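(* Let $\alpha>-1$ and $i\in\mathbb{S}$. Let $T$ be a bounded positive operator on the slice Bergman space $\mathcal{A}^2_{\alpha,i}(\mathbb{D})$ and let $(\lambda_n)_{n\in\mathbb{N}}$ be its sequence of singular values. If $$d\mu_i(z)=\frac{1}{\pi(1-|z|^2)^2}\,dm_i(z)$$ is the $\mathbb{C}_i$-Möbius invariant area measure on $\mathbb{D}_i$, then $$\sum_{n=1}^{+\infty}\lambda_n=(\alpha+1)\int_{\mathbb{D}_i}\widetilde{T}(z)\,d\mu_i(z).$$
   Context: $\mathbb{H}$ denotes the quaternions, $\mathbb{D}$ its open unit ball, $\mathbb{S}=\{x\in\mathbb{H}:\operatorname{Re}(x)=0,\ |x|=1\}$, $\mathbb{C}_i=\{a+ib:a,b\in\mathbb{R}\}$, $\mathbb{D}_i=\mathbb{D}\cap\mathbb{C}_i$, and $dm_i$ is Lebesgue measure on $\mathbb{C}_i$. Every $x\in\mathbb{H}$ is written $x=x_0+i_xx_1$ with $x_0=\operatorname{Re}(x)$, $x_1$ the modulus of the imaginary part, $i_x\in\mathbb{S}$. A real differentiable $f:\mathbb{D}\to\mathbb{H}$ is left slice hyperholomorphic if $f(x)=u(x_0,x_1)+i_xv(x_0,x_1)$ with $\mathbb{H}$-valued $u,v$ satisfying $u(x_0,x_1)=u(x_0,-x_1)$, $v(x_0,x_1)=-v(x_0,-x_1)$, $\partial_{x_0}u=\partial_{x_1}v$ and $\partial_{x_0}v=-\partial_{x_1}u$. $dA_{\alpha,i}(z)=\frac{\alpha+1}{\pi}(1-|z|^2)^\alpha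 dm_i(z)$ on $\mathbb{D}_i$. $\mathcal{A}^2_{\alpha,i}(\mathbb{D})$ is the right $\mathbb{H}$-vector space of all left slice hyperholomorphic $f$ on $\mathbb{D}$ with $\int_{\mathbb{D}_i}|f|^2dA_{\alpha,i}<\infty$, with scalar product $\langle f,g\rangle=\int_{\mathbb{D}_i}\overline{f(z)}g(z)\,dA_{\alpha,i}(z)$; it is a quaternionic reproducing kernel Hilbert space. $K_w$ denotes the unique element with $f(w)=\langle K_w,f\rangle$ for all $f$; for $z,w\in\mathbb{D}_i$ one has $K_w(z)=(1-z\overline w)^{-(2+\alpha)}$. Set $k_w=K_w/\|K_w\|$. For a bounded right $\mathbb{H}$-linear operator $T$, the Berezin transform is $\widetilde{T}(z)=\langle k_z,Tk_z\rangle$ for $z\in\mathbb{D}_i$. Operators are right $\mathbb{H}$-linear, and $T$ is positive if $\langle f,Tf\rangle\ge0$ for all $f$. Singular values are defined as follows: for a compact operator $T$, they are the eigenvalues of $|T|=\sqrt{T^*T}$ in decreasing order, counted with multiplicity. *)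

theory Defs
  imports "HOL-Analysis.Analysis"
begin

section \<open>Quaternions\<close>

codatatype quat = Quat (qRe: real) (qI: real) (qJ: real) (qK: real)

lemma quat_eqI [intro?]:
  "qRe x = qRe y \<Longrightarrow> qI x = qI y \<Longrightarrow> qJ x = qJ y \<Longrightarrow> qK x = qK y \<Longrightarrow> x = y"
  by (rule quat.expand) simp

lemma quat_eq_iff:
  "x = y \<longleftrightarrow> qRe x = qRe y \<and> qI x = qI y \<and> qJ x = qJ y \<and> qK x = qK y"
  by (auto intro: quat_eqI)

instantiation quat :: ab_group_add
begin

primcorec zero_quat where
  "qRe 0 = 0" | "qI 0 = 0" | "qJ 0 = 0" | "qK 0 = 0"

primcorec plus_quat where
  "qRe (x + y) = qRe x + qRe y"
| "qI (x + y) = qI x + qI y"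
| "qJ (x + y) = qJ x + qJ y"
| "qK (x + y) = qK x + qK y"

primcorec uminus_quat where
  "qRe (- x) = - qRe x" | "qI (- x) = - qI x" | "qJ (- x) = - qJ x" | "qK (- x) = - qK x"

primcorec minus_quat where
  "qRe (x - y) = qRe x - qRe y"
| "qI (x - y) = qI x - qI y"
| "qJ (x - y) = qJ x - qJ y"
| "qK (x - y) = qK x - qK y"

instance
  by standard (simp_all add: quat_eq_iff)

end

instantiation quat :: ring_1
begin

primcorec one_quat where
  "qRe 1 = 1" | "qI 1 = 0" | "qJ 1 = 0" | "qK 1 = 0"

primcorec times_quat where
  "qRe (x * y) = qRe x * qRe y - qI x * qI y - qJ x * qJ y - qK x * qK y"
| "qI (x * y) = qRe x * qI y + qI x * qRe y + qJ x * qK y - qK x * qJ y"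
| "qJ (x * y) = qRe x * qJ y - qI x * qK y + qJ x * qRe y + qK x * qI y"
| "qK (x * y) = qRe x * qK y + qI x * qJ y - qJ x * qI y + qK x * qRe y"

instance
  by standard (simp_all add: quat_eq_iff algebra_simps)

end

instantiation quat :: real_algebra_1
begin

primcorec scaleR_quat where
  "qRe (scaleR r x) = r * qRe x"
| "qI (scaleR r x) = r * qI x"
| "qJ (scaleR r x) = r * qJ x"
| "qK (scaleR r x) = r * qK x"

instance
  by standard (simp_all add: quat_eq_iff algebra_simps)

end

primcorec qcnj :: "quat \<Rightarrow> quat" where
  "qRe (qcnj x) = qRe x" | "qI (qcnj x) = - qI x" | "qJ (qcnj x) = - qJ x" | "qK (qcnj x) = - qK x"

definition qnorm_sq :: "quat \<Rightarrow> real" where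
  "qnorm_sq x = (qRe x)\<^sup>2 + (qI x)\<^sup>2 + (qJ x)\<^sup>2 + (qK x)\<^sup>2"

lemma qnorm_sq_nonneg: "0 \<le> qnorm_sq x"
  by (simp add: qnorm_sq_def)

lemma qnorm_sq_eq_0_iff: "qnorm_sq x = 0 \<longleftrightarrow> x = 0"
proof
  assume h: "qnorm_sq x = 0"
  note nn = zero_le_power2[of "qRe x"] zero_le_power2[of "qI x"]
    zero_le_power2[of "qJ x"] zero_le_power2[of "qK x"]
  have "(qRe x)\<^sup>2 = 0" using h nn unfolding qnorm_sq_def by linarith
  moreover have "(qI x)\<^sup>2 = 0" using h nn unfolding qnorm_sq_def by linarith
  moreover have "(qJ x)\<^sup>2 = 0" using h nn unfolding qnorm_sq_def by linarith
  moreover have "(qK x)\<^sup>2 = 0" using h nn unfolding qnorm_sq_def by linarith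
  ultimately show "x = 0"
    by (simp add: quat_eq_iff)
qed (simp add: qnorm_sq_def)

lemma mult_qcnj: "x * qcnj x = qnorm_sq x *\<^sub>R 1"
  by (simp add: quat_eq_iff qnorm_sq_def power2_eq_square)

lemma qcnj_mult_self: "qcnj x * x = qnorm_sq x *\<^sub>R 1"
  by (simp add: quat_eq_iff qnorm_sq_def power2_eq_square)

lemma qcnj_mult: "qcnj (x * y) = qcnj y * qcnj x"
  by (simp add: quat_eq_iff)

lemma qnorm_sq_mult: "qnorm_sq (x * y) = qnorm_sq x * qnorm_sq y"
proof -
  have "qnorm_sq (x * y) *\<^sub>R (1 :: quat) = x * (y * qcnj y) * qcnj x"
    by (simp only: mult_qcnj[symmetric] qcnj_mult mult.assoc)
  also have "\<dots> = qnorm_sq y *\<^sub>R (x * qcnj x)"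
    by (simp only: mult_qcnj[of y] mult_scaleR_right mult_scaleR_left mult_1_right)
  also have "\<dots> = (qnorm_sq x * qnorm_sq y) *\<^sub>R 1"
    by (simp only: mult_qcnj[of x] scaleR_scaleR mult.commute)
  finally have "qRe (qnorm_sq (x * y) *\<^sub>R 1) = qRe ((qnorm_sq x * qnorm_sq y) *\<^sub>R 1)"
    by (rule arg_cong)
  then show ?thesis
    by simp
qed

instantiation quat :: real_div_algebra
begin

definition "inverse x = qcnj x /\<^sub>R qnorm_sq x" for x :: quat

definition "x div y = x * inverse y" for x y :: quat

instance
proof
  fix x y :: quat
  show "inverse 0 = (0 :: quat)"
    by (simp add: inverse_quat_def quat_eq_iff)
  show "x div y = x * inverse y"
    by (rule divide_quat_def)
  assume "x \<noteq> 0"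
  then have "qnorm_sq x \<noteq> 0"
    by (simp add: qnorm_sq_eq_0_iff)
  then show "inverse x * x = 1" "x * inverse x = 1"
    by (simp_all add: inverse_quat_def mult_qcnj qcnj_mult_self)
qed

end

instantiation quat :: real_inner
begin

definition "inner x y = qRe x * qRe y + qI x * qI y + qJ x * qJ y + qK x * qK y" for x y :: quat

definition "norm x = sqrt (qnorm_sq x)"

definition "sgn x = x /\<^sub>R norm x" for x :: quat

definition "dist x y = norm (x - y)" for x y :: quat

definition uniformity_quat_def:
  "(uniformity :: (quat \<times> quat) filter) = (INF e\<in>{0 <..}. principal {(x, y). dist x y < e})"

definition open_quat_def:
  "open (U :: quat set) \<longleftrightarrow> (\<forall>x\<in>U. eventually (\<lambda>(x', y). x' = x \<longrightarrow> y \<in> U) uniformity)"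

instance
proof
  fix x y z :: quat and r :: real and U :: "quat set"
  show "sgn x = x /\<^sub>R norm x" "dist x y = norm (x - y)"
    by (rule sgn_quat_def dist_quat_def)+
  show "(uniformity :: (quat \<times> quat) filter) = (INF e\<in>{0 <..}. principal {(x, y). dist x y < e})"
    by (rule uniformity_quat_def)
  show "open U \<longleftrightarrow> (\<forall>x\<in>U. eventually (\<lambda>(x', y). x' = x \<longrightarrow> y \<in> U) uniformity)"
    by (rule open_quat_def)
  show "inner x y = inner y x" "inner (x + y) z = inner x z + inner y z"
    "inner (scaleR r x) y = r * inner x y"
    by (simp_all add: inner_quat_def algebra_simps)
  show "0 \<le> inner x x"
    by (simp add: inner_quat_def)
  show "inner x x = 0 \<longleftrightarrow> x = 0"
    using qnorm_sq_eq_0_iff[of x] by (simp add: inner_quat_def qnorm_sq_def power2_eq_square)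
  show "norm x = sqrt (inner x x)"
    by (simp add: inner_quat_def norm_quat_def qnorm_sq_def power2_eq_square)
qed

end

instance quat :: real_normed_div_algebra
proof
  fix x y :: quat
  show "norm (x * y) = norm x * norm y"
    by (simp add: norm_quat_def qnorm_sq_mult real_sqrt_mult)
qed

instantiation quat :: euclidean_space
begin

definition "Basis = {Quat 1 0 0 0, Quat 0 1 0 0, Quat 0 0 1 0, Quat 0 0 0 1}"

instance
proof
  show "(Basis :: quat set) \<noteq> {}" "finite (Basis :: quat set)"
    by (simp_all add: Basis_quat_def)
  fix x u v :: quat
  show "u \<in> Basis \<Longrightarrow> v \<in> Basis \<Longrightarrow> inner u v = (if u = v then 1 else 0)"
    unfolding Basis_quat_def by (elim insertE emptyE) (simp_all add: inner_quat_def)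
  show "(\<forall>u\<in>Basis. inner x u = 0) \<longleftrightarrow> x = 0"
    by (simp add: Basis_quat_def inner_quat_def quat_eq_iff[of x])
qed

end

definition imag_units :: "quat set" where
  "imag_units = {x. qRe x = 0 \<and> norm x = 1}"

section \<open>Slice hyperholomorphic functions on the unit ball\<close>

text \<open>
  A representation \<open>x = x\<^sub>0 + i\<^sub>x x\<^sub>1\<close> of a quaternion consists of reals \<open>x\<^sub>0\<close>, \<open>x\<^sub>1 \<ge> 0\<close> and an
  imaginary unit \<open>i\<^sub>x\<close>; for real \<open>x\<close> one has \<open>x\<^sub>1 = 0\<close> and \<open>i\<^sub>x\<close> is arbitrary. The functions \<open>u\<close> and \<open>v\<close>
  live on the planar unit disc, also for negative second argument.
\<close>
definition slice_hyperholomorphic :: "(quat \<Rightarrow> quat) \<Rightarrow> bool" where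
  "slice_hyperholomorphic f \<longleftrightarrow>
     f differentiable_on ball 0 1 \<and>
     (\<exists>u v :: real \<Rightarrow> real \<Rightarrow> quat.
        (\<forall>j\<in>imag_units. \<forall>a b. b \<ge> 0 \<and> a\<^sup>2 + b\<^sup>2 < 1 \<longrightarrow>
           f (of_real a + j * of_real b) = u a b + j * v a b) \<and>
        (\<forall>a b. a\<^sup>2 + b\<^sup>2 < 1 \<longrightarrow>
           u a b = u a (- b) \<and> v a b = - v a (- b) \<and>
           (\<exists>p q.
              ((\<lambda>s. u s b) has_vector_derivative p) (at a) \<and>
              ((\<lambda>t. v a t) has_vector_derivative p) (at b) \<and>
              ((\<lambda>s. v s b) has_vector_derivative q) (at a) \<and>
              ((\<lambda>t. u a t) has_vector_derivative - q) (at b))))"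

section \<open>Slice Bergman spaces\<close>

definition slice_embed :: "quat \<Rightarrow> complex \<Rightarrow> quat" where
  "slice_embed i z = of_real (Re z) + i * of_real (Im z)"

definition slice_disc :: "quat \<Rightarrow> quat set" where
  "slice_disc i = ball 0 1 \<inter> range (slice_embed i)"

text \<open>
  Lebesgue measure on the slice, as a measure on the quaternions concentrated on the slice.
\<close>
definition slice_lebesgue :: "quat \<Rightarrow> quat measure" where
  "slice_lebesgue i = distr lborel borel (slice_embed i)"

definition slice_area :: "real \<Rightarrow> quat \<Rightarrow> quat measure" where
  "slice_area \<alpha> i = density (slice_lebesgue i)
     (\<lambda>z. ennreal ((\<alpha> + 1) / pi * (1 - (norm z)\<^sup>2) powr \<alpha>) * indicator (slice_disc i) z)"

definition slice_moebius_area :: "quat \<Rightarrow> quat measure" where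
  "slice_moebius_area i = density (slice_lebesgue i)
     (\<lambda>z. ennreal (1 / (pi * (1 - (norm z)\<^sup>2)\<^sup>2)) * indicator (slice_disc i) z)"

text \<open>
  Functions on the open unit ball are represented by their extension by \<open>0\<close>, so that equality of
  functions on the ball is equality in HOL. The vector space operations are pointwise, with scalars
  acting by multiplication on the right.
\<close>
definition slice_bergman :: "real \<Rightarrow> quat \<Rightarrow> (quat \<Rightarrow> quat) set" where
  "slice_bergman \<alpha> i =
     {f. slice_hyperholomorphic f \<and> (\<forall>x. x \<notin> ball 0 1 \<longrightarrow> f x = 0) \<and>
         integrable (slice_area \<alpha> i) (\<lambda>z. (norm (f z))\<^sup>2)}"

definition slice_inner :: "real \<Rightarrow> quat \<Rightarrow> (quat \<Rightarrow> quat) \<Rightarrow> (quat \<Rightarrow> quat) \<Rightarrow> quat" where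
  "slice_inner \<alpha> i f g = (LINT z|slice_area \<alpha> i. qcnj (f z) * g z)"

definition slice_norm :: "real \<Rightarrow> quat \<Rightarrow> (quat \<Rightarrow> quat) \<Rightarrow> real" where
  "slice_norm \<alpha> i f = sqrt (qRe (slice_inner \<alpha> i f f))"

definition bergman_kernel :: "real \<Rightarrow> quat \<Rightarrow> quat \<Rightarrow> quat \<Rightarrow> quat" where
  "bergman_kernel \<alpha> i w =
     (THE k. k \<in> slice_bergman \<alpha> i \<and> (\<forall>f\<in>slice_bergman \<alpha> i. f w = slice_inner \<alpha> i k f))"

definition normalized_kernel :: "real \<Rightarrow> quat \<Rightarrow> quat \<Rightarrow> quat \<Rightarrow> quat" where
  "normalized_kernel \<alpha> i w =
     (\<lambda>x. bergman_kernel \<alpha> i w x /\<^sub>R slice_norm \<alpha> i (bergman_kernel \<alpha> i w))"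

section \<open>Operators on the slice Bergman space\<close>

text \<open>
  Operators are HOL functions of which only the values on the Bergman space matter.
\<close>
definition bounded_operator ::
    "real \<Rightarrow> quat \<Rightarrow> ((quat \<Rightarrow> quat) \<Rightarrow> (quat \<Rightarrow> quat)) \<Rightarrow> bool" where
  "bounded_operator \<alpha> i T \<longleftrightarrow>
     (\<forall>f\<in>slice_bergman \<alpha> i. T f \<in> slice_bergman \<alpha> i) \<and>
     (\<forall>f\<in>slice_bergman \<alpha> i. \<forall>g\<in>slice_bergman \<alpha> i. T (\<lambda>x. f x + g x) = (\<lambda>x. T f x + T g x)) \<and>
     (\<forall>f\<in>slice_bergman \<alpha> i. \<forall>q. T (\<lambda>x. f x * q) = (\<lambda>x. T f x * q)) \<and>
     (\<exists>C. \<forall>f\<in>slice_bergman \<alpha> i. slice_norm \<alpha> i (T f) \<le> C * slice_norm \<alpha> i f)"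

text \<open>The scalar product \<open>\<langle>f, T f\<rangle>\<close> is a quaternion; it has to be real and nonnegative.\<close>
definition positive_operator ::
    "real \<Rightarrow> quat \<Rightarrow> ((quat \<Rightarrow> quat) \<Rightarrow> (quat \<Rightarrow> quat)) \<Rightarrow> bool" where
  "positive_operator \<alpha> i T \<longleftrightarrow>
     (\<forall>f\<in>slice_bergman \<alpha> i. \<exists>r\<ge>0. slice_inner \<alpha> i f (T f) = of_real r)"

definition adjoint_operator ::
    "real \<Rightarrow> quat \<Rightarrow> ((quat \<Rightarrow> quat) \<Rightarrow> (quat \<Rightarrow> quat)) \<Rightarrow> ((quat \<Rightarrow> quat) \<Rightarrow> (quat \<Rightarrow> quat)) \<Rightarrow> bool" where
  "adjoint_operator \<alpha> i T A \<longleftrightarrow>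
     bounded_operator \<alpha> i A \<and>
     (\<forall>f\<in>slice_bergman \<alpha> i. \<forall>g\<in>slice_bergman \<alpha> i.
        slice_inner \<alpha> i (A f) g = slice_inner \<alpha> i f (T g))"

text \<open>\<open>S = |T|\<close>, the positive square root of \<open>T\<^sup>* T\<close>.\<close>
definition modulus_operator ::
    "real \<Rightarrow> quat \<Rightarrow> ((quat \<Rightarrow> quat) \<Rightarrow> (quat \<Rightarrow> quat)) \<Rightarrow> ((quat \<Rightarrow> quat) \<Rightarrow> (quat \<Rightarrow> quat)) \<Rightarrow> bool" where
  "modulus_operator \<alpha> i T S \<longleftrightarrow>
     bounded_operator \<alpha> i S \<and> positive_operator \<alpha> i S \<and>
     (\<exists>A. adjoint_operator \<alpha> i T A \<and> (\<forall>f\<in>slice_bergman \<alpha> i. S (S f) = A (T f)))"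

definition compact_operator ::
    "real \<Rightarrow> quat \<Rightarrow> ((quat \<Rightarrow> quat) \<Rightarrow> (quat \<Rightarrow> quat)) \<Rightarrow> bool" where
  "compact_operator \<alpha> i T \<longleftrightarrow>
     bounded_operator \<alpha> i T \<and>
     (\<forall>F :: nat \<Rightarrow> quat \<Rightarrow> quat. \<forall>C.
        (\<forall>n. F n \<in> slice_bergman \<alpha> i \<and> slice_norm \<alpha> i (F n) \<le> C) \<longrightarrow>
        (\<exists>r g. strict_mono r \<and> g \<in> slice_bergman \<alpha> i \<and>
           (\<lambda>n. slice_norm \<alpha> i (\<lambda>x. T (F (r n)) x - g x)) \<longlonglongrightarrow> 0))"

definition eigenspace ::
    "real \<Rightarrow> quat \<Rightarrow> ((quat \<Rightarrow> quat) \<Rightarrow> (quat \<Rightarrow> quat)) \<Rightarrow> real \<Rightarrow> (quat \<Rightarrow> quat) set" where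
  "eigenspace \<alpha> i S t = {f \<in> slice_bergman \<alpha> i. S f = (\<lambda>x. f x * of_real t)}"

text \<open>\<open>E\<close> is a right quaternionic vector space with a basis of \<open>n\<close> elements.\<close>
definition has_right_dim :: "(quat \<Rightarrow> quat) set \<Rightarrow> nat \<Rightarrow> bool" where
  "has_right_dim E n \<longleftrightarrow>
     (\<exists>B. finite B \<and> card B = n \<and>
        E = range (\<lambda>c x. \<Sum>b\<in>B. b x * c b) \<and>
        (\<forall>c. (\<forall>x. (\<Sum>b\<in>B. b x * c b) = 0) \<longrightarrow> (\<forall>b\<in>B. c b = 0)))"

text \<open>
  The eigenvalues of the positive operator \<open>|T|\<close> are nonnegative reals. The sequence \<open>s\<close> is
  decreasing and lists every positive eigenvalue as often as its multiplicity, the right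
  quaternionic dimension of the eigenspace; if there are only finitely many of them it continues
  with zeros. Indices start at \<open>0\<close>. Singular values exist for compact operators only.
\<close>
definition singular_value_sequence ::
    "real \<Rightarrow> quat \<Rightarrow> ((quat \<Rightarrow> quat) \<Rightarrow> (quat \<Rightarrow> quat)) \<Rightarrow> (nat \<Rightarrow> real) \<Rightarrow> bool" where
  "singular_value_sequence \<alpha> i T s \<longleftrightarrow>
     compact_operator \<alpha> i T \<and>
     (\<exists>S. modulus_operator \<alpha> i T S \<and>
        decseq s \<and> (\<forall>n. s n \<ge> 0) \<and>
        (\<forall>t>0. finite {n. s n = t} \<and> has_right_dim (eigenspace \<alpha> i S t) (card {n. s n = t})))"

definition berezin_transform ::
    "real \<Rightarrow> quat \<Rightarrow> ((quat \<Rightarrow> quat) \<Rightarrow> (quat \<Rightarrow> quat)) \<Rightarrow> quat \<Rightarrow> quat" where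
  "berezin_transform \<alpha> i T z =
     slice_inner \<alpha> i (normalized_kernel \<alpha> i z) (T (normalized_kernel \<alpha> i z))"

end

(*
  Every f in the space satisfies f(z) = <K_z, f>, and ||K_z||^2 = K_z(z) = (1 - |z|^2)^{-(2 + alpha)},
  so (alpha + 1) times the Moebius area turns the Berezin transform of T into
  <K_z, T K_z> with respect to the weighted area measure. A positive operator is self-adjoint and has
  the same eigenspaces for positive eigenvalues as |T|. For compact T these diagonalise the quadratic
  form: <f, T f> = sum_n s_n |<e_n, f>|^2 with orthonormal e_n. At f = K_z the n-th term is
  s_n |e_n(z)|^2, whose integral is s_n.

  The diagonalisation does not use completeness: compactness itself supplies the limit of a
  maximising sequence. The reproducing property is reduced to scalar holomorphic functions by the
  left C_i-linear coordinate of f(z) q, for all right factors q; there it is the orthogonality of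
  monomials, which follows from the invariance of the measure under rotations.
*)
theory Submission
  imports Defs "HOL-Complex_Analysis.Complex_Analysis" "HOL-Library.Function_Algebras"
begin

section \<open>Quaternionic inner product spaces\<close>

text \<open>Both sides of the formula are extended nonnegative reals, so an infinite trace is
  covered and sum and integral are exchanged by monotone convergence. The factor
  \<open>\<alpha> + 1\<close> is the normalising constant of the weighted area measure.
  Noncommutativity shapes the rest. Scalars act on the right, whereas the Cauchy-Riemann equations
  and the kernel act from the left; power series therefore carry their coefficients on the right. An
  estimate such as Cauchy-Schwarz controls only the real part of a scalar product; the other
  components are recovered by letting a right factor \<open>q\<close> vary. The scalar product sees
  a single slice, but the elements are functions on the whole ball. Definiteness needs two facts:
  the reproducing formula turns vanishing almost everywhere on the slice into vanishing everywhere
  on it, and one slice determines the function. Hence the kernel is built explicitly as a power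
  series on the ball, and the definite description \<open>bergman_kernel\<close> is identified with
  it only afterwards.\<close>

lemma quat_real_iff_qcnj: "q = of_real (qRe q) \<longleftrightarrow> qcnj q = q"
  by (auto simp: of_real_def quat_eq_iff)

lemma qRe_of_real [simp]: "qRe (of_real r) = r" "qI (of_real r) = 0" "qJ (of_real r) = 0" "qK (of_real r) = 0"
  by (simp_all add: of_real_def)

lemma qcnj_simps [simp]: "qcnj (of_real r) = of_real r" "qcnj (qcnj p) = p" "qcnj 0 = 0" "qcnj 1 = 1"
  "qcnj (p + q) = qcnj p + qcnj q" "qcnj (p - q) = qcnj p - qcnj q" "qcnj (- p) = - qcnj p"
  by (simp_all add: quat_eq_iff)

lemma mult_qcnj_norm: "q * qcnj q = of_real ((norm q)\<^sup>2)" "qcnj q * q = of_real ((norm q)\<^sup>2)"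
  using qnorm_sq_nonneg[of q]
  by (simp_all add: mult_qcnj qcnj_mult_self norm_quat_def of_real_def)

lemma norm_qcnj [simp]: "norm (qcnj q) = norm q"
  by (simp add: norm_quat_def qnorm_sq_def)

lemma of_real_mult_quat_commute: "of_real r * q = q * (of_real r :: quat)"
  by (simp add: quat_eq_iff)

lemma of_real_mult_quat_left_commute: "p * (of_real r * q) = of_real r * (p * q :: quat)"
  by (simp add: quat_eq_iff algebra_simps)

text \<open>The carrier is a set and not a type because the Bergman space is a proper subset of the
  additive group of functions. The scalar laws hold for all vectors, since they are pointwise
  identities there; only the laws of \<open>ip\<close> need integrability and hence
  membership.\<close>

locale quat_inner_space =
  fixes H :: "'v::ab_group_add set" and rs :: "'v \<Rightarrow> quat \<Rightarrow> 'v" (infixl "\<star>" 75)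
    and ip :: "'v \<Rightarrow> 'v \<Rightarrow> quat"
  assumes rs_add_left: "(f + g) \<star> q = f \<star> q + g \<star> q"
    and rs_add_right: "f \<star> (p + q) = f \<star> p + f \<star> q"
    and rs_mult: "f \<star> (p * q) = (f \<star> p) \<star> q"
    and rs_one [simp]: "f \<star> 1 = f"
    and zero_mem [simp, intro]: "0 \<in> H"
    and add_mem [simp, intro]: "f \<in> H \<Longrightarrow> g \<in> H \<Longrightarrow> f + g \<in> H"
    and rs_mem [simp, intro]: "f \<in> H \<Longrightarrow> f \<star> q \<in> H"
    and ip_add_right: "f \<in> H \<Longrightarrow> g \<in> H \<Longrightarrow> h \<in> H \<Longrightarrow> ip f (g + h) = ip f g + ip f h"
    and ip_rs_right: "f \<in> H \<Longrightarrow> g \<in> H \<Longrightarrow> ip f (g \<star> q) = ip f g * q"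
    and ip_cnj: "f \<in> H \<Longrightarrow> g \<in> H \<Longrightarrow> qcnj (ip f g) = ip g f"
    and ip_self_nonneg: "f \<in> H \<Longrightarrow> 0 \<le> qRe (ip f f)"
    and ip_self_zeroD: "f \<in> H \<Longrightarrow> qRe (ip f f) = 0 \<Longrightarrow> f = 0"
begin

lemma rs_zero_left [simp]: "0 \<star> q = 0"
  using rs_add_left[of 0 0 q] by simp

lemma rs_zero_right [simp]: "f \<star> 0 = 0"
  using rs_add_right[of f 0 0] by simp

lemma rs_minus_one [simp]: "f \<star> (- 1) = - f"
  using rs_add_right[of f 1 "- 1"] by (simp add: eq_neg_iff_add_eq_0 add.commute)

lemma rs_minus_left: "(- f) \<star> q = - (f \<star> q)"
  using rs_add_left[of f "- f" q] by (simp add: eq_neg_iff_add_eq_0 add.commute)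

lemma rs_diff_left: "(f - g) \<star> q = f \<star> q - g \<star> q"
  using rs_add_left[of f "- g" q] by (simp add: rs_minus_left)

lemma rs_sum_left: "(\<Sum>x\<in>A. f x) \<star> q = (\<Sum>x\<in>A. f x \<star> q)"
  by (induction A rule: infinite_finite_induct) (simp_all add: rs_add_left)

lemma minus_mem [simp, intro]: "f \<in> H \<Longrightarrow> - f \<in> H"
  using rs_mem[of f "- 1"] by simp

lemma diff_mem [simp, intro]: "f \<in> H \<Longrightarrow> g \<in> H \<Longrightarrow> f - g \<in> H"
  using add_mem[of f "- g"] by simp

lemma sum_mem: "(\<And>x. x \<in> A \<Longrightarrow> f x \<in> H) \<Longrightarrow> (\<Sum>x\<in>A. f x) \<in> H"
  by (induction A rule: infinite_finite_induct) auto

lemma ip_zero_right [simp]: "f \<in> H \<Longrightarrow> ip f 0 = 0"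
  using ip_rs_right[of f f 0] by simp

lemma ip_zero_left [simp]: "f \<in> H \<Longrightarrow> ip 0 f = 0"
  using ip_cnj[of f 0] by simp

lemma ip_minus_right: "f \<in> H \<Longrightarrow> g \<in> H \<Longrightarrow> ip f (- g) = - ip f g"
  using ip_rs_right[of f g "- 1"] by simp

lemma ip_diff_right: "f \<in> H \<Longrightarrow> g \<in> H \<Longrightarrow> h \<in> H \<Longrightarrow> ip f (g - h) = ip f g - ip f h"
  using ip_add_right[of f g "- h"] by (simp add: ip_minus_right)

lemma ip_add_left: "f \<in> H \<Longrightarrow> g \<in> H \<Longrightarrow> h \<in> H \<Longrightarrow> ip (f + g) h = ip f h + ip g h"
  using ip_add_right[of h f g] by (simp flip: ip_cnj[of h])

lemma ip_diff_left: "f \<in> H \<Longrightarrow> g \<in> H \<Longrightarrow> h \<in> H \<Longrightarrow> ip (f - g) h = ip f h - ip g h"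
  using ip_diff_right[of h f g] by (simp flip: ip_cnj[of h])

lemma ip_rs_left: "f \<in> H \<Longrightarrow> g \<in> H \<Longrightarrow> ip (f \<star> q) g = qcnj q * ip f g"
  using ip_rs_right[of g f q] by (simp flip: ip_cnj[of g] add: qcnj_mult)

lemma ip_sum_right:
  "f \<in> H \<Longrightarrow> (\<And>x. x \<in> A \<Longrightarrow> g x \<in> H) \<Longrightarrow> ip f (\<Sum>x\<in>A. g x) = (\<Sum>x\<in>A. ip f (g x))"
  by (induction A rule: infinite_finite_induct) (auto simp: ip_add_right sum_mem)

definition sqn :: "'v \<Rightarrow> real" where "sqn f = qRe (ip f f)"

lemma ip_self: "f \<in> H \<Longrightarrow> ip f f = of_real (sqn f)"
  using ip_cnj[of f f] quat_real_iff_qcnj[of "ip f f"] by (simp add: sqn_def)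

lemma sqn_nonneg: "f \<in> H \<Longrightarrow> 0 \<le> sqn f"
  by (simp add: sqn_def ip_self_nonneg)

lemma sqn_zero [simp]: "sqn 0 = 0"
  by (simp add: sqn_def)

lemma sqn_eq_0D: "f \<in> H \<Longrightarrow> sqn f = 0 \<Longrightarrow> f = 0"
  by (simp add: sqn_def ip_self_zeroD)

lemma sqn_pos: "f \<in> H \<Longrightarrow> f \<noteq> 0 \<Longrightarrow> 0 < sqn f"
  using sqn_nonneg[of f] sqn_eq_0D[of f] by (cases "sqn f = 0") auto

lemma qRe_ip_sym: "f \<in> H \<Longrightarrow> g \<in> H \<Longrightarrow> qRe (ip f g) = qRe (ip g f)"
  by (simp flip: ip_cnj[of f])

lemma sqn_rs: "f \<in> H \<Longrightarrow> sqn (f \<star> q) = sqn f * (norm q)\<^sup>2"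
proof -
  assume f: "f \<in> H"
  have "ip (f \<star> q) (f \<star> q) = qcnj q * (of_real (sqn f) * q)"
    using f by (simp add: ip_rs_left ip_rs_right ip_self[OF f] mult.assoc)
  also have "\<dots> = qcnj q * q * of_real (sqn f)"
    by (simp only: of_real_mult_quat_commute mult.assoc)
  also have "\<dots> = of_real ((norm q)\<^sup>2 * sqn f)"
    by (simp only: mult_qcnj_norm of_real_mult)
  finally have "qRe (ip (f \<star> q) (f \<star> q)) = (norm q)\<^sup>2 * sqn f"
    by (simp only: qRe_of_real)
  then show ?thesis by (simp add: sqn_def)
qed

lemma sqn_diff: "f \<in> H \<Longrightarrow> g \<in> H \<Longrightarrow> sqn (f - g) = sqn f - 2 * qRe (ip f g) + sqn g"
  using qRe_ip_sym[of f g] by (simp add: sqn_def ip_diff_left ip_diff_right)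

lemma sqn_add: "f \<in> H \<Longrightarrow> g \<in> H \<Longrightarrow> sqn (f + g) = sqn f + 2 * qRe (ip f g) + sqn g"
  using qRe_ip_sym[of f g] by (simp add: sqn_def ip_add_left ip_add_right)

text \<open>The parallelogram identity without its term \<open>sqn (f + g)\<close>. It takes the
  place of the triangle inequality, so that all limits can be handled with squared norms.\<close>

lemma sqn_diff_le: "f \<in> H \<Longrightarrow> g \<in> H \<Longrightarrow> sqn (f - g) \<le> 2 * sqn f + 2 * sqn g"
  using sqn_nonneg[of "f + g"] by (simp add: sqn_add sqn_diff)

section \<open>Right linear spans and orthonormal bases\<close>

definition rspan :: "'v set \<Rightarrow> 'v set" where
  "rspan B = range (\<lambda>c. \<Sum>b\<in>B. b \<star> c b)"

lemma rspan_add: "f \<in> rspan B \<Longrightarrow> g \<in> rspan B \<Longrightarrow> f + g \<in> rspan B"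
  unfolding rspan_def
  by (auto simp: rs_add_right[symmetric] sum.distrib[symmetric])

lemma rspan_rs: "f \<in> rspan B \<Longrightarrow> f \<star> q \<in> rspan B"
  unfolding rspan_def by (auto simp: rs_sum_left rs_mult[symmetric])

lemma rspan_zero: "0 \<in> rspan B"
  unfolding rspan_def by (rule range_eqI[of _ _ "\<lambda>_. 0"]) simp

lemma rspan_sum: "(\<And>x. x \<in> A \<Longrightarrow> f x \<in> rspan B) \<Longrightarrow> (\<Sum>x\<in>A. f x) \<in> rspan B"
  by (induction A rule: infinite_finite_induct) (auto simp: rspan_add rspan_zero)

lemma rspan_base: "finite B \<Longrightarrow> b \<in> B \<Longrightarrow> b \<in> rspan B"
  unfolding rspan_def
  by (rule range_eqI[of _ _ "\<lambda>x. if x = b then 1 else 0"]) (simp add: if_distrib cong: if_cong)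

lemma rspan_least: "B \<subseteq> rspan C \<Longrightarrow> rspan B \<subseteq> rspan C"
  unfolding rspan_def[of B] by (auto intro!: rspan_sum rspan_rs)

definition orthonormal :: "'v set \<Rightarrow> bool" where
  "orthonormal U \<longleftrightarrow> (\<forall>u\<in>U. \<forall>v\<in>U. ip u v = (if u = v then 1 else 0))"

lemma orthonormal_expansion:
  assumes "finite U" "U \<subseteq> H" "orthonormal U" "f \<in> rspan U"
  shows "f = (\<Sum>u\<in>U. u \<star> ip u f)"
proof -
  obtain c where f: "f = (\<Sum>u\<in>U. u \<star> c u)" using assms(4) by (auto simp: rspan_def)
  have "ip v f = c v" if "v \<in> U" for v
  proof -
    have "ip v f = (\<Sum>u\<in>U. ip v u * c u)"
      unfolding f using assms(2) that by (subst ip_sum_right) (auto simp: ip_rs_right subset_eq)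
    also have "\<dots> = (\<Sum>u\<in>U. if u = v then c u else 0)"
      using assms(3) that by (intro sum.cong) (auto simp: orthonormal_def)
    finally show ?thesis using assms(1) that by simp
  qed
  then show ?thesis by (subst f) (simp cong: sum.cong)
qed

text \<open>Multiplicity is a right dimension, so a basis of an eigenspace must become an
  orthonormal one with the same number of elements and the same span. Independence is expressed by
  coefficients, as in \<open>has_right_dim\<close>; it keeps every remainder \<open>d\<close>
  nonzero.\<close>

lemma gram_schmidt:
  assumes "finite B" "B \<subseteq> H" "\<And>c. (\<Sum>b\<in>B. b \<star> c b) = 0 \<Longrightarrow> \<forall>b\<in>B. c b = 0"
  shows "\<exists>U. finite U \<and> card U = card B \<and> U \<subseteq> H \<and> U \<subseteq> rspan B \<and> B \<subseteq> rspan U \<and> orthonormal U"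
  using assms
proof (induction B)
  case empty
  then show ?case by (intro exI[of _ "{}"]) (simp add: orthonormal_def)
next
  case (insert b B)
  have "\<forall>x\<in>B. c x = 0" if "(\<Sum>x\<in>B. x \<star> c x) = 0" for c
  proof -
    \<comment> \<open>A relation on \<open>B\<close> becomes one on \<open>insert b B\<close> with
      coefficient \<open>0\<close> at \<open>b\<close>, so \<open>B\<close> inherits
      independence.\<close>
    have "(\<Sum>x\<in>insert b B. x \<star> (c(b := 0)) x) = 0"
      using that insert.hyps by (simp add: if_distrib if_distribR) (smt (verit) sum.cong)
    from insert.prems(2)[OF this] show ?thesis using insert.hyps by (auto split: if_splits)
  qed
  then obtain U where U: "finite U" "card U = card B" "U \<subseteq> H" "U \<subseteq> rspan B" "B \<subseteq> rspan U" "orthonormal U"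
    using insert.IH insert.prems by auto
  have bH: "b \<in> H" using insert.prems by auto
  define p where "p = (\<Sum>u\<in>U. u \<star> ip u b)"
  define d where "d = b - p"
  have pU: "p \<in> rspan U" unfolding p_def using U(1) by (auto intro!: rspan_sum rspan_rs rspan_base)
  have pH: "p \<in> H" unfolding p_def using U by (intro sum_mem) auto
  have dH: "d \<in> H" using bH pH by (simp add: d_def)
  have ipd: "ip v d = 0" if "v \<in> U" for v
  proof -
    have "ip v p = (\<Sum>u\<in>U. ip v u * ip u b)"
      unfolding p_def using U that by (subst ip_sum_right) (auto simp: ip_rs_right subset_eq)
    also have "\<dots> = (\<Sum>u\<in>U. if u = v then ip u b else 0)"
      using U(6) that by (intro sum.cong) (auto simp: orthonormal_def)
    finally have "ip v p = ip v b" using U(1) that by simp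
    then show ?thesis using that U(3) bH pH by (auto simp: d_def ip_diff_right)
  qed
  have "d \<noteq> 0"
  proof
    assume "d = 0"
    then have "b \<in> rspan B" using pU rspan_least[OF U(4)] by (auto simp: d_def)
    then obtain c where c: "b = (\<Sum>x\<in>B. x \<star> c x)" by (auto simp: rspan_def)
    \<comment> \<open>If \<open>d = 0\<close>, then \<open>b\<close> is a combination of
      \<open>B\<close>; coefficient \<open>- 1\<close> at \<open>b\<close> turns this into a
      nontrivial relation on \<open>insert b B\<close>.\<close>
    have "(\<Sum>x\<in>B. x \<star> (c(b := - 1)) x) = (\<Sum>x\<in>B. x \<star> c x)"
      by (rule sum.cong) (use insert.hyps in auto)
    then have "(\<Sum>x\<in>B. x \<star> (c(b := - 1)) x) = b" using c by (simp only:)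
    then have "(\<Sum>x\<in>insert b B. x \<star> (c(b := - 1)) x) = 0"
      using insert.hyps by simp
    from insert.prems(2)[OF this] show False by simp
  qed
  then have pos: "sqn d > 0" using dH sqn_pos by blast
  define r where "r = 1 / sqrt (sqn d)"
  define w where "w = d \<star> of_real r"
  have wH: "w \<in> H" using dH by (simp add: w_def)
  have "sqn w = 1"
    using pos unfolding w_def sqn_rs[OF dH] r_def by (simp add: power_divide del: of_real_divide)
  then have ww: "ip w w = 1" using ip_self[OF wH] by simp
  have uw: "ip u w = 0" if "u \<in> U" for u
    using ipd[OF that] that U(3) dH by (simp add: w_def ip_rs_right subset_eq)
  have wu: "ip w u = 0" if "u \<in> U" for u
    using uw[OF that] ip_cnj[of u w] that U(3) wH by auto
  have "w \<notin> U" using ww wu by force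
  have sub: "rspan B \<subseteq> rspan (insert b B)"
    using insert.hyps by (intro rspan_least) (auto intro: rspan_base)
  have "b \<in> rspan (insert b B)" using insert.hyps by (auto intro: rspan_base)
  moreover have "p \<in> rspan (insert b B)" using pU rspan_least[OF U(4)] sub by auto
  ultimately have "b + p \<star> (- 1) \<in> rspan (insert b B)" by (intro rspan_add rspan_rs)
  then have wB: "w \<in> rspan (insert b B)" unfolding w_def d_def by (intro rspan_rs) simp
  have sub': "rspan U \<subseteq> rspan (insert w U)"
    using U(1) by (intro rspan_least) (auto intro: rspan_base)
  have "w \<star> of_real (sqrt (sqn d)) = d"
    using pos by (simp add: w_def r_def flip: rs_mult of_real_mult del: of_real_divide)
  then have "b = w \<star> of_real (sqrt (sqn d)) + p" by (simp add: d_def)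
  moreover have "w \<in> rspan (insert w U)" "p \<in> rspan (insert w U)"
    using U(1) pU sub' by (auto intro: rspan_base)
  ultimately have bU: "b \<in> rspan (insert w U)" by (metis rspan_add rspan_rs)
  show ?case
  proof (intro exI[of _ "insert w U"] conjI)
    show "card (insert w U) = card (insert b B)" using U(1,2) \<open>w \<notin> U\<close> insert.hyps by simp
    show "orthonormal (insert w U)" using U(6) ww uw wu \<open>w \<notin> U\<close> by (auto simp: orthonormal_def)
  qed (use U wH wB bU sub sub' in auto)
qed

section \<open>Positive right linear operators\<close>

definition linear_op :: "('v \<Rightarrow> 'v) \<Rightarrow> bool" where
  "linear_op T \<longleftrightarrow> (\<forall>f\<in>H. T f \<in> H) \<and> (\<forall>f\<in>H. \<forall>g\<in>H. T (f + g) = T f + T g) \<and>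
     (\<forall>f\<in>H. \<forall>q. T (f \<star> q) = T f \<star> q)"

definition positive_op :: "('v \<Rightarrow> 'v) \<Rightarrow> bool" where
  "positive_op T \<longleftrightarrow> linear_op T \<and> (\<forall>f\<in>H. \<exists>r\<ge>0. ip f (T f) = of_real r)"

lemma linear_op_mem: "linear_op T \<Longrightarrow> f \<in> H \<Longrightarrow> T f \<in> H"
  and linear_op_add: "linear_op T \<Longrightarrow> f \<in> H \<Longrightarrow> g \<in> H \<Longrightarrow> T (f + g) = T f + T g"
  and linear_op_rs: "linear_op T \<Longrightarrow> f \<in> H \<Longrightarrow> T (f \<star> q) = T f \<star> q"
  by (simp_all add: linear_op_def)

lemma linear_op_diff: "linear_op T \<Longrightarrow> f \<in> H \<Longrightarrow> g \<in> H \<Longrightarrow> T (f - g) = T f - T g"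
  using linear_op_add[of T f "g \<star> (- 1)"] linear_op_rs[of T g "- 1"] by simp

lemma linear_op_zero: "linear_op T \<Longrightarrow> T 0 = 0"
  using linear_op_diff[of T 0 0] by simp

lemma linear_op_sum:
  "linear_op T \<Longrightarrow> (\<And>x. x \<in> A \<Longrightarrow> f x \<in> H) \<Longrightarrow> T (\<Sum>x\<in>A. f x) = (\<Sum>x\<in>A. T (f x))"
  by (induction A rule: infinite_finite_induct) (auto simp: linear_op_add linear_op_zero sum_mem)

lemma positive_op_linear: "positive_op T \<Longrightarrow> linear_op T"
  by (simp add: positive_op_def)

lemma positive_op_nonneg: "positive_op T \<Longrightarrow> f \<in> H \<Longrightarrow> 0 \<le> qRe (ip f (T f))"
  unfolding positive_op_def by (metis qRe_of_real(1))

lemma positive_op_real: "positive_op T \<Longrightarrow> f \<in> H \<Longrightarrow> qcnj (ip f (T f)) = ip f (T f)"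
  unfolding positive_op_def by (metis qcnj_simps(1))

text \<open>Polarisation: if \<open>D q\<close> is real for every quaternion \<open>q\<close>, then \<open>D = 0\<close>.\<close>
lemma positive_op_selfadjoint:
  assumes T: "positive_op T" and f: "f \<in> H" and g: "g \<in> H"
  shows "ip (T f) g = ip f (T g)"
proof -
  note lin = positive_op_linear[OF T]
  define D where "D = ip f (T g) - qcnj (ip g (T f))"
  have "qcnj (D * q) = D * q" for q
  proof -
    have h: "ip (f + g \<star> q) (T (f + g \<star> q)) =
        ip f (T f) + ip f (T g) * q + qcnj q * ip g (T f) + ip (g \<star> q) (T (g \<star> q))"
      using lin f g
      by (simp add: linear_op_add linear_op_rs linear_op_mem ip_add_left ip_add_right ip_rs_left ip_rs_right algebra_simps)
    \<comment> \<open>The form at \<open>f + g \<star> q\<close> and both of its diagonal terms are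
      real, hence so is the sum of the cross terms. Sorting this equation by the side on which
      \<open>q\<close> occurs gives \<open>D * q = qcnj (D * q)\<close>.\<close>
    have "qcnj (ip f (T g) * q + qcnj q * ip g (T f)) = ip f (T g) * q + qcnj q * ip g (T f)"
      using positive_op_real[OF T, of "f + g \<star> q"] positive_op_real[OF T f]
        positive_op_real[OF T, of "g \<star> q"] f g unfolding h by simp
    then show ?thesis unfolding D_def by (simp add: qcnj_mult algebra_simps)
  qed
  \<comment> \<open>The factor \<open>1\<close> shows that \<open>D\<close> is real; then
    \<open>D\<close> times the unit \<open>Quat 0 1 0 0\<close> is purely imaginary and real at
    once.\<close>
  from this[of 1] this[of "Quat 0 1 0 0"] have "D = 0"
    by (simp add: quat_eq_iff)
  then have "ip f (T g) = ip (T f) g"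
    unfolding D_def using lin f g by (simp add: ip_cnj linear_op_mem)
  then show ?thesis by simp
qed

text \<open>The discriminant of a nonnegative quadratic polynomial in a real parameter
  \<open>t\<close>, namely the form of \<open>T\<close> at \<open>f + t g\<close>. It serves twice:
  with the identity it is the usual inequality, and with \<open>T\<close> itself it bounds
  \<open>sqn (T f)\<close> by the form.\<close>

lemma positive_op_cauchy_schwarz:
  assumes T: "positive_op T" and f: "f \<in> H" and g: "g \<in> H"
  shows "(qRe (ip f (T g)))\<^sup>2 \<le> qRe (ip f (T f)) * qRe (ip g (T g))"
proof -
  note lin = positive_op_linear[OF T]
  define a b c where "a = qRe (ip g (T g))" and "b = qRe (ip f (T g))" and "c = qRe (ip f (T f))"
  have sym: "qRe (ip g (T f)) = b"
    using positive_op_selfadjoint[OF T g f] qRe_ip_sym[of "T g" f] f g lin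
    by (simp add: b_def linear_op_mem)
  have *: "0 \<le> a * t\<^sup>2 + 2 * b * t + c" for t
  proof -
    have "qRe (ip (f + g \<star> of_real t) (T (f + g \<star> of_real t))) = a * t\<^sup>2 + 2 * b * t + c"
      using lin f g sym
      by (simp add: linear_op_add linear_op_rs linear_op_mem ip_add_left ip_add_right ip_rs_left
          ip_rs_right a_def b_def c_def algebra_simps power2_eq_square)
    moreover have "0 \<le> qRe (ip (f + g \<star> of_real t) (T (f + g \<star> of_real t)))"
      using T f g by (intro positive_op_nonneg) auto
    ultimately show ?thesis by simp
  qed
  have "a \<ge> 0" "c \<ge> 0" using positive_op_nonneg[OF T] f g by (auto simp: a_def c_def)
  show ?thesis
  proof (cases "a = 0")
    case True
    have "b = 0"
    proof (rule ccontr)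
      assume "b \<noteq> 0"
      \<comment> \<open>For \<open>a = 0\<close> the polynomial is \<open>2 * b * t + c\<close>, and
        at this \<open>t\<close> its value is \<open>- 1\<close>.\<close>
      then show False using *[of "- (c + 1) / (2 * b)"] True by simp
    qed
    then show ?thesis using True by (simp add: a_def b_def)
  next
    case False
    \<comment> \<open>The polynomial at its minimiser \<open>- b / a\<close>, multiplied by
      \<open>a\<close> to clear the denominator.\<close>
    then have "0 \<le> a * (a * (- b / a)\<^sup>2 + 2 * b * (- b / a) + c)"
      using *[of "- b / a"] \<open>a \<ge> 0\<close> by simp
    also have "\<dots> = c * a - b\<^sup>2" using False by (simp add: field_simps power2_eq_square)
    finally show ?thesis by (simp add: a_def b_def c_def)
  qed
qed

lemma id_positive: "positive_op (\<lambda>f. f)"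
  unfolding positive_op_def linear_op_def using sqn_nonneg ip_self by auto

lemma cauchy_schwarz: "f \<in> H \<Longrightarrow> g \<in> H \<Longrightarrow> (qRe (ip f g))\<^sup>2 \<le> sqn f * sqn g"
  using positive_op_cauchy_schwarz[OF id_positive] by (simp add: sqn_def)

text \<open>If \<open>P\<^sup>2 = Q\<^sup>2\<close>, then \<open>(Q + t) (Q - t) = 0\<close> on the eigenspace of \<open>P\<close> for \<open>t\<close>.\<close>
lemma eigenvector_of_square_root:
  assumes P: "positive_op P" and Q: "positive_op Q" and PQ: "\<And>f. f \<in> H \<Longrightarrow> P (P f) = Q (Q f)"
    and f: "f \<in> H" and t: "t > 0" and Pf: "P f = f \<star> of_real t"
  shows "Q f = f \<star> of_real t"
proof -
  note lP = positive_op_linear[OF P] and lQ = positive_op_linear[OF Q]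
  define g where "g = Q f - f \<star> of_real t"
  have gH: "g \<in> H" using f lQ by (auto simp: g_def linear_op_mem)
  have "Q (Q f) = f \<star> of_real t \<star> of_real t"
    using PQ[OF f] Pf lP f by (simp add: linear_op_rs)
  then have "Q g = (- g) \<star> of_real t"
    using lQ f by (simp add: g_def linear_op_diff linear_op_rs linear_op_mem rs_diff_left rs_minus_left)
  then have "qRe (ip g (Q g)) = - (sqn g * t)"
    using gH by (simp add: ip_rs_right ip_minus_right ip_self)
  then have "sqn g * t \<le> 0" using positive_op_nonneg[OF Q gH] by simp
  then have "sqn g = 0" using t sqn_nonneg[OF gH] by (simp add: mult_le_0_iff)
  then show ?thesis using sqn_eq_0D[OF gH] by (simp add: g_def)
qed

section \<open>Diagonalisation of compact positive operators\<close>

definition compact_op :: "('v \<Rightarrow> 'v) \<Rightarrow> bool" where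
  "compact_op T \<longleftrightarrow> (\<forall>F C. (\<forall>n::nat. F n \<in> H \<and> sqn (F n) \<le> C) \<longrightarrow>
     (\<exists>r g. strict_mono r \<and> g \<in> H \<and> (\<lambda>n. sqn (T (F (r n)) - g)) \<longlonglongrightarrow> 0))"

text \<open>Cauchy-Schwarz yields only that the real part of the limit vanishes. Applying it to
  \<open>f \<star> q\<close> with \<open>q = ip f g\<close> makes this real part equal to the
  squared norm of the whole scalar product.\<close>

lemma ip_limit_zero:
  assumes "f \<in> H" "g \<in> H" "\<And>n. h n \<in> H" "(\<lambda>n. sqn (h n - g)) \<longlonglongrightarrow> 0" "\<And>n. ip f (h n) = 0"
  shows "ip f g = 0"
proof -
  have *: "qRe (ip (f \<star> q) g) = 0" for q
  proof -
    have "(qRe (ip (f \<star> q) g))\<^sup>2 \<le> sqn (f \<star> q) * sqn (h n - g)" for n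
      using cauchy_schwarz[of "f \<star> q" "h n - g"] assms
      by (simp add: ip_diff_right ip_rs_left del: times_quat.sel)
    moreover have "(\<lambda>n. sqn (f \<star> q) * sqn (h n - g)) \<longlonglongrightarrow> sqn (f \<star> q) * 0"
      by (intro tendsto_intros assms)
    ultimately have "(qRe (ip (f \<star> q) g))\<^sup>2 \<le> 0"
      by (intro LIMSEQ_le_const[where X = "\<lambda>n. sqn (f \<star> q) * sqn (h n - g)"]) auto
    then show ?thesis by simp
  qed
  have "ip (f \<star> ip f g) g = of_real ((norm (ip f g))\<^sup>2)"
    using assms by (simp only: ip_rs_left mult_qcnj_norm)
  then have "(norm (ip f g))\<^sup>2 = 0" using *[of "ip f g"] by (simp only: qRe_of_real)
  then show ?thesis by simp
qed

text \<open>
  The supremum \<open>M\<close> of the quadratic form of \<open>T\<close> on the unit sphere of \<open>V\<close> is an eigenvalue: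
  along a maximising sequence, \<open>\<parallel>T f - M f\<parallel>\<^sup>2 \<le> M (M - \<langle>f, T f\<rangle>)\<close> tends to \<open>0\<close>.
\<close>
lemma compact_positive_eigenvector:
  assumes T: "positive_op T" and cpt: "compact_op T"
    and bdd: "\<And>f. f \<in> H \<Longrightarrow> sqn (T f) \<le> K * sqn f"
    and VH: "V \<subseteq> H" and Vrs: "\<And>f q. f \<in> V \<Longrightarrow> f \<star> q \<in> V" and VT: "\<And>f. f \<in> V \<Longrightarrow> T f \<in> V"
    and Vlim: "\<And>h g. g \<in> H \<Longrightarrow> (\<And>n::nat. h n \<in> V) \<Longrightarrow> (\<lambda>n. sqn (h n - g)) \<longlonglongrightarrow> 0 \<Longrightarrow> g \<in> V"
    and f0: "f0 \<in> V" "c * sqn f0 < qRe (ip f0 (T f0))" and c: "c \<ge> 0"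
  shows "\<exists>t g. t > c \<and> g \<in> V \<and> g \<noteq> 0 \<and> T g = g \<star> of_real t"
proof -
  note lin = positive_op_linear[OF T]
  define R where "R = {qRe (ip f (T f)) | f. f \<in> V \<and> sqn f = 1}"
  \<comment> \<open>Expanding \<open>0 \<le> sqn (f - T f)\<close> gives
    \<open>2 * qRe (ip f (T f)) \<le> 1 + K\<close>. The bound is crude, but it only has to make the
    supremum \<open>M\<close> finite.\<close>
  have K0: "qRe (ip f (T f)) \<le> 1 + K" if "f \<in> H" "sqn f = 1" for f
  proof -
    have Tf: "T f \<in> H" using that lin by (auto simp: linear_op_mem)
    have "2 * qRe (ip f (T f)) \<le> sqn f + sqn (T f)"
      using sqn_nonneg[of "f - T f"] that Tf by (simp add: sqn_diff)
    then show ?thesis using bdd[OF that(1)] sqn_nonneg[OF Tf] that by simp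
  qed
  then have bddR: "bdd_above R" using VH by (auto simp: R_def bdd_above_def)
  have "f0 \<noteq> 0" using f0 lin by (auto simp: linear_op_zero)
  then have pos0: "sqn f0 > 0" using f0 VH sqn_pos by auto
  define f1 where "f1 = f0 \<star> of_real (1 / sqrt (sqn f0))"
  have scale: "qRe (ip (f \<star> of_real r) (T (f \<star> of_real r))) = r\<^sup>2 * qRe (ip f (T f))" if "f \<in> H" for f r
    using that lin by (simp add: linear_op_rs linear_op_mem ip_rs_left ip_rs_right power2_eq_square)
  have "sqn f1 = 1" using pos0 f0(1) VH unfolding f1_def by (subst sqn_rs) (auto simp: power_divide simp del: of_real_divide)
  have f1R: "qRe (ip f1 (T f1)) \<in> R" "qRe (ip f1 (T f1)) > c"
  proof -
    show "qRe (ip f1 (T f1)) \<in> R" using \<open>sqn f1 = 1\<close> f0 Vrs by (auto simp: R_def f1_def)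
    have "qRe (ip f1 (T f1)) = qRe (ip f0 (T f0)) / sqn f0"
      unfolding f1_def using f0 VH pos0 by (subst scale) (auto simp: power_divide simp del: of_real_divide)
    then show "qRe (ip f1 (T f1)) > c" using f0(2) pos0 by (simp only: less_divide_eq if_True)
  qed
  define M where "M = Sup R"
  have "M > c" using cSup_upper[OF f1R(1) bddR] f1R(2) by (simp add: M_def)
  then have "M > 0" using c by simp
  have le_M: "qRe (ip f (T f)) \<le> M * sqn f" if "f \<in> V" for f
  proof (cases "f = 0")
    case True then show ?thesis using lin by (simp add: linear_op_zero)
  next
    case False
    then have pos: "sqn f > 0" using that VH sqn_pos by auto
    let ?f = "f \<star> of_real (1 / sqrt (sqn f))"
    have "sqn ?f = 1" using pos that VH by (subst sqn_rs) (auto simp: power_divide simp del: of_real_divide)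
    then have "qRe (ip ?f (T ?f)) \<le> M" unfolding M_def
      using that Vrs bddR by (intro cSup_upper) (auto simp: R_def)
    then show ?thesis using that VH pos by (subst (asm) scale) (auto simp: power_divide field_simps simp del: of_real_divide)
  qed
  \<comment> \<open>Cauchy-Schwarz for the form of \<open>T\<close> at the pair \<open>T f\<close>,
    \<open>f\<close> bounds the square of \<open>sqn (T f)\<close> by the product of the forms at
    \<open>T f\<close> and at \<open>f\<close>. As \<open>V\<close> is invariant,
    \<open>le_M\<close> applies to \<open>T f\<close>, and one factor \<open>sqn (T f)\<close>
    cancels.\<close>
  have sq_le: "sqn (T f) \<le> M * qRe (ip f (T f))" if f: "f \<in> V" for f
  proof -
    have H: "f \<in> H" "T f \<in> H" "T f \<in> V" using f VH VT by auto
    have "(sqn (T f))\<^sup>2 \<le> qRe (ip (T f) (T (T f))) * qRe (ip f (T f))"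
      using positive_op_cauchy_schwarz[OF T H(2,1)] by (simp add: sqn_def)
    also have "\<dots> \<le> (M * sqn (T f)) * qRe (ip f (T f))"
      using le_M[OF H(3)] positive_op_nonneg[OF T H(1)] by (intro mult_right_mono) auto
    finally have "sqn (T f) * sqn (T f) \<le> sqn (T f) * (M * qRe (ip f (T f)))"
      by (simp add: power2_eq_square mult_ac)
    moreover have "0 \<le> M * qRe (ip f (T f))" using \<open>M > 0\<close> positive_op_nonneg[OF T H(1)] by simp
    ultimately show ?thesis using sqn_nonneg[OF H(2)]
      by (cases "sqn (T f) = 0") (auto simp: mult_le_cancel_left)
  qed
  have "\<exists>f. f \<in> V \<and> sqn f = 1 \<and> qRe (ip f (T f)) > M - 1 / Suc n" for n :: nat
  proof -
    have "M - 1 / Suc n < Sup R" by (simp add: M_def)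
    then show ?thesis using less_cSup_iff[of R] f1R(1) bddR unfolding R_def by blast
  qed
  then obtain F where F: "\<And>n. F n \<in> V" "\<And>n. sqn (F n) = 1" "\<And>n::nat. qRe (ip (F n) (T (F n))) > M - 1 / Suc n"
    by metis
  have FH: "F n \<in> H" "T (F n) \<in> H" for n using F(1) VH VT by blast+
  have "\<forall>n. F n \<in> H \<and> sqn (F n) \<le> 1" using FH F(2) by simp
  then obtain r g where r: "strict_mono r" and gH: "g \<in> H" and lim: "(\<lambda>n. sqn (T (F (r n)) - g)) \<longlonglongrightarrow> 0"
    using cpt unfolding compact_op_def by blast
  have gV: "g \<in> V" using Vlim[OF gH _ lim] F(1) VT by blast
  define D where "D n = T (F n) - F n \<star> of_real M" for n
  have DH: "D n \<in> H" for n unfolding D_def using FH by blast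
  have D_le: "sqn (D n) \<le> M / Suc n" for n
  proof -
    have "sqn (D n) = sqn (T (F n)) - 2 * M * qRe (ip (F n) (T (F n))) + M\<^sup>2"
      unfolding D_def using FH F(2) by (simp add: sqn_diff sqn_rs ip_rs_right qRe_ip_sym[of "T (F n)"])
    also have "\<dots> \<le> M * (M - qRe (ip (F n) (T (F n))))"
      using sq_le[OF F(1)[of n]] by (simp add: algebra_simps power2_eq_square)
    also have "\<dots> \<le> M * (1 / Suc n)" using \<open>M > 0\<close> F(3)[of n] by (intro mult_left_mono) auto
    finally show ?thesis by simp
  qed
  have "(\<lambda>n. M / real (Suc n)) \<longlonglongrightarrow> 0"
    using tendsto_mult[OF tendsto_const LIMSEQ_inverse_real_of_nat, of M] by (simp add: field_simps)
  then have Dlim0: "(\<lambda>n. sqn (D n)) \<longlonglongrightarrow> 0"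
    by (rule Lim_null_comparison[rotated]) (simp only: real_norm_def abs_of_nonneg[OF sqn_nonneg[OF DH]] D_le always_eventually simp_thms)
  have Dlim: "(\<lambda>n. sqn (D (r n))) \<longlonglongrightarrow> 0"
    using LIMSEQ_subseq_LIMSEQ[OF Dlim0 r] by (simp add: o_def)
  \<comment> \<open>Compactness makes only the images \<open>T (F (r n))\<close> converge. Since
    \<open>E n\<close> is the difference of \<open>T (F (r n)) - g\<close> and the residual
    \<open>D (r n)\<close>, the vectors \<open>F (r n)\<close> themselves, scaled by
    \<open>M\<close>, converge to \<open>g\<close> too.\<close>
  define E where "E n = F (r n) \<star> of_real M - g" for n
  have EH: "E n \<in> H" for n unfolding E_def using FH gH by blast
  have E_le: "sqn (E n) \<le> 2 * sqn (T (F (r n)) - g) + 2 * sqn (D (r n))" for n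
  proof -
    have "E n = (T (F (r n)) - g) - D (r n)" by (simp add: E_def D_def)
    then show ?thesis using sqn_diff_le[of "T (F (r n)) - g" "D (r n)"] FH gH DH by auto
  qed
  have "(\<lambda>n. 2 * sqn (T (F (r n)) - g) + 2 * sqn (D (r n))) \<longlonglongrightarrow> 2 * 0 + 2 * 0"
    by (intro tendsto_intros lim Dlim)
  then have Elim: "(\<lambda>n. sqn (E n)) \<longlonglongrightarrow> 0"
    by (intro Lim_null_comparison[OF always_eventually, of "\<lambda>n. sqn (E n)"])
      (simp_all only: real_norm_def abs_of_nonneg[OF sqn_nonneg[OF EH]] E_le simp_thms mult_zero_right add_0)
  have TgH: "T g \<in> H" using gH lin by (simp add: linear_op_mem)
  have "sqn (T g - g \<star> of_real M) \<le> 2 * (K * sqn (E n)) + 2 * (sqn (T (F (r n)) - g) * M\<^sup>2)" for n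
  proof -
    let ?a = "(T (F (r n)) - g) \<star> of_real M"
    \<comment> \<open>The left side does not depend on \<open>n\<close>, and both terms on the right
      tend to \<open>0\<close>: the first by compactness, the second because \<open>T\<close> is
      bounded and \<open>E n\<close> tends to \<open>0\<close>. So \<open>g\<close> is an exact
      eigenvector.\<close>
    have "T g - g \<star> of_real M = ?a - T (E n)"
      unfolding E_def using FH gH lin
      by (simp add: linear_op_diff linear_op_rs rs_diff_left rs_mem)
    then have "sqn (T g - g \<star> of_real M) \<le> 2 * sqn ?a + 2 * sqn (T (E n))"
      using sqn_diff_le[of ?a "T (E n)"] FH gH EH lin by (auto simp: linear_op_mem)
    also have "sqn ?a = sqn (T (F (r n)) - g) * M\<^sup>2"
      using FH gH by (subst sqn_rs) auto
    finally show ?thesis using bdd[OF EH[of n]] by simp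
  qed
  moreover have "(\<lambda>n. 2 * (K * sqn (E n)) + 2 * (sqn (T (F (r n)) - g) * M\<^sup>2)) \<longlonglongrightarrow> 2 * (K * 0) + 2 * (0 * M\<^sup>2)"
    by (intro tendsto_intros lim Elim)
  ultimately have "sqn (T g - g \<star> of_real M) \<le> 2 * (K * 0) + 2 * (0 * M\<^sup>2)"
    by (intro LIMSEQ_le_const[where X = "\<lambda>n. 2 * (K * sqn (E n)) + 2 * (sqn (T (F (r n)) - g) * M\<^sup>2)"]) auto
  then have "sqn (T g - g \<star> of_real M) = 0"
    using sqn_nonneg[of "T g - g \<star> of_real M"] TgH gH by auto
  then have Tg: "T g = g \<star> of_real M" using sqn_eq_0D[of "T g - g \<star> of_real M"] TgH gH by auto
  have "g \<noteq> 0"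
  proof
    assume "g = 0"
    then have "sqn (E n) = M\<^sup>2" for n unfolding E_def using FH F(2) by (simp add: sqn_rs)
    then have "(\<lambda>n::nat. M\<^sup>2) \<longlonglongrightarrow> 0" using Elim by simp
    then show False using \<open>M > 0\<close> by (simp add: LIMSEQ_const_iff)
  qed
  then show ?thesis using \<open>M > c\<close> gV Tg by blast
qed

text \<open>On the orthogonal complement of the first \<open>N\<close> eigenvectors the form is at
  most \<open>s N * sqn f\<close>: a larger value would produce an eigenvector there with an
  eigenvalue above \<open>s N\<close>, although all basis vectors for such an eigenvalue are among
  those first \<open>N\<close>. Hence the remainder after \<open>N\<close> terms is at most
  \<open>s N * sqn f\<close>, and \<open>s\<close> tends to \<open>0\<close>.\<close>

theorem compact_positive_diagonal:
  assumes T: "positive_op T" and cpt: "compact_op T"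
    and bdd: "\<And>f. f \<in> H \<Longrightarrow> sqn (T f) \<le> K * sqn f"
    and dec: "decseq s" and s0: "\<And>n::nat. 0 \<le> s n"
    and fin: "\<And>t. t > 0 \<Longrightarrow> finite {n. s n = t}"
    and dim: "\<And>t. t > 0 \<Longrightarrow> \<exists>B. finite B \<and> card B = card {n. s n = t} \<and>
      {f \<in> H. T f = f \<star> of_real t} = rspan B \<and> (\<forall>c. (\<Sum>b\<in>B. b \<star> c b) = 0 \<longrightarrow> (\<forall>b\<in>B. c b = 0))"
  shows "\<exists>e. (\<forall>n. e n \<in> H \<and> sqn (e n) = (if s n > 0 then 1 else 0)) \<and>
    (\<forall>f\<in>H. (\<lambda>n. s n * (norm (ip (e n) f))\<^sup>2) sums qRe (ip f (T f)))"
proof -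
  note lin = positive_op_linear[OF T]
  define E where "E t = {f \<in> H. T f = f \<star> of_real t}" for t
  \<comment> \<open>The orthonormal basis of an eigenspace is indexed by the positions at which
    \<open>s\<close> takes the value \<open>t\<close>, so that multiplicities are accounted for by a
    bijection. The last conjunct is totality in the form in which it is applied later.\<close>
  define P where "P t b \<longleftrightarrow>
      (\<forall>n m. s n = t \<longrightarrow> s m = t \<longrightarrow> ip (b n) (b m) = (if n = m then 1 else 0)) \<and>
      (\<forall>n. s n = t \<longrightarrow> b n \<in> E t) \<and> (\<forall>f\<in>E t. (\<forall>n. s n = t \<longrightarrow> ip (b n) f = 0) \<longrightarrow> f = 0)" for t b
  have "\<exists>b. P t b"
    if t: "t > 0" for t
  proof -
    obtain B where B: "finite B" "card B = card {n. s n = t}" "E t = rspan B"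
        "\<And>c. (\<Sum>b\<in>B. b \<star> c b) = 0 \<Longrightarrow> \<forall>b\<in>B. c b = 0"
      using dim[OF t] unfolding E_def by blast
    have "B \<subseteq> E t" using B by (auto intro: rspan_base)
    then have "B \<subseteq> H" by (auto simp: E_def)
    then obtain U where U: "finite U" "card U = card B" "U \<subseteq> H" "U \<subseteq> rspan B" "B \<subseteq> rspan U" "orthonormal U"
      using gram_schmidt[OF B(1) _ B(4)] by blast
    obtain b where b: "bij_betw b {n. s n = t} U"
      using finite_same_card_bij[OF fin[OF t] U(1)] U(2) B(2) by auto
    show ?thesis unfolding P_def
    proof (intro exI[of _ b] conjI allI impI ballI)
      show "ip (b n) (b m) = (if n = m then 1 else 0)" if "s n = t" "s m = t" for n m
      proof -
        have "b n \<in> U" "b m \<in> U" "b n = b m \<longleftrightarrow> n = m"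
          using b that by (auto simp: bij_betw_def inj_on_def)
        then show ?thesis using U(6) by (simp add: orthonormal_def)
      qed
      show "b n \<in> E t" if "s n = t" for n
        using b that U(4) B(3) by (auto simp: bij_betw_def)
      show "f = 0" if "f \<in> E t" "\<forall>n. s n = t \<longrightarrow> ip (b n) f = 0" for f
      proof -
        have "f \<in> rspan U" using that(1) B(3) rspan_least[OF U(5)] by auto
        then have "f = (\<Sum>u\<in>U. u \<star> ip u f)" using orthonormal_expansion U by auto
        also have "\<dots> = 0" using b that(2) by (intro sum.neutral) (force simp: bij_betw_def)
        finally show ?thesis .
      qed
    qed
  qed
  then have "\<forall>t. \<exists>b. t > 0 \<longrightarrow> P t b" by blast
  from choice[OF this] obtain b where bP: "\<And>t. t > 0 \<Longrightarrow> P t (b t)" by blast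
  have b: "ip (b t n) (b t m) = (if n = m then 1 else 0)" if "t > 0" "s n = t" "s m = t" for t n m
    using bP[OF that(1)] that(2,3) unfolding P_def by blast
  have b_mem: "b t n \<in> E t" if "t > 0" "s n = t" for t n
    using bP[OF that(1)] that(2) unfolding P_def by blast
  have b_total: "f = 0" if "t > 0" "f \<in> E t" "\<And>n. s n = t \<Longrightarrow> ip (b t n) f = 0" for t f
    using bP[OF that(1)] that(2,3) unfolding P_def by blast
  \<comment> \<open>The padding zeros of \<open>s\<close> get the zero vector, so no vectors in the
    null space of \<open>T\<close> have to be chosen.\<close>
  define e where "e n = (if s n > 0 then b (s n) n else 0)" for n
  have eH: "e n \<in> H" for n using b_mem[of "s n" n, OF _ refl] by (cases "s n > 0") (simp_all add: e_def E_def)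
  have Te: "T (e n) = e n \<star> of_real (s n)" for n
    using b_mem[of "s n" n, OF _ refl] lin by (cases "s n > 0") (simp_all add: e_def E_def linear_op_zero)
  have e_zero: "e n = 0" if "\<not> s n > 0" for n using that by (simp add: e_def)
  have ortho: "ip (e n) (e m) = (if n = m \<and> s n > 0 then 1 else 0)" for n m
  proof (cases "s n > 0 \<and> s m > 0")
    case True
    show ?thesis
    proof (cases "s n = s m")
      case True
      have "e n = b (s n) n" "e m = b (s n) m" using \<open>s n > 0 \<and> s m > 0\<close> True by (simp_all add: e_def)
      then show ?thesis using b[OF _ refl True[symmetric]] \<open>s n > 0 \<and> s m > 0\<close> by simp
    next
      case False
      have "of_real (s n) * ip (e n) (e m) = ip (T (e n)) (e m)"
        unfolding Te ip_rs_left[OF eH eH] by (simp only: qcnj_simps)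
      also have "\<dots> = ip (e n) (T (e m))" by (rule positive_op_selfadjoint[OF T eH eH])
      also have "\<dots> = of_real (s m) * ip (e n) (e m)"
        unfolding Te ip_rs_right[OF eH eH] by (rule of_real_mult_quat_commute[symmetric])
      finally have "of_real (s n - s m) * ip (e n) (e m) = 0"
        by (simp only: of_real_diff left_diff_distrib diff_self)
      then have "ip (e n) (e m) = 0" using False by (simp only: mult_eq_0_iff of_real_eq_0_iff) simp
      then show ?thesis using False by auto
    qed
  next
    case False
    then consider "e n = 0" "\<not> s n > 0" | "e m = 0" "\<not> s m > 0" using e_zero by blast
    then show ?thesis using ip_zero_left[OF eH] ip_zero_right[OF eH] by cases auto
  qed
  have sqn_e: "sqn (e n) = (if s n > 0 then 1 else 0)" for n
    using ortho[of n n] by (simp add: sqn_def)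
  have s_lim: "s \<longlonglongrightarrow> 0"
  proof -
    obtain l where l: "s \<longlonglongrightarrow> l" "\<And>n. l \<le> s n"
      using decseq_convergent[OF dec, of 0] s0 by blast
    have "l \<ge> 0" using l(1) s0 by (intro LIMSEQ_le_const) auto
    have "l = 0"
    proof (rule ccontr)
      assume "l \<noteq> 0"
      then have pos: "l > 0" using \<open>l \<ge> 0\<close> by simp
      have "\<forall>n. e n \<in> H \<and> sqn (e n) \<le> 1" using eH sqn_e by simp
      then obtain r g where r: "strict_mono r" and gH: "g \<in> H"
        and lim: "(\<lambda>n. sqn (T (e (r n)) - g)) \<longlonglongrightarrow> 0"
        using cpt unfolding compact_op_def by blast
      \<comment> \<open>For a limit \<open>l > 0\<close> the vectors \<open>T (e n)\<close> are
        pairwise orthogonal with squared norm at least \<open>l\<^sup>2\<close>. Two consecutive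
        members of the subsequence then have squared distance at least \<open>2 * l\<^sup>2\<close>,
        which contradicts convergence.\<close>
      have sep: "2 * l\<^sup>2 \<le> 2 * sqn (T (e (r n)) - g) + 2 * sqn (T (e (r (Suc n))) - g)" for n
      proof -
        let ?f = "T (e (r n))" and ?h = "T (e (r (Suc n)))"
        have H: "?f \<in> H" "?h \<in> H" using eH lin by (auto simp: linear_op_mem)
        have ne: "r n \<noteq> r (Suc n)" using r by (metis lessI less_irrefl strict_monoD)
        have p: "s (r n) > 0" "s (r (Suc n)) > 0" using l(2) pos by (auto intro: less_le_trans)
        have "ip ?f ?h = 0"
          using ne ortho[of "r n" "r (Suc n)"] eH[of "r n"] eH[of "r (Suc n)"]
          by (simp only: Te) (simp add: ip_rs_left ip_rs_right)
        then have "sqn (?f - ?h) = (s (r n))\<^sup>2 + (s (r (Suc n)))\<^sup>2"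
          using H p by (simp add: sqn_diff) (simp add: Te sqn_rs eH sqn_e)
        moreover have "l\<^sup>2 \<le> (s (r n))\<^sup>2" "l\<^sup>2 \<le> (s (r (Suc n)))\<^sup>2"
          using l(2) pos by (auto intro!: power_mono)
        moreover have "sqn (?f - ?h) \<le> 2 * sqn (?f - g) + 2 * sqn (?h - g)"
          using sqn_diff_le[of "?f - g" "?h - g"] H gH by simp
        ultimately show ?thesis by simp
      qed
      have "(\<lambda>n. 2 * sqn (T (e (r n)) - g) + 2 * sqn (T (e (r (Suc n))) - g)) \<longlonglongrightarrow> 2 * 0 + 2 * 0"
        by (intro tendsto_intros lim LIMSEQ_Suc[OF lim])
      then have "2 * l\<^sup>2 \<le> 2 * 0 + 2 * 0"
        by (rule LIMSEQ_le_const) (use sep in auto)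
      then show False using pos by simp
    qed
    then show ?thesis using l by simp
  qed
  define V where "V N = {f \<in> H. \<forall>n<N. ip (e n) f = 0}" for N :: nat
  have form_le: "qRe (ip f (T f)) \<le> s N * sqn f" if f: "f \<in> V N" for f N
  proof (rule ccontr)
    assume "\<not> ?thesis"
    then have f': "s N * sqn f < qRe (ip f (T f))" by simp
    have "\<exists>t g. t > s N \<and> g \<in> V N \<and> g \<noteq> 0 \<and> T g = g \<star> of_real t"
    proof (rule compact_positive_eigenvector[OF T cpt bdd _ _ _ _ f f' s0])
      show "V N \<subseteq> H" by (auto simp: V_def)
      show "g \<star> q \<in> V N" if "g \<in> V N" for g q using that eH by (auto simp: V_def ip_rs_right)
      show "T g \<in> V N" if "g \<in> V N" for g
      proof -
        have "ip (e n) (T g) = of_real (s n) * ip (e n) g" if "g \<in> H" for n g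
          using ip_rs_left[OF eH that, of n "of_real (s n)"] positive_op_selfadjoint[OF T eH that, of n]
          by (simp only: Te qcnj_simps)
        then show ?thesis using that lin by (auto simp: V_def linear_op_mem)
      qed
      show "g \<in> V N" if "g \<in> H" "\<And>n::nat. h n \<in> V N" "(\<lambda>n. sqn (h n - g)) \<longlonglongrightarrow> 0" for h g
        using that eH by (auto simp: V_def intro!: ip_limit_zero[of _ g h])
    qed
    then obtain t g where g: "t > s N" "g \<in> V N" "g \<noteq> 0" "T g = g \<star> of_real t" by blast
    have "t > 0" using g(1) s0[of N] by simp
    \<comment> \<open>As \<open>s\<close> decreases and \<open>t > s N\<close>, every position with
      value \<open>t\<close> lies before \<open>N\<close>; thus \<open>g\<close> is orthogonal to
      the whole basis of its own eigenspace.\<close>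
    have "ip (b t n) g = 0" if n: "s n = t" for n
    proof -
      have "n < N" using n g(1) decseqD[OF dec, of N n] by (meson not_le not_less)
      then show ?thesis using g(2) n \<open>t > 0\<close> by (auto simp: V_def e_def)
    qed
    moreover have "g \<in> E t" using g by (auto simp: E_def V_def)
    ultimately show False using b_total[OF \<open>t > 0\<close>] g(3) by blast
  qed
  have "(\<lambda>n. s n * (norm (ip (e n) f))\<^sup>2) sums qRe (ip f (T f))" if f: "f \<in> H" for f
  proof -
    define p where "p N = (\<Sum>n<N. e n \<star> ip (e n) f)" for N
    have pH: "p N \<in> H" for N unfolding p_def using eH by (intro sum_mem) auto
    have ipe: "ip (e m) (p N) = (if m < N then ip (e m) f else 0)" for m N
    proof -
      have "ip (e m) (p N) = (\<Sum>n<N. ip (e m) (e n) * ip (e n) f)"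
        unfolding p_def using eH by (subst ip_sum_right) (auto simp: ip_rs_right)
      also have "\<dots> = (\<Sum>n<N. if n = m then ip (e m) f else 0)"
        using ortho[of m] e_zero[of m] f by (intro sum.cong) (auto split: if_splits)
      finally show ?thesis by simp
    qed
    have dV: "f - p N \<in> V N" for N using f pH eH by (simp add: V_def ip_diff_right ipe)
    have Tp: "T (p N) = (\<Sum>n<N. e n \<star> (of_real (s n) * ip (e n) f))" for N
      unfolding p_def using lin eH
      by (subst linear_op_sum) (auto simp: linear_op_rs Te rs_mult)
    have ipTp: "ip g (T (p N)) = (\<Sum>n<N. of_real (s n) * (ip g (e n) * ip (e n) f))" if "g \<in> H" for g N
      unfolding Tp using that eH
      by (subst ip_sum_right) (auto simp: ip_rs_right of_real_mult_quat_left_commute)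
    have partial: "qRe (ip f (T (p N))) = (\<Sum>n<N. s n * (norm (ip (e n) f))\<^sup>2)" for N
    proof -
      have "ip f (e n) * ip (e n) f = of_real ((norm (ip (e n) f))\<^sup>2)" for n
        using mult_qcnj_norm(2)[of "ip (e n) f"] ip_cnj[OF eH f, of n] by simp
      then have "ip f (T (p N)) = of_real (\<Sum>n<N. s n * (norm (ip (e n) f))\<^sup>2)"
        using ipTp[OF f] by simp
      then show ?thesis by (simp only: qRe_of_real)
    qed
    \<comment> \<open>\<open>T (p N)\<close> is a combination of the first \<open>N\<close>
      eigenvectors and so is orthogonal to \<open>f - p N\<close>. Self-adjointness moves
      \<open>T\<close> onto \<open>p N\<close> in the remaining cross term, which is the partial
      sum.\<close>
    have split: "qRe (ip (f - p N) (T (f - p N))) = qRe (ip f (T f)) - (\<Sum>n<N. s n * (norm (ip (e n) f))\<^sup>2)" for N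
    proof -
      have dH: "f - p N \<in> H" using f pH by blast
      have "ip (f - p N) (e n) = 0" if "n < N" for n
        using dV[of N] that ip_cnj[OF eH dH, of n] by (simp add: V_def)
      then have z: "ip (f - p N) (T (p N)) = 0" using ipTp[OF dH] by simp
      have TH: "T f \<in> H" "T (p N) \<in> H" using lin f pH by (auto simp: linear_op_mem)
      have "ip (f - p N) (T (f - p N)) = ip (f - p N) (T f)"
        using z dH TH lin f pH by (simp add: linear_op_diff ip_diff_right)
      also have "\<dots> = ip f (T f) - ip (T (p N)) f"
        using f pH TH positive_op_selfadjoint[OF T pH f] by (simp add: ip_diff_left)
      finally show ?thesis using partial[of N] qRe_ip_sym[OF TH(2) f] by simp
    qed
    have dsq: "sqn (f - p N) \<le> sqn f" for N
    proof -
      have dH: "f - p N \<in> H" using f pH by blast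
      have "ip (p N) (f - p N) = 0"
      proof -
        have "ip (f - p N) (p N) = (\<Sum>n<N. ip (f - p N) (e n) * ip (e n) f)"
          using dH eH by (subst p_def, subst ip_sum_right) (auto simp: ip_rs_right)
        also have "\<dots> = 0"
        proof (intro sum.neutral ballI)
          fix n assume "n \<in> {..<N}"
          then have "ip (e n) (f - p N) = 0" using dV[of N] by (simp add: V_def)
          then show "ip (f - p N) (e n) * ip (e n) f = 0" using ip_cnj[OF eH dH, of n] by simp
        qed
        finally show ?thesis using ip_cnj[OF dH pH, of N] by simp
      qed
      then have "sqn f = sqn (p N) + sqn (f - p N)"
        using sqn_add[OF pH dH, of N] by simp
      then show ?thesis using sqn_nonneg[OF pH] by simp
    qed
    \<comment> \<open>By \<open>split\<close> the remainder is the form at \<open>f - p N\<close>: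
      nonnegative by positivity and at most \<open>s N * sqn (f - p N)\<close> by
      \<open>form_le\<close>.\<close>
    have bd: "\<bar>(\<Sum>n<N. s n * (norm (ip (e n) f))\<^sup>2) - qRe (ip f (T f))\<bar> \<le> s N * sqn f" for N
    proof -
      have dH: "f - p N \<in> H" using f pH by blast
      show ?thesis
        using form_le[OF dV[of N]] positive_op_nonneg[OF T dH] split[of N]
          mult_left_mono[OF dsq[of N] s0[of N]] by simp
    qed
    have lim: "(\<lambda>N. s N * sqn f) \<longlonglongrightarrow> 0"
      using tendsto_mult_right[OF s_lim, of "sqn f"] by simp
    have "(\<lambda>N. (\<Sum>n<N. s n * (norm (ip (e n) f))\<^sup>2) - qRe (ip f (T f))) \<longlonglongrightarrow> 0"
      by (rule Lim_null_comparison[OF always_eventually lim]) (simp only: real_norm_def bd simp_thms)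
    then show ?thesis unfolding sums_def by (rule LIM_zero_cancel)
  qed
  then show ?thesis by (intro exI[of _ e] conjI allI ballI eH sqn_e)
qed

end

section \<open>Weighted area on the complex disc\<close>

lemma borel_measurable_Complex [measurable (raw)]:
  "f \<in> borel_measurable M \<Longrightarrow> g \<in> borel_measurable M \<Longrightarrow> (\<lambda>x. Complex (f x) (g x)) \<in> borel_measurable M"
  by (simp add: borel_measurable_complex_iff)

lemma borel_measurable_cnj [measurable]: "cnj \<in> borel_measurable borel"
  by (intro borel_measurable_continuous_onI continuous_intros)

lemma ball_in_sets_borel [measurable]: "ball x r \<in> sets (borel :: 'a::metric_space measure)"
  by simp

text \<open>Lebesgue measure is determined by its values on boxes. The product form makes iterated
  integrals over real and imaginary parts available.\<close>

lemma lborel_complex: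
  "(lborel :: complex measure) = distr (lborel \<Otimes>\<^sub>M lborel) borel (\<lambda>p. Complex (fst p) (snd p))"
proof (rule lborel_eqI)
  fix l u :: complex
  assume le: "\<And>b. b \<in> Basis \<Longrightarrow> l \<bullet> b \<le> u \<bullet> b"
  have l: "Re l \<le> Re u" "Im l \<le> Im u"
    using le[of 1] le[of \<i>] by (auto simp: Basis_complex_def)
  have m: "(\<lambda>p. Complex (fst p) (snd p)) \<in> borel_measurable (lborel \<Otimes>\<^sub>M lborel)"
    by measurable
  have pre: "(\<lambda>p. Complex (fst p) (snd p)) -` box l u \<inter> space (lborel \<Otimes>\<^sub>M lborel) =
      {Re l<..<Re u} \<times> {Im l<..<Im u}"
    by (auto simp: box_def Basis_complex_def space_pair_measure)
  show "emeasure (distr (lborel \<Otimes>\<^sub>M lborel) borel (\<lambda>p. Complex (fst p) (snd p))) (box l u) =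
      ennreal (\<Prod>b\<in>Basis. (u - l) \<bullet> b)"
    using l by (simp add: emeasure_distr[OF m] pre lborel.emeasure_pair_measure_Times
        Basis_complex_def ennreal_mult)
qed simp

lemma nn_integral_lborel_complex:
  assumes [measurable]: "f \<in> borel_measurable borel"
  shows "(\<integral>\<^sup>+z. f z \<partial>lborel) = (\<integral>\<^sup>+y. \<integral>\<^sup>+x. f (Complex x y) \<partial>lborel \<partial>lborel)"
    and "(\<integral>\<^sup>+z. f z \<partial>lborel) = (\<integral>\<^sup>+x. \<integral>\<^sup>+y. f (Complex x y) \<partial>lborel \<partial>lborel)"
proof -
  have "(\<integral>\<^sup>+z. f z \<partial>lborel) = (\<integral>\<^sup>+p. f (Complex (fst p) (snd p)) \<partial>(lborel \<Otimes>\<^sub>M lborel))"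
    by (subst lborel_complex, subst nn_integral_distr) measurable
  then show "(\<integral>\<^sup>+z. f z \<partial>lborel) = (\<integral>\<^sup>+y. \<integral>\<^sup>+x. f (Complex x y) \<partial>lborel \<partial>lborel)"
      "(\<integral>\<^sup>+z. f z \<partial>lborel) = (\<integral>\<^sup>+x. \<integral>\<^sup>+y. f (Complex x y) \<partial>lborel \<partial>lborel)"
    using lborel_pair.nn_integral_snd[of "\<lambda>p. f (Complex (fst p) (snd p))"]
      lborel.nn_integral_fst[of "\<lambda>p. f (Complex (fst p) (snd p))"] by simp_all
qed

text \<open>A shear translates each horizontal line, so the inner integral of the iterated integral
  does not change. The companion below does the same on vertical lines.\<close>

lemma lborel_distr_shear_Re:
  "distr lborel borel (\<lambda>z. Complex (Re z + a * Im z) (Im z)) = lborel"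
proof (rule measure_eqI)
  fix A assume "A \<in> sets (distr lborel borel (\<lambda>z. Complex (Re z + a * Im z) (Im z)))"
  then have [measurable]: "A \<in> sets borel" by simp
  have "emeasure (distr lborel borel (\<lambda>z. Complex (Re z + a * Im z) (Im z))) A =
      (\<integral>\<^sup>+z. indicator A (Complex (Re z + a * Im z) (Im z)) \<partial>lborel)"
    by (subst nn_integral_indicator[symmetric], simp, subst nn_integral_distr) (simp_all add: measurable_lborel1)
  also have "\<dots> = (\<integral>\<^sup>+y. \<integral>\<^sup>+x. indicator A (Complex (a * y + 1 * x) y) \<partial>lborel \<partial>lborel)"
    by (subst nn_integral_lborel_complex) (measurable, simp add: add.commute)
  also have "\<dots> = (\<integral>\<^sup>+y. \<integral>\<^sup>+x. indicator A (Complex x y) \<partial>lborel \<partial>lborel)"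
  proof (rule nn_integral_cong)
    fix y :: real
    show "(\<integral>\<^sup>+x. indicator A (Complex (a * y + 1 * x) y) \<partial>lborel) = (\<integral>\<^sup>+x. indicator A (Complex x y) \<partial>lborel)"
      using nn_integral_real_affine[of "\<lambda>x. indicator A (Complex x y)" 1 "a * y"] by simp
  qed
  also have "\<dots> = emeasure lborel A"
    by (subst nn_integral_lborel_complex(1)[symmetric]) simp_all
  finally show "emeasure (distr lborel borel (\<lambda>z. Complex (Re z + a * Im z) (Im z))) A = emeasure lborel A" .
qed simp

lemma lborel_distr_shear_Im:
  "distr lborel borel (\<lambda>z. Complex (Re z) (Im z + a * Re z)) = lborel"
proof (rule measure_eqI)
  fix A assume "A \<in> sets (distr lborel borel (\<lambda>z. Complex (Re z) (Im z + a * Re z)))"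
  then have [measurable]: "A \<in> sets borel" by simp
  have "emeasure (distr lborel borel (\<lambda>z. Complex (Re z) (Im z + a * Re z))) A =
      (\<integral>\<^sup>+z. indicator A (Complex (Re z) (Im z + a * Re z)) \<partial>lborel)"
    by (subst nn_integral_indicator[symmetric], simp, subst nn_integral_distr) (simp_all add: measurable_lborel1)
  also have "\<dots> = (\<integral>\<^sup>+x. \<integral>\<^sup>+y. indicator A (Complex x (a * x + 1 * y)) \<partial>lborel \<partial>lborel)"
    by (subst nn_integral_lborel_complex(2)) (measurable, simp add: add.commute)
  also have "\<dots> = (\<integral>\<^sup>+x. \<integral>\<^sup>+y. indicator A (Complex x y) \<partial>lborel \<partial>lborel)"
  proof (rule nn_integral_cong)
    fix x :: real
    show "(\<integral>\<^sup>+y. indicator A (Complex x (a * x + 1 * y)) \<partial>lborel) = (\<integral>\<^sup>+y. indicator A (Complex x y) \<partial>lborel)"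
      using nn_integral_real_affine[of "\<lambda>y. indicator A (Complex x y)" 1 "a * x"] by simp
  qed
  also have "\<dots> = emeasure lborel A"
    by (subst nn_integral_lborel_complex(2)[symmetric]) simp_all
  finally show "emeasure (distr lborel borel (\<lambda>z. Complex (Re z) (Im z + a * Re z))) A = emeasure lborel A" .
qed simp

text \<open>A rotation by an angle that is not a multiple of \<open>\<pi>\<close> is a product of three shears.\<close>
lemma lborel_distr_rotation:
  assumes u: "cmod u = 1" "Im u \<noteq> 0"
  shows "distr lborel borel ((*) u) = lborel"
proof -
  \<comment> \<open>For \<open>u = cis t\<close> this is \<open>- tan (t / 2)\<close>; the middle
    shear \<open>Y\<close> has the coefficient \<open>sin t\<close>. The quotient is the reason for
    excluding \<open>Im u = 0\<close>.\<close>
  define a where "a = (Re u - 1) / Im u"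
  define X where "X = (\<lambda>z. Complex (Re z + a * Im z) (Im z))"
  define Y where "Y = (\<lambda>z. Complex (Re z) (Im z + Im u * Re z))"
  have "(Re u)\<^sup>2 + (Im u)\<^sup>2 = 1" using u(1) cmod_power2[of u] by simp
  then have "(1 - Re u) * (1 + Re u) = (Im u)\<^sup>2" by (simp add: algebra_simps power2_eq_square)
  then have a: "a * Im u = Re u - 1" "a * (Re u + 1) = - Im u"
    using u(2) by (simp_all add: a_def field_simps power2_eq_square)
  have "(*) u = X \<circ> (Y \<circ> X)"
  proof
    fix z
    have "Re (X (Y (X z))) = (1 + a * Im u) * Re z + (a * (a * Im u) + 2 * a) * Im z"
      by (simp add: X_def Y_def algebra_simps)
    also have "a * (a * Im u) + 2 * a = - Im u" unfolding a(1) using a(2) by (simp add: algebra_simps)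
    finally have 1: "Re (X (Y (X z))) = Re (u * z)" using a(1) by (simp add: algebra_simps)
    have "Im (X (Y (X z))) = Im u * Re z + (1 + a * Im u) * Im z"
      by (simp add: X_def Y_def algebra_simps)
    then have "Im (X (Y (X z))) = Im (u * z)" using a(1) by simp
    with 1 show "u * z = (X \<circ> (Y \<circ> X)) z" by (simp add: complex_eq_iff)
  qed
  moreover have [measurable]: "X \<in> borel_measurable borel" "Y \<in> borel_measurable borel"
    unfolding X_def Y_def by measurable
  moreover have "distr lborel borel X = lborel" "distr lborel borel Y = lborel"
    unfolding X_def Y_def by (rule lborel_distr_shear_Re lborel_distr_shear_Im)+
  ultimately show ?thesis
    by (simp flip: distr_distr[where N = borel])
qed

text \<open>A disc of radius \<open>sqrt x\<close> has area \<open>pi * x\<close>, so the squared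
  modulus carries area to a multiple of length. This does the work of polar coordinates; the two
  measures are compared on the rays \<open>{x<..}\<close>.\<close>

lemma distr_square_norm_disc:
  "distr (density lborel (indicator (ball 0 1))) borel (\<lambda>z::complex. (cmod z)\<^sup>2) =
    density lborel (\<lambda>t. ennreal pi * indicator {0<..<1} t)"
proof (rule measure_eqI_lessThan)
  have E: "emeasure (distr (density lborel (indicator (ball 0 1))) borel (\<lambda>z::complex. (cmod z)\<^sup>2)) {x<..} =
      emeasure lborel (ball (0::complex) 1 \<inter> {z. x < (cmod z)\<^sup>2})" for x
  proof -
    have [measurable]: "{z::complex. x < (cmod z)\<^sup>2} \<in> sets borel" by measurable
    have pre: "(\<lambda>z::complex. (cmod z)\<^sup>2) -` {x<..} \<inter> space (density lborel (indicator (ball 0 1))) =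
        {z. x < (cmod z)\<^sup>2}" by auto
    show ?thesis
      by (subst emeasure_distr, simp, simp, subst pre, subst emeasure_restricted) simp_all
  qed
  fix x :: real
  have B: "emeasure lborel (ball (0::complex) 1) = ennreal pi"
    by (subst emeasure_ball) (simp_all add: unit_ball_vol_2)
  have "emeasure lborel (ball (0::complex) 1 \<inter> {z. x < (cmod z)\<^sup>2}) \<le> ennreal pi"
    unfolding B[symmetric] by (intro emeasure_mono) auto
  then show "emeasure (distr (density lborel (indicator (ball 0 1))) borel (\<lambda>z::complex. (cmod z)\<^sup>2)) {x<..} < \<infinity>"
    unfolding E using order_le_less_trans by fastforce
  have R: "emeasure (density lborel (\<lambda>t. ennreal pi * indicator {0<..<1} t)) {x<..} =
      ennreal pi * emeasure lborel ({0<..<1} \<inter> {x<..})"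
    by (subst emeasure_density) (simp_all add: nn_integral_cmult mult.assoc flip: indicator_inter_arith)
  consider "x < 0" | "0 \<le> x" "x < 1" | "1 \<le> x" by linarith
  then show "emeasure (distr (density lborel (indicator (ball 0 1))) borel (\<lambda>z::complex. (cmod z)\<^sup>2)) {x<..} =
      emeasure (density lborel (\<lambda>t. ennreal pi * indicator {0<..<1} t)) {x<..}"
  proof cases
    case 1
    have "ball (0::complex) 1 \<inter> {z. x < (cmod z)\<^sup>2} = ball 0 1"
      using 1 by (auto intro: less_le_trans)
    moreover have "{0<..<1} \<inter> {x<..} = {0<..<1::real}" using 1 by auto
    ultimately show ?thesis unfolding E R by (simp add: B)
  next
    case 2
    have "ball (0::complex) 1 \<inter> {z. x < (cmod z)\<^sup>2} = ball 0 1 - cball 0 (sqrt x)"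
    proof -
      have "x < (cmod z)\<^sup>2 \<longleftrightarrow> \<not> cmod z \<le> sqrt x" for z
        using real_sqrt_less_iff[of x "(cmod z)\<^sup>2"] by auto
      then show ?thesis by (simp only: set_eq_iff Int_iff Diff_iff mem_Collect_eq mem_cball dist_0_norm simp_thms)
    qed
    moreover have "emeasure lborel (cball (0::complex) (sqrt x)) = ennreal (pi * x)"
      using 2 by (subst emeasure_cball) (simp_all add: unit_ball_vol_2)
    moreover have "cball (0::complex) (sqrt x) \<subseteq> ball 0 1" 
    proof
      fix z :: complex assume "z \<in> cball 0 (sqrt x)"
      then have "cmod z \<le> sqrt x" by simp
      also have "sqrt x < 1" using 2 by simp
      finally show "z \<in> ball 0 1" by simp
    qed
    ultimately have "emeasure lborel (ball (0::complex) 1 \<inter> {z. x < (cmod z)\<^sup>2}) = ennreal pi - ennreal (pi * x)"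
      by (simp add: emeasure_Diff B)
    also have "\<dots> = ennreal pi * ennreal (1 - x)"
      using 2 by (simp add: ennreal_minus ennreal_mult[symmetric] algebra_simps)
    moreover have "{0<..<1} \<inter> {x<..} = {x<..<1::real}" using 2 by auto
    ultimately show ?thesis unfolding E R using 2 by simp
  next
    case 3
    have "ball (0::complex) 1 \<inter> {z. x < (cmod z)\<^sup>2} = {}"
    proof -
      have "(cmod z)\<^sup>2 \<le> x" if "cmod z < 1" for z
        using that 3 power_le_one[of "cmod z" 2] by simp
      then show ?thesis by force
    qed
    moreover have "{0<..<1} \<inter> {x<..} = ({}::real set)" using 3 by auto
    ultimately show ?thesis unfolding E R by simp
  qed
qed simp_all

lemma nn_integral_disc_radial:
  assumes [measurable]: "f \<in> borel_measurable borel"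
  shows "(\<integral>\<^sup>+z. f ((cmod z)\<^sup>2) * indicator (ball 0 1) z \<partial>lborel) =
    ennreal pi * (\<integral>\<^sup>+t. f t * indicator {0<..<1} t \<partial>lborel)"
proof -
  have "(\<integral>\<^sup>+z. f ((cmod z)\<^sup>2) * indicator (ball 0 1) z \<partial>lborel) =
      (\<integral>\<^sup>+t. f t \<partial>distr (density lborel (indicator (ball 0 1))) borel (\<lambda>z::complex. (cmod z)\<^sup>2))"
    by (subst nn_integral_distr, simp, simp, subst nn_integral_density, simp_all add: mult.commute)
  also have "\<dots> = ennreal pi * (\<integral>\<^sup>+t. f t * indicator {0<..<1} t \<partial>lborel)"
    unfolding distr_square_norm_disc
    by (simp add: nn_integral_density nn_integral_cmult[symmetric] mult_ac)
  finally show ?thesis .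
qed

section \<open>The weighted area measure: moments, orthogonality, reproducing formula\<close>

definition disc_area :: "real \<Rightarrow> complex measure" where
  "disc_area \<alpha> = density lborel
     (\<lambda>z. ennreal ((\<alpha> + 1) / pi * (1 - (cmod z)\<^sup>2) powr \<alpha>) * indicator (ball 0 1) z)"

lemma sets_disc_area [simp, measurable_cong]: "sets (disc_area \<alpha>) = sets borel"
  by (simp add: disc_area_def)

lemma space_disc_area [simp]: "space (disc_area \<alpha>) = UNIV"
  by (simp add: disc_area_def)

lemma AE_disc_area: "AE z in disc_area \<alpha>. z \<in> ball 0 1"
  unfolding disc_area_def by (subst AE_density) (auto simp: indicator_def)

text \<open>The Taylor coefficients of \<open>(1 - t) powr (- (\<alpha> + 2))\<close>. They are also
  the reciprocals of the squared norms of the monomials, and this coincidence makes the kernel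
  reproduce.\<close>

definition bergman_coeff :: "real \<Rightarrow> nat \<Rightarrow> real" where
  "bergman_coeff \<alpha> n = pochhammer (\<alpha> + 2) n / fact n"

lemma bergman_coeff_pos: "\<alpha> > -1 \<Longrightarrow> 0 < bergman_coeff \<alpha> n"
  unfolding bergman_coeff_def by (intro divide_pos_pos pochhammer_pos) auto

lemma bergman_coeff_sums:
  assumes "\<bar>r\<bar> < 1"
  shows "(\<lambda>n. bergman_coeff \<alpha> n * r ^ n) sums (1 - r) powr (- (\<alpha> + 2))"
proof -
  have "((- (\<alpha> + 2)) gchoose n) * (- r) ^ n = bergman_coeff \<alpha> n * r ^ n" for n
  proof -
    have "(- 1) ^ n * (- r) ^ n = r ^ n" by (simp flip: power_mult_distrib)
    moreover have "((- (\<alpha> + 2)) gchoose n) * (- r) ^ n = bergman_coeff \<alpha> n * ((- 1) ^ n * (- r) ^ n)"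
      by (simp add: gbinomial_pochhammer bergman_coeff_def add.commute)
    ultimately show ?thesis by simp
  qed
  then show ?thesis
    using gen_binomial_real[of "- r" "- (\<alpha> + 2)"] assms by simp
qed

lemma bergman_coeff_summable: "\<bar>r\<bar> < 1 \<Longrightarrow> summable (\<lambda>n. bergman_coeff \<alpha> n * r ^ n)"
  using bergman_coeff_sums sums_summable by blast

text \<open>The substitution of the squared modulus by \<open>t\<close> gives
  \<open>\<alpha> + 1\<close> times the Beta integral with parameters \<open>n + 1\<close> and
  \<open>\<alpha> + 1\<close>. The exponents in \<open>h\<close> are kept in the shape of the Beta
  integrand; the functional equation of Gamma absorbs the factor
  \<open>\<alpha> + 1\<close>.\<close>

lemma disc_area_moment:
  assumes \<alpha>: "\<alpha> > -1"
  shows "(\<integral>\<^sup>+z. ennreal ((cmod z) ^ (2 * n)) \<partial>disc_area \<alpha>) = ennreal (1 / bergman_coeff \<alpha> n)"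
proof -
  define h where "h t = t powr (real n + 1 - 1) * (1 - t) powr (\<alpha> + 1 - 1)" for t :: real
  define c where "c = (\<alpha> + 1) / pi"
  have "c > 0" using \<alpha> by (simp add: c_def)
  have [measurable]: "h \<in> borel_measurable borel" unfolding h_def by measurable
  have "((\<lambda>t. if t \<in> {0..1} then h t else 0) has_integral Beta (real n + 1) (\<alpha> + 1)) UNIV"
    using has_integral_Beta_real[of "real n + 1" "\<alpha> + 1"] \<alpha> unfolding h_def[symmetric] by (subst has_integral_restrict_UNIV) auto
  then have "(\<integral>\<^sup>+t. ennreal (if t \<in> {0..1} then h t else 0) \<partial>lborel) = ennreal (Beta (real n + 1) (\<alpha> + 1))"
    by (intro nn_integral_has_integral_lborel) (auto simp: h_def)
  also have "(\<integral>\<^sup>+t. ennreal (if t \<in> {0..1} then h t else 0) \<partial>lborel) =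
      (\<integral>\<^sup>+t. ennreal (t ^ n * (1 - t) powr \<alpha>) * indicator {0<..<1} t \<partial>lborel)"
  proof (rule nn_integral_cong_AE)
    show "AE t in lborel. ennreal (if t \<in> {0..1} then h t else 0) = ennreal (t ^ n * (1 - t) powr \<alpha>) * indicator {0<..<1} t"
      using AE_lborel_singleton[of 0] AE_lborel_singleton[of 1]
      by eventually_elim (auto simp: h_def powr_realpow indicator_def)
  qed
  finally have beta: "(\<integral>\<^sup>+t. ennreal (t ^ n * (1 - t) powr \<alpha>) * indicator {0<..<1} t \<partial>lborel) = ennreal (Beta (real n + 1) (\<alpha> + 1))" .
  have "(\<integral>\<^sup>+z. ennreal ((cmod z) ^ (2 * n)) \<partial>disc_area \<alpha>) =
      (\<integral>\<^sup>+z. (ennreal c * ennreal (((cmod z)\<^sup>2) ^ n * (1 - (cmod z)\<^sup>2) powr \<alpha>)) * indicator (ball 0 1) z \<partial>lborel)"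
    unfolding disc_area_def c_def[symmetric] power_mult
    by (subst nn_integral_density) (use \<open>c > 0\<close> in \<open>auto intro!: nn_integral_cong simp: indicator_def ennreal_mult' mult_ac\<close>)
  also have "\<dots> = ennreal pi * (\<integral>\<^sup>+t. (ennreal c * ennreal (t ^ n * (1 - t) powr \<alpha>)) * indicator {0<..<1} t \<partial>lborel)"
    by (rule nn_integral_disc_radial) measurable
  also have "\<dots> = ennreal pi * (ennreal c * ennreal (Beta (real n + 1) (\<alpha> + 1)))"
    by (simp add: mult.assoc nn_integral_cmult beta)
  also have "\<dots> = ennreal ((\<alpha> + 1) * Beta (real n + 1) (\<alpha> + 1))"
    using \<open>c > 0\<close> by (simp add: c_def flip: ennreal_mult')
  also have "(\<alpha> + 1) * Beta (real n + 1) (\<alpha> + 1) = 1 / bergman_coeff \<alpha> n"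
  proof -
    have nn: "\<alpha> + 2 \<notin> \<int>\<^sub>\<le>\<^sub>0" "\<alpha> + 1 \<notin> \<int>\<^sub>\<le>\<^sub>0" using \<alpha> by (auto elim!: nonpos_Ints_cases)
    have pos: "Gamma (\<alpha> + 2) > 0" "Gamma (\<alpha> + 2 + real n) > 0" using \<alpha> by (auto intro!: Gamma_real_pos)
    have "Gamma (\<alpha> + 2) = (\<alpha> + 1) * Gamma (\<alpha> + 1)"
      using Gamma_plus1[OF nn(2)] by (simp add: add.assoc)
    moreover have "Gamma (real n + 1) = fact n" using Gamma_fact[of n, where ?'a = real] by (simp add: add.commute)
    moreover have "real n + 1 + (\<alpha> + 1) = \<alpha> + 2 + real n" by simp
    ultimately have "(\<alpha> + 1) * Beta (real n + 1) (\<alpha> + 1) = fact n * Gamma (\<alpha> + 2) / Gamma (\<alpha> + 2 + real n)"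
      by (simp only: Beta_def) (simp add: mult_ac)
    then show ?thesis unfolding bergman_coeff_def pochhammer_Gamma[OF nn(1)] using pos by (simp add: field_simps)
  qed
  finally show ?thesis .
qed

lemma finite_measure_disc_area: "\<alpha> > -1 \<Longrightarrow> finite_measure (disc_area \<alpha>)"
  using disc_area_moment[of \<alpha> 0] by (intro finite_measureI) (simp add: bergman_coeff_def)

lemma integral_moment_disc_area:
  assumes "\<alpha> > -1"
  shows "integrable (disc_area \<alpha>) (\<lambda>z. (cmod z) ^ (2 * n))"
    and "(LINT z|disc_area \<alpha>. (cmod z) ^ (2 * n)) = 1 / bergman_coeff \<alpha> n"
  using disc_area_moment[OF assms, of n] bergman_coeff_pos[OF assms, of n]
  by (subst (asm) nn_integral_eq_integrable; simp)+

lemma disc_area_rotation: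
  assumes u: "cmod u = 1" "Im u \<noteq> 0"
  shows "distr (disc_area \<alpha>) borel ((*) u) = disc_area \<alpha>"
proof -
  let ?w = "\<lambda>z. ennreal ((\<alpha> + 1) / pi * (1 - (cmod z)\<^sup>2) powr \<alpha>) * indicator (ball 0 1) z"
  have "disc_area \<alpha> = density (distr lborel borel ((*) u)) ?w"
    by (simp add: lborel_distr_rotation[OF u] disc_area_def)
  also have "\<dots> = distr (density lborel (\<lambda>z. ?w (u * z))) borel ((*) u)"
    by (rule density_distr) (simp_all add: measurable_lborel1)
  also have "(\<lambda>z. ?w (u * z)) = ?w"
    using u(1) by (auto simp: norm_mult indicator_def)
  finally show ?thesis by (simp add: disc_area_def)
qed

text \<open>A suitable rotation multiplies the integrand by \<open>\<i>\<close> and leaves the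
  measure alone, so the integral equals \<open>\<i>\<close> times itself. The cutoff at radius
  \<open>R\<close> is invariant under rotations; it is there because power series are first
  integrated on smaller discs.\<close>

lemma integral_monomials_disc_area:
  assumes "n \<noteq> m"
  shows "(LINT z|disc_area \<alpha>. indicator (ball 0 R) z *\<^sub>R (cnj z ^ n * z ^ m)) = 0"
proof -
  define d where "d = real m - real n"
  have "d \<noteq> 0" using assms by (simp add: d_def)
  have d1: "\<bar>d\<bar> \<ge> 1" using assms unfolding d_def by linarith
  \<comment> \<open>Chosen so that the total phase \<open>d * \<theta>\<close> is
    \<open>pi / 2\<close>. Since \<open>d\<close> is a nonzero integer, the modulus of
    \<open>\<theta>\<close> is at most \<open>pi / 2\<close>, and the rotation has a nonzero
    sine.\<close>
  define \<theta> where "\<theta> = pi / (2 * d)"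
  define u where "u = cis \<theta>"
  have "sin \<theta> \<noteq> 0"
  proof -
    have "0 < \<bar>\<theta>\<bar>" "\<bar>\<theta>\<bar> < pi" using d1 by (auto simp: \<theta>_def field_simps abs_mult pi_gt_zero intro: less_le_trans[of _ "pi * 2"])
    then show ?thesis using sin_gt_zero[of "\<bar>\<theta>\<bar>"] by (auto simp: abs_if split: if_splits)
  qed
  then have u: "cmod u = 1" "Im u \<noteq> 0" by (auto simp: u_def)
  have "cnj u ^ n * u ^ m = cis (real m * \<theta> - real n * \<theta>)"
    by (simp add: u_def cis_cnj Complex.DeMoivre cis_mult)
  also have "real m * \<theta> - real n * \<theta> = pi / 2"
  proof -
    have "real m * \<theta> - real n * \<theta> = d * \<theta>" unfolding d_def by (rule left_diff_distrib[symmetric])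
    then show ?thesis using \<open>d \<noteq> 0\<close> by (simp add: \<theta>_def)
  qed
  finally have uu: "cnj u ^ n * u ^ m = \<i>" by (simp add: complex_eq_iff)
  let ?f = "\<lambda>z. indicator (ball 0 R) z *\<^sub>R (cnj z ^ n * z ^ m) :: complex"
  have [measurable]: "?f \<in> borel_measurable borel" by measurable
  have "integral\<^sup>L (disc_area \<alpha>) ?f = (LINT z|disc_area \<alpha>. ?f (u * z))"
    by (subst disc_area_rotation[OF u, symmetric], subst integral_distr) (simp_all add: measurable_lborel1)
  also have "(\<lambda>z. ?f (u * z)) = (\<lambda>z. \<i> * ?f z)"
    using u(1) by (auto simp: uu[symmetric] power_mult_distrib norm_mult indicator_def)
  finally have "integral\<^sup>L (disc_area \<alpha>) ?f = \<i> * integral\<^sup>L (disc_area \<alpha>) ?f" by (simp only: integral_mult_right_zero)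
  from eq_iff_diff_eq_0[THEN iffD1, OF this]
  have "(1 - \<i>) * integral\<^sup>L (disc_area \<alpha>) ?f = 0" by (simp only: left_diff_distrib mult_1_left)
  moreover have "1 - \<i> \<noteq> 0" by (simp add: complex_eq_iff)
  ultimately show ?thesis by (simp only: mult_eq_0_iff) simp
qed

text \<open>The Taylor series converges uniformly only on smaller discs. Orthogonality is therefore
  applied on \<open>ball 0 R\<close>, where just the term of index \<open>n\<close> survives, and
  dominated convergence lets \<open>R\<close> tend to \<open>1\<close> on both sides.\<close>

lemma holomorphic_moment_disc_area:
  assumes \<alpha>: "\<alpha> > -1" and hol: "g holomorphic_on ball 0 1"
    and int: "integrable (disc_area \<alpha>) g"
  shows "(LINT z|disc_area \<alpha>. cnj z ^ n * g z) = (deriv ^^ n) g 0 / fact n / bergman_coeff \<alpha> n"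
proof -
  interpret finite_measure "disc_area \<alpha>" by (rule finite_measure_disc_area[OF \<alpha>])
  define a where "a m = (deriv ^^ m) g 0 / fact m" for m
  have [measurable]: "g \<in> borel_measurable borel"
    using borel_measurable_integrable[OF int] by simp
  have a: "(\<lambda>m. a m * z ^ m) sums g z" if "cmod z < 1" for z
    using holomorphic_power_series[OF hol, of z] that by (simp add: a_def)
  have small: "(LINT z|disc_area \<alpha>. indicator (ball 0 R) z *\<^sub>R (cnj z ^ n * g z)) =
      a n * (LINT z|disc_area \<alpha>. indicator (ball 0 R) z *\<^sub>R (cnj z ^ n * z ^ n))" if R: "0 < R" "R < 1" for R
  proof -
    let ?f = "\<lambda>m z. indicator (ball 0 R) z *\<^sub>R (cnj z ^ n * (a m * z ^ m)) :: complex"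
    \<comment> \<open>Convergence at the larger radius \<open>R'\<close> gives absolute convergence
      at \<open>R\<close>, hence a summable majorant on the smaller disc.\<close>
    obtain R' where R': "R < R'" "R' < 1" using R dense by blast
    have "summable (\<lambda>m. a m * of_real R' ^ m)" using a[of "of_real R'"] R R' sums_summable by force
    then have sR: "summable (\<lambda>m. norm (a m) * R ^ m)"
      using powser_insidea[of a "of_real R'" "of_real R"] R R' by (simp add: norm_mult norm_power)
    have bnd: "norm (?f m z) \<le> norm (a m) * R ^ m" for m z
    proof (cases "cmod z < R")
      case True
      have "norm (?f m z) = cmod z ^ n * (norm (a m) * cmod z ^ m)"
        using True by (simp add: norm_mult norm_power)
      also have "\<dots> \<le> 1 * (norm (a m) * R ^ m)"
        using True R by (intro mult_mono power_le_one power_mono) auto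
      finally show ?thesis by simp
    qed (use R in simp)
    have fint: "integrable (disc_area \<alpha>) (?f m)" for m
      by (rule integrable_const_bound[where B = "norm (a m) * R ^ m"], simp only: bnd always_eventually simp_thms) measurable
    have A: "(\<lambda>m. integral\<^sup>L (disc_area \<alpha>) (?f m)) sums (LINT z|disc_area \<alpha>. (\<Sum>m. ?f m z))"
    proof (rule sums_integral[OF fint])
      show "AE z in disc_area \<alpha>. summable (\<lambda>m. norm (?f m z))"
        by (intro always_eventually allI summable_comparison_test'[OF sR, of 0]) (use bnd in auto)
      show "summable (\<lambda>m. LINT z|disc_area \<alpha>. norm (?f m z))"
      proof (rule summable_comparison_test'[of "\<lambda>m. norm (a m) * R ^ m * measure (disc_area \<alpha>) UNIV" 0])
        show "summable (\<lambda>m. norm (a m) * R ^ m * measure (disc_area \<alpha>) UNIV)" by (intro summable_mult2 sR)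
        fix m
        have "(LINT z|disc_area \<alpha>. norm (?f m z)) \<le> (LINT z|disc_area \<alpha>. norm (a m) * R ^ m)"
          using fint by (intro integral_mono integrable_norm bnd) auto
        then show "norm (LINT z|disc_area \<alpha>. norm (?f m z)) \<le> norm (a m) * R ^ m * measure (disc_area \<alpha>) UNIV"
          by (simp add: mult_ac)
      qed
    qed
    have B: "(\<lambda>z. \<Sum>m. ?f m z) = (\<lambda>z. indicator (ball 0 R) z *\<^sub>R (cnj z ^ n * g z))"
    proof
      fix z
      show "(\<Sum>m. ?f m z) = indicator (ball 0 R) z *\<^sub>R (cnj z ^ n * g z)"
      proof (cases "cmod z < R")
        case True
        then show ?thesis using a[of z] R by (auto intro!: sums_unique[symmetric] sums_mult)
      qed simp
    qed
    have "(\<lambda>m. integral\<^sup>L (disc_area \<alpha>) (?f m)) sums integral\<^sup>L (disc_area \<alpha>) (?f n)"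
    proof (rule sums_If_finite_set[of "{n}" "\<lambda>m. integral\<^sup>L (disc_area \<alpha>) (?f m)", simplified, THEN sums_cong[THEN iffD1, rotated]])
      fix m
      have "?f m = (\<lambda>z. a m * (indicator (ball 0 R) z *\<^sub>R (cnj z ^ n * z ^ m)))" by (simp add: fun_eq_iff mult_ac)
      then have "integral\<^sup>L (disc_area \<alpha>) (?f m) = a m * (LINT z|disc_area \<alpha>. indicator (ball 0 R) z *\<^sub>R (cnj z ^ n * z ^ m))"
        by (simp only: integral_mult_right_zero)
      then show "(if m = n then integral\<^sup>L (disc_area \<alpha>) (?f m) else 0) = integral\<^sup>L (disc_area \<alpha>) (?f m)"
        using integral_monomials_disc_area[of n m \<alpha> R] by auto
    qed
    then have "integral\<^sup>L (disc_area \<alpha>) (?f n) = (LINT z|disc_area \<alpha>. indicator (ball 0 R) z *\<^sub>R (cnj z ^ n * g z))"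
      by (rule sums_unique2[OF _ A[unfolded B]])
    moreover have "?f n = (\<lambda>z. a n * (indicator (ball 0 R) z *\<^sub>R (cnj z ^ n * z ^ n)))" by (simp add: fun_eq_iff mult_ac)
    ultimately show ?thesis by (simp only: integral_mult_right_zero)
  qed
  \<comment> \<open>The shift by \<open>2\<close> makes the first radius \<open>1 / 2\<close>, so
    that all radii are positive.\<close>
  define R where "R k = 1 - 1 / real (k + 2)" for k
  have R: "0 < R k" "R k < 1" for k by (simp_all add: R_def field_simps)
  have Rlim: "R \<longlonglongrightarrow> 1" unfolding R_def by real_asymp
  have lim: "(\<lambda>k. LINT z|disc_area \<alpha>. indicator (ball 0 (R k)) z *\<^sub>R (cnj z ^ n * f z)) \<longlonglongrightarrow>
      (LINT z|disc_area \<alpha>. cnj z ^ n * f z)" if f: "integrable (disc_area \<alpha>) f" for f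
  proof (rule integral_dominated_convergence[where w = "\<lambda>z. norm (f z)"])
    have [measurable]: "f \<in> borel_measurable borel"
      using borel_measurable_integrable[OF f] by simp
    show "(\<lambda>z. cnj z ^ n * f z) \<in> borel_measurable (disc_area \<alpha>)"
      "(\<lambda>z. indicator (ball 0 (R k)) z *\<^sub>R (cnj z ^ n * f z)) \<in> borel_measurable (disc_area \<alpha>)" for k
      by measurable
    show "AE z in disc_area \<alpha>. (\<lambda>k. indicator (ball 0 (R k)) z *\<^sub>R (cnj z ^ n * f z)) \<longlonglongrightarrow> cnj z ^ n * f z"
      using AE_disc_area[of \<alpha>]
    proof eventually_elim
      case (elim z)
      then have "eventually (\<lambda>k. cmod z < R k) sequentially" using order_tendstoD(1)[OF Rlim] by simp
      then show ?case by (rule tendsto_eventually[OF eventually_mono]) simp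
    qed
    show "AE z in disc_area \<alpha>. norm (indicator (ball 0 (R k)) z *\<^sub>R (cnj z ^ n * f z)) \<le> norm (f z)" for k
      using AE_disc_area[of \<alpha>]
    proof eventually_elim
      case (elim z)
      then have "cmod z ^ n * cmod (f z) \<le> 1 * cmod (f z)" by (intro mult_right_mono power_le_one) auto
      then show ?case by (simp add: indicator_def norm_mult norm_power)
    qed
  qed (use f in simp)
  have "integrable (disc_area \<alpha>) (\<lambda>z. z ^ n)"
  proof (rule integrable_const_bound[where B = 1])
    show "AE z in disc_area \<alpha>. norm (z ^ n) \<le> 1"
      using AE_disc_area[of \<alpha>] by eventually_elim (auto simp: norm_power intro: power_le_one)
  qed simp
  from tendsto_mult_left[OF lim[OF this], of "a n"] lim[OF int]
  have "(LINT z|disc_area \<alpha>. cnj z ^ n * g z) = a n * (LINT z|disc_area \<alpha>. cnj z ^ n * z ^ n)"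
    unfolding small[OF R] by (rule LIMSEQ_unique[rotated])
  also have "(LINT z|disc_area \<alpha>. cnj z ^ n * z ^ n) = (LINT z|disc_area \<alpha>. complex_of_real (cmod z ^ (2 * n)))"
  proof (intro Bochner_Integration.integral_cong refl)
    fix z
    have "cnj z ^ n * z ^ n = (complex_of_real ((cmod z)\<^sup>2)) ^ n"
      by (simp only: complex_norm_square power_mult_distrib mult.commute)
    then show "cnj z ^ n * z ^ n = complex_of_real (cmod z ^ (2 * n))"
      by (simp only: power_mult of_real_power)
  qed
  also have "\<dots> = of_real (1 / bergman_coeff \<alpha> n)"
    unfolding integral_complex_of_real integral_moment_disc_area[OF \<alpha>] ..
  finally show ?thesis by (simp add: a_def)
qed

text \<open>For fixed \<open>w\<close> the kernel series is dominated on the disc by a summable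
  series, so it can be integrated termwise against \<open>g\<close>. In each term the coefficient
  cancels the norm factor of the moment and leaves a term of the Taylor series of \<open>g\<close>
  at \<open>w\<close>.\<close>

theorem disc_reproducing:
  assumes \<alpha>: "\<alpha> > -1" and hol: "g holomorphic_on ball 0 1"
    and int: "integrable (disc_area \<alpha>) g" and w: "cmod w < 1"
  shows "(LINT z|disc_area \<alpha>. (\<Sum>n. of_real (bergman_coeff \<alpha> n) * w ^ n * cnj z ^ n) * g z) = g w"
proof -
  let ?f = "\<lambda>n z. of_real (bergman_coeff \<alpha> n) * w ^ n * cnj z ^ n * g z"
  have [measurable]: "g \<in> borel_measurable borel"
    using borel_measurable_integrable[OF int] by simp
  have cp: "bergman_coeff \<alpha> n \<ge> 0" for n using bergman_coeff_pos[OF \<alpha>, of n] by simp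
  have sw: "summable (\<lambda>n. bergman_coeff \<alpha> n * cmod w ^ n)" using w by (intro bergman_coeff_summable) simp
  have bnd: "norm (?f n z) \<le> bergman_coeff \<alpha> n * cmod w ^ n * norm (g z)" if "cmod z < 1" for n z
  proof -
    have "norm (?f n z) = bergman_coeff \<alpha> n * cmod w ^ n * norm (g z) * cmod z ^ n"
      using cp by (simp add: norm_mult norm_power)
    also have "\<dots> \<le> bergman_coeff \<alpha> n * cmod w ^ n * norm (g z) * 1"
      using cp that by (intro mult_left_mono power_le_one) auto
    finally show ?thesis by simp
  qed
  have bndAE: "AE z in disc_area \<alpha>. norm (?f n z) \<le> bergman_coeff \<alpha> n * cmod w ^ n * norm (g z)" for n
    using AE_disc_area[of \<alpha>] by eventually_elim (use bnd in auto)
  have fint: "integrable (disc_area \<alpha>) (?f n)" for n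
  proof (rule Bochner_Integration.integrable_bound[of _ "\<lambda>z. bergman_coeff \<alpha> n * cmod w ^ n * norm (g z)"])
    show "AE z in disc_area \<alpha>. norm (?f n z) \<le> norm (bergman_coeff \<alpha> n * cmod w ^ n * norm (g z))"
      using bndAE[of n] cp by (simp add: abs_mult)
    show "?f n \<in> borel_measurable (disc_area \<alpha>)" by measurable
  qed (use int in simp)
  have S: "(\<lambda>n. integral\<^sup>L (disc_area \<alpha>) (?f n)) sums (LINT z|disc_area \<alpha>. (\<Sum>n. ?f n z))"
  proof (rule sums_integral[OF fint])
    show "AE z in disc_area \<alpha>. summable (\<lambda>n. norm (?f n z))"
      using AE_disc_area[of \<alpha>]
    proof eventually_elim
      case (elim z)
      show ?case
        by (rule summable_comparison_test'[OF summable_mult2[OF sw, of "norm (g z)"], of 0]) (use bnd elim in auto)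
    qed
    show "summable (\<lambda>n. LINT z|disc_area \<alpha>. norm (?f n z))"
    proof (rule summable_comparison_test'[OF summable_mult2[OF sw, of "LINT z|disc_area \<alpha>. norm (g z)"], of 0])
      fix n
      have "(LINT z|disc_area \<alpha>. norm (?f n z)) \<le> (LINT z|disc_area \<alpha>. bergman_coeff \<alpha> n * cmod w ^ n * norm (g z))"
        using int by (intro integral_mono_AE integrable_norm fint bndAE integrable_mult_right)
      then show "norm (LINT z|disc_area \<alpha>. norm (?f n z)) \<le> bergman_coeff \<alpha> n * cmod w ^ n * (LINT z|disc_area \<alpha>. norm (g z))"
        by simp
    qed
  qed
  have M: "integral\<^sup>L (disc_area \<alpha>) (?f n) = (deriv ^^ n) g 0 / fact n * (w - 0) ^ n" for n
  proof -
    have "integral\<^sup>L (disc_area \<alpha>) (?f n) = of_real (bergman_coeff \<alpha> n) * w ^ n * (LINT z|disc_area \<alpha>. cnj z ^ n * g z)"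
      by (simp only: mult.assoc integral_mult_right_zero)
    also have "\<dots> = (deriv ^^ n) g 0 / fact n * w ^ n"
      using bergman_coeff_pos[OF \<alpha>, of n] by (simp add: holomorphic_moment_disc_area[OF \<alpha> hol int])
    finally show ?thesis by simp
  qed
  have "w \<in> ball 0 1" using w by simp
  from sums_unique2[OF S[unfolded M] holomorphic_power_series[OF hol this]]
  have "(LINT z|disc_area \<alpha>. (\<Sum>n. ?f n z)) = g w" .
  also have "(LINT z|disc_area \<alpha>. (\<Sum>n. ?f n z)) =
      (LINT z|disc_area \<alpha>. (\<Sum>n. of_real (bergman_coeff \<alpha> n) * w ^ n * cnj z ^ n) * g z)"
  proof (rule integral_cong_AE)
    show "AE z in disc_area \<alpha>. (\<Sum>n. ?f n z) = (\<Sum>n. of_real (bergman_coeff \<alpha> n) * w ^ n * cnj z ^ n) * g z"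
      using AE_disc_area[of \<alpha>]
    proof eventually_elim
      case (elim z)
      have "summable (\<lambda>n. of_real (bergman_coeff \<alpha> n) * w ^ n * cnj z ^ n)"
      proof (rule summable_comparison_test'[OF sw, of 0])
        fix n
        have "cmod w ^ n * cmod z ^ n \<le> cmod w ^ n * 1" using elim by (intro mult_left_mono power_le_one) auto
        then show "norm (of_real (bergman_coeff \<alpha> n) * w ^ n * cnj z ^ n) \<le> bergman_coeff \<alpha> n * cmod w ^ n"
          using cp[of n] by (simp add: norm_mult norm_power mult.assoc mult_left_mono)
      qed
      then show ?case by (rule suminf_mult2[symmetric])
    qed
  qed measurable
  finally show ?thesis .
qed

section \<open>Slice hyperholomorphic functions and power series\<close>

lemma imag_units_iff: "i \<in> imag_units \<longleftrightarrow> qRe i = 0 \<and> qI i * qI i + qJ i * qJ i + qK i * qK i = 1"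
  by (auto simp: imag_units_def norm_quat_def qnorm_sq_def power2_eq_square)

lemma imag_unit_square: "i \<in> imag_units \<Longrightarrow> i * i = - 1"
  by (auto simp: imag_units_iff quat_eq_iff)

lemma imag_unit_uminus: "i \<in> imag_units \<Longrightarrow> - i \<in> imag_units"
  by (simp add: imag_units_def)

lemma slice_embed_scaleR: "slice_embed i z = Re z *\<^sub>R 1 + Im z *\<^sub>R i"
  by (simp add: slice_embed_def of_real_def)

lemma bounded_linear_slice_embed: "bounded_linear (slice_embed i)"
  unfolding slice_embed_scaleR
  by (intro bounded_linear_add bounded_linear_compose[OF bounded_linear_scaleR_left bounded_linear_Re]
      bounded_linear_compose[OF bounded_linear_scaleR_left bounded_linear_Im])

lemma slice_embed_of_real [simp]: "slice_embed i (of_real r) = of_real r"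
  and slice_embed_1 [simp]: "slice_embed i 1 = 1"
  by (simp_all add: slice_embed_def algebra_simps)

lemma slice_embed_mult:
  assumes "i \<in> imag_units"
  shows "slice_embed i (z * w) = slice_embed i z * slice_embed i w"
proof -
  have "slice_embed i z * slice_embed i w = (Re z * Re w) *\<^sub>R 1 + (Re z * Im w) *\<^sub>R i + (Im z * Re w) *\<^sub>R i
      + (Im z * Im w) *\<^sub>R (i * i)"
    by (simp add: slice_embed_scaleR algebra_simps)
  then show ?thesis by (simp add: imag_unit_square[OF assms] slice_embed_scaleR algebra_simps)
qed

lemma slice_embed_power: "i \<in> imag_units \<Longrightarrow> slice_embed i (z ^ n) = slice_embed i z ^ n"
  by (induction n) (simp_all add: slice_embed_mult)

lemma qcnj_slice_embed: "i \<in> imag_units \<Longrightarrow> qcnj (slice_embed i z) = slice_embed i (cnj z)"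
  by (simp add: slice_embed_scaleR imag_units_iff quat_eq_iff)

lemma slice_embed_uminus_unit: "slice_embed (- i) z = slice_embed i (cnj z)"
  by (simp add: slice_embed_scaleR)

lemma norm_slice_embed [simp]: "i \<in> imag_units \<Longrightarrow> norm (slice_embed i z) = cmod z"
proof -
  assume i: "i \<in> imag_units"
  have "of_real ((norm (slice_embed i z))\<^sup>2) = slice_embed i z * qcnj (slice_embed i z)"
    by (rule mult_qcnj_norm(1)[symmetric])
  also have "\<dots> = slice_embed i (z * cnj z)"
    by (simp only: qcnj_slice_embed[OF i] slice_embed_mult[OF i])
  also have "\<dots> = of_real ((cmod z)\<^sup>2)"
    by (simp only: complex_norm_square[symmetric] slice_embed_of_real)
  finally show ?thesis by (simp only: of_real_eq_iff power2_eq_iff_nonneg norm_ge_zero)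
qed

text \<open>The orthogonal projection of the quaternions onto the slice of \<open>i\<close>, read as
  a complex number. What matters is that it is linear for multiplication from the left by elements
  of that slice.\<close>

definition slice_coord :: "quat \<Rightarrow> quat \<Rightarrow> complex" where
  "slice_coord i x = Complex (inner 1 x) (inner i x)"

lemma bounded_linear_slice_coord: "bounded_linear (slice_coord i)"
  unfolding linear_conv_bounded_linear[symmetric]
  by (intro linearI) (simp_all add: slice_coord_def inner_add_right complex_eq_iff)

lemma slice_coord_mult:
  assumes "i \<in> imag_units"
  shows "slice_coord i (slice_embed i z * x) = z * slice_coord i x"
proof -
  have i: "qRe i = 0" "qI i * qI i + qJ i * qJ i + qK i * qK i = 1"
    using assms by (auto simp: imag_units_iff)
  interpret c: bounded_linear "slice_coord i" by (rule bounded_linear_slice_coord)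
  have "slice_coord i (i * x) = \<i> * slice_coord i x"
  proof -
    have "inner i (i * x) = (qI i * qI i + qJ i * qJ i + qK i * qK i) * qRe x"
      using i(1) by (simp add: inner_quat_def algebra_simps)
    then show ?thesis using i by (simp add: slice_coord_def complex_eq_iff inner_quat_def)
  qed
  moreover have "slice_embed i z * x = Re z *\<^sub>R x + Im z *\<^sub>R (i * x)"
    by (simp add: slice_embed_scaleR algebra_simps)
  ultimately show ?thesis
    by (simp add: c.add c.scaleR complex_eq_iff)
qed

lemma slice_coord_embed: "i \<in> imag_units \<Longrightarrow> slice_coord i (slice_embed i z) = z"
  using slice_coord_mult[of i z 1] by (simp add: slice_coord_def inner_quat_def imag_units_iff complex_eq_iff)

text \<open>One coordinate forgets two real dimensions. The right factor \<open>qcnj (x - y)\<close>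
  brings them back, because the coordinate of \<open>(x - y) * qcnj (x - y)\<close> is the squared
  norm.\<close>

lemma quat_eq_slice_coordI:
  assumes "\<And>q. slice_coord i (x * q) = slice_coord i (y * q)"
  shows "x = y"
proof -
  interpret c: bounded_linear "slice_coord i" by (rule bounded_linear_slice_coord)
  have "slice_coord i ((x - y) * qcnj (x - y)) = 0"
    unfolding left_diff_distrib c.diff using assms by simp
  then have "Re (slice_coord i (of_real ((norm (x - y))\<^sup>2))) = 0"
    by (simp only: mult_qcnj_norm zero_complex.sel)
  then show ?thesis by (simp add: slice_coord_def inner_quat_def del: of_real_power)
qed

text \<open>The given unit is the value of \<open>j\<close> for real \<open>x\<close>, where the
  direction of the imaginary part is arbitrary.\<close>

lemma quat_slice_decomp:
  assumes "i \<in> imag_units"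
  obtains j z where "j \<in> imag_units" "Im z \<ge> 0" "x = slice_embed j z"
proof (cases "x = of_real (qRe x)")
  case True
  then show ?thesis using that[of i "of_real (qRe x)"] assms by simp
next
  case False
  define y where "y = x - of_real (qRe x)"
  have y: "qRe y = 0" "y \<noteq> 0" using False by (simp_all add: y_def)
  have "y /\<^sub>R norm y \<in> imag_units" using y by (simp add: imag_units_def)
  moreover have "x = slice_embed (y /\<^sub>R norm y) (Complex (qRe x) (norm y))"
    using y by (simp add: slice_embed_scaleR y_def of_real_def)
  ultimately show ?thesis using that[of "y /\<^sub>R norm y" "Complex (qRe x) (norm y)"] by simp
qed

lemma slice_disc_eq: "i \<in> imag_units \<Longrightarrow> slice_disc i = slice_embed i ` ball 0 1"
  by (auto simp: slice_disc_def)

lemma slice_embed_in_slice_disc: "i \<in> imag_units \<Longrightarrow> slice_embed i z \<in> slice_disc i \<longleftrightarrow> cmod z < 1"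
  by (auto simp: slice_disc_def)

text \<open>The slice is the fixed point set of the continuous projection
  \<open>slice_embed i\<close> after \<open>slice_coord i\<close>, hence closed.\<close>

lemma slice_disc_borel [measurable]:
  assumes "i \<in> imag_units"
  shows "slice_disc i \<in> sets borel"
proof -
  have "slice_disc i = ball 0 1 \<inter> {x. slice_embed i (slice_coord i x) = x}"
    using slice_coord_embed[OF assms] by (auto simp: slice_disc_def) (metis rangeI)
  moreover have "closed {x. slice_embed i (slice_coord i x) = x}"
    by (intro closed_Collect_eq bounded_linear.continuous_on[OF bounded_linear_slice_embed]
        bounded_linear.continuous_on[OF bounded_linear_slice_coord] continuous_intros)
  ultimately show ?thesis by simp
qed

lemma slice_embed_measurable [measurable]: "slice_embed i \<in> borel_measurable borel"
  by (intro borel_measurable_continuous_onI bounded_linear.continuous_on[OF bounded_linear_slice_embed] continuous_intros)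

section \<open>Slice hyperholomorphic functions through Cauchy-Riemann pairs\<close>

definition slice_cauchy_riemann :: "(real \<Rightarrow> real \<Rightarrow> quat) \<Rightarrow> (real \<Rightarrow> real \<Rightarrow> quat) \<Rightarrow> bool" where
  "slice_cauchy_riemann u v \<longleftrightarrow> (\<forall>a b. a\<^sup>2 + b\<^sup>2 < 1 \<longrightarrow>
           u a b = u a (- b) \<and> v a b = - v a (- b) \<and>
           (\<exists>p q.
              ((\<lambda>s. u s b) has_vector_derivative p) (at a) \<and>
              ((\<lambda>t. v a t) has_vector_derivative p) (at b) \<and>
              ((\<lambda>s. v s b) has_vector_derivative q) (at a) \<and>
              ((\<lambda>t. u a t) has_vector_derivative - q) (at b)))"

lemma cmod_less_1_iff: "cmod z < 1 \<longleftrightarrow> (Re z)\<^sup>2 + (Im z)\<^sup>2 < 1"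
  by (simp add: cmod_def)

text \<open>A point of the lower half slice of \<open>j\<close> is a point of the upper half slice
  of \<open>- j\<close>. The parities of \<open>u\<close> and \<open>v\<close> compensate the two
  sign changes, so the representation holds on the whole disc of each slice.\<close>

lemma slice_hyperholomorphic_iff:
  "slice_hyperholomorphic f \<longleftrightarrow> f differentiable_on ball 0 1 \<and>
     (\<exists>u v. (\<forall>j\<in>imag_units. \<forall>z. cmod z < 1 \<longrightarrow>
        f (slice_embed j z) = u (Re z) (Im z) + j * v (Re z) (Im z)) \<and> slice_cauchy_riemann u v)"
    (is "_ \<longleftrightarrow> _ \<and> ?R")
proof -
  have "(\<forall>j\<in>imag_units. \<forall>a b. b \<ge> 0 \<and> a\<^sup>2 + b\<^sup>2 < 1 \<longrightarrow> f (of_real a + j * of_real b) = u a b + j * v a b)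
      \<longleftrightarrow> (\<forall>j\<in>imag_units. \<forall>z. cmod z < 1 \<longrightarrow> f (slice_embed j z) = u (Re z) (Im z) + j * v (Re z) (Im z))"
    (is "?L \<longleftrightarrow> ?M") if uv: "slice_cauchy_riemann u v" for u v
  proof
    assume L: ?L
    show ?M
    proof (intro ballI allI impI)
      fix j z assume j: "j \<in> imag_units" and z: "cmod z < 1"
      have z': "(Re z)\<^sup>2 + (Im z)\<^sup>2 < 1" using z by (simp only: cmod_less_1_iff)
      show "f (slice_embed j z) = u (Re z) (Im z) + j * v (Re z) (Im z)"
      proof (cases "Im z \<ge> 0")
        case True
        then show ?thesis using L j z' by (simp add: slice_embed_def)
      next
        case False
        have "u (Re z) (Im z) = u (Re z) (- Im z)" "v (Re z) (Im z) = - v (Re z) (- Im z)"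
          using uv z' unfolding slice_cauchy_riemann_def by blast+
        moreover have "f (of_real (Re z) + (- j) * of_real (- Im z)) = u (Re z) (- Im z) + (- j) * v (Re z) (- Im z)"
          using L[rule_format, OF imag_unit_uminus[OF j], of "- Im z" "Re z"] False z' by simp
        ultimately show ?thesis by (simp add: slice_embed_def)
      qed
    qed
  next
    assume M: ?M
    show ?L
    proof (intro ballI allI impI)
      fix j and a b :: real assume "j \<in> imag_units" "b \<ge> 0 \<and> a\<^sup>2 + b\<^sup>2 < 1"
      then show "f (of_real a + j * of_real b) = u a b + j * v a b"
        using M[rule_format, of j "Complex a b"] by (simp only: cmod_less_1_iff complex.sel slice_embed_def)
    qed
  qed
  then show ?thesis
    unfolding slice_hyperholomorphic_def slice_cauchy_riemann_def[symmetric] by blast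
qed

lemma slice_cauchy_riemann_add:
  assumes "slice_cauchy_riemann u v" "slice_cauchy_riemann u' v'"
  shows "slice_cauchy_riemann (\<lambda>a b. u a b + u' a b) (\<lambda>a b. v a b + v' a b)"
  unfolding slice_cauchy_riemann_def
proof (intro allI impI)
  fix a b :: real assume ab: "a\<^sup>2 + b\<^sup>2 < 1"
  obtain p q where 1: "u a b = u a (- b)" "v a b = - v a (- b)"
      "((\<lambda>s. u s b) has_vector_derivative p) (at a)" "((\<lambda>t. v a t) has_vector_derivative p) (at b)"
      "((\<lambda>s. v s b) has_vector_derivative q) (at a)" "((\<lambda>t. u a t) has_vector_derivative - q) (at b)"
    using assms(1) ab unfolding slice_cauchy_riemann_def by blast
  obtain p' q' where 2: "u' a b = u' a (- b)" "v' a b = - v' a (- b)"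
      "((\<lambda>s. u' s b) has_vector_derivative p') (at a)" "((\<lambda>t. v' a t) has_vector_derivative p') (at b)"
      "((\<lambda>s. v' s b) has_vector_derivative q') (at a)" "((\<lambda>t. u' a t) has_vector_derivative - q') (at b)"
    using assms(2) ab unfolding slice_cauchy_riemann_def by blast
  have "- (q + q') = - q + - q'" by simp
  then show "u a b + u' a b = u a (- b) + u' a (- b) \<and> v a b + v' a b = - (v a (- b) + v' a (- b)) \<and>
      (\<exists>p q. ((\<lambda>s. u s b + u' s b) has_vector_derivative p) (at a) \<and>
        ((\<lambda>t. v a t + v' a t) has_vector_derivative p) (at b) \<and>
        ((\<lambda>s. v s b + v' s b) has_vector_derivative q) (at a) \<and>
        ((\<lambda>t. u a t + u' a t) has_vector_derivative - q) (at b))"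
    using 1(1,2) 2(1,2) has_vector_derivative_add[OF 1(3) 2(3)] has_vector_derivative_add[OF 1(4) 2(4)]
      has_vector_derivative_add[OF 1(5) 2(5)] has_vector_derivative_add[OF 1(6) 2(6)]
    by (intro conjI exI[of _ "p + p'"] exI[of _ "q + q'"]) simp_all
qed

lemma slice_cauchy_riemann_mult_right:
  assumes "slice_cauchy_riemann u v"
  shows "slice_cauchy_riemann (\<lambda>a b. u a b * c) (\<lambda>a b. v a b * c)"
  unfolding slice_cauchy_riemann_def
proof (intro allI impI)
  fix a b :: real assume ab: "a\<^sup>2 + b\<^sup>2 < 1"
  obtain p q where 1: "u a b = u a (- b)" "v a b = - v a (- b)"
      "((\<lambda>s. u s b) has_vector_derivative p) (at a)" "((\<lambda>t. v a t) has_vector_derivative p) (at b)"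
      "((\<lambda>s. v s b) has_vector_derivative q) (at a)" "((\<lambda>t. u a t) has_vector_derivative - q) (at b)"
    using assms(1) ab unfolding slice_cauchy_riemann_def by blast
  note m = bounded_linear.has_vector_derivative[OF bounded_linear_mult_left, of _ _ _ c]
  show "u a b * c = u a (- b) * c \<and> v a b * c = - (v a (- b) * c) \<and>
      (\<exists>p q. ((\<lambda>s. u s b * c) has_vector_derivative p) (at a) \<and>
        ((\<lambda>t. v a t * c) has_vector_derivative p) (at b) \<and>
        ((\<lambda>s. v s b * c) has_vector_derivative q) (at a) \<and>
        ((\<lambda>t. u a t * c) has_vector_derivative - q) (at b))"
    using 1(1,2) m[OF 1(3)] m[OF 1(4)] m[OF 1(5)] m[OF 1(6)]
    by (intro conjI exI[of _ "p * c"] exI[of _ "q * c"]) simp_all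
qed

lemma slice_hyperholomorphic_add:
  assumes "slice_hyperholomorphic f" "slice_hyperholomorphic g"
  shows "slice_hyperholomorphic (\<lambda>x. f x + g x)"
proof -
  obtain u v u' v' where
    "\<forall>j\<in>imag_units. \<forall>z. cmod z < 1 \<longrightarrow> f (slice_embed j z) = u (Re z) (Im z) + j * v (Re z) (Im z)"
    "\<forall>j\<in>imag_units. \<forall>z. cmod z < 1 \<longrightarrow> g (slice_embed j z) = u' (Re z) (Im z) + j * v' (Re z) (Im z)"
    "slice_cauchy_riemann u v" "slice_cauchy_riemann u' v'"
    using assms unfolding slice_hyperholomorphic_iff by blast
  then show ?thesis
    using assms unfolding slice_hyperholomorphic_iff
    by (intro conjI exI[of _ "\<lambda>a b. u a b + u' a b"] exI[of _ "\<lambda>a b. v a b + v' a b"]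
        slice_cauchy_riemann_add differentiable_on_add) (simp_all add: algebra_simps)
qed

lemma slice_hyperholomorphic_mult_right:
  assumes "slice_hyperholomorphic f"
  shows "slice_hyperholomorphic (\<lambda>x. f x * c)"
proof -
  obtain u v where
    "\<forall>j\<in>imag_units. \<forall>z. cmod z < 1 \<longrightarrow> f (slice_embed j z) = u (Re z) (Im z) + j * v (Re z) (Im z)"
    "slice_cauchy_riemann u v"
    using assms unfolding slice_hyperholomorphic_iff by blast
  moreover have "(\<lambda>x. f x * c) differentiable_on ball 0 1"
    using assms unfolding slice_hyperholomorphic_iff differentiable_on_def
    by (intro ballI differentiable_mult differentiable_const) auto
  ultimately show ?thesis
    unfolding slice_hyperholomorphic_iff
    by (intro conjI exI[of _ "\<lambda>a b. u a b * c"] exI[of _ "\<lambda>a b. v a b * c"]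
        slice_cauchy_riemann_mult_right) (simp_all add: algebra_simps)
qed

text \<open>The values on one slice determine \<open>u\<close> and \<open>v\<close>, hence the function on the whole ball.\<close>
lemma slice_hyperholomorphic_zero_on_slice:
  assumes f: "slice_hyperholomorphic f" and i: "i \<in> imag_units"
    and zero: "\<And>z. cmod z < 1 \<Longrightarrow> f (slice_embed i z) = 0" and x: "norm x < 1"
  shows "f x = 0"
proof -
  obtain u v where uv:
    "\<And>j z. j \<in> imag_units \<Longrightarrow> cmod z < 1 \<Longrightarrow> f (slice_embed j z) = u (Re z) (Im z) + j * v (Re z) (Im z)"
    using f unfolding slice_hyperholomorphic_iff by blast
  obtain j z where j: "j \<in> imag_units" "x = slice_embed j z" using quat_slice_decomp[OF i] by blast
  then have z: "cmod z < 1" using x by simp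
  have 1: "u (Re z) (Im z) + i * v (Re z) (Im z) = 0" using uv[OF i z] zero[OF z] by simp
  \<comment> \<open>The unit \<open>- i\<close> spans the same slice and supplies the second
    equation needed to separate \<open>u\<close> from \<open>i * v\<close>.\<close>
  have 2: "u (Re z) (Im z) - i * v (Re z) (Im z) = 0"
    using uv[OF imag_unit_uminus[OF i] z] zero[of "cnj z"] z by (simp add: slice_embed_uminus_unit)
  have "2 *\<^sub>R u (Re z) (Im z) = 0" using 1 2 by (simp add: scaleR_2 add_eq_0_iff)
  then have u: "u (Re z) (Im z) = 0" by simp
  then have "i * v (Re z) (Im z) = 0" using 1 by simp
  then have "v (Re z) (Im z) = 0" using i by (auto simp: imag_units_def)
  then show ?thesis using uv[OF j(1) z] u j(2) by simp
qed

lemma has_vector_derivative_Complex: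
  assumes D: "(F has_derivative D) (at (Complex a b))"
  shows "((\<lambda>s. F (Complex s b)) has_vector_derivative D 1) (at a)"
    and "((\<lambda>t. F (Complex a t)) has_vector_derivative D \<i>) (at b)"
proof -
  interpret bounded_linear D using D by (rule has_derivative_bounded_linear)
  have 1: "((\<lambda>s. Complex s b) has_vector_derivative 1) (at a)"
    and 2: "((\<lambda>t. Complex a t) has_vector_derivative \<i>) (at b)"
    unfolding has_vector_derivative_complex_iff by simp_all
  show "((\<lambda>s. F (Complex s b)) has_vector_derivative D 1) (at a)"
    using has_derivative_compose[OF 1[unfolded has_vector_derivative_def] D]
    by (simp add: has_vector_derivative_def scaleR)
  show "((\<lambda>t. F (Complex a t)) has_vector_derivative D \<i>) (at b)"
    using has_derivative_compose[OF 2[unfolded has_vector_derivative_def] D]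
    by (simp add: has_vector_derivative_def scaleR)
qed

text \<open>Real differentiability provides a total derivative \<open>D\<close> along the slice, and
  the Cauchy-Riemann equations say \<open>D \<i> = i * D 1\<close>. Thus \<open>D h\<close> is
  \<open>slice_embed i h * D 1\<close>: the increment acts from the left, the factor
  \<open>q\<close> from the right, and \<open>slice_coord\<close> turns the left action into complex
  multiplication.\<close>

lemma slice_hyperholomorphic_holomorphic:
  assumes f: "slice_hyperholomorphic f" and i: "i \<in> imag_units"
  shows "(\<lambda>z. slice_coord i (f (slice_embed i z) * q)) holomorphic_on ball 0 1"
proof (rule holomorphic_onI)
  fix z :: complex assume "z \<in> ball 0 1"
  then have z: "cmod z < 1" by simp
  then have z': "(Re z)\<^sup>2 + (Im z)\<^sup>2 < 1" by (simp only: cmod_less_1_iff)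
  obtain u v where uv:
    "\<And>z. cmod z < 1 \<Longrightarrow> f (slice_embed i z) = u (Re z) (Im z) + i * v (Re z) (Im z)"
    and cr: "slice_cauchy_riemann u v"
    using f i unfolding slice_hyperholomorphic_iff by blast
  define F where "F = (\<lambda>z. f (slice_embed i z))"
  have "slice_embed i z \<in> ball 0 1" using z i by simp
  then have "f differentiable (at (slice_embed i z))"
    using f unfolding slice_hyperholomorphic_iff differentiable_on_def by (metis at_within_open open_ball)
  then obtain D' where D': "(f has_derivative D') (at (slice_embed i z))" unfolding differentiable_def by blast
  define D where "D = (\<lambda>h. D' (slice_embed i h))"
  have D: "(F has_derivative D) (at z)"
    unfolding F_def D_def
    by (rule has_derivative_compose[OF bounded_linear_imp_has_derivative[OF bounded_linear_slice_embed] D'])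
  interpret Dlin: bounded_linear D using D by (rule has_derivative_bounded_linear)
  obtain p r where p: "((\<lambda>s. u s (Im z)) has_vector_derivative p) (at (Re z))"
      "((\<lambda>t. v (Re z) t) has_vector_derivative p) (at (Im z))"
      "((\<lambda>s. v s (Im z)) has_vector_derivative r) (at (Re z))"
      "((\<lambda>t. u (Re z) t) has_vector_derivative - r) (at (Im z))"
    using cr z' unfolding slice_cauchy_riemann_def by blast
  note mi = bounded_linear.has_vector_derivative[OF bounded_linear_mult_right, of _ _ _ i]
  have opn: "open ((\<lambda>s. Complex s (Im z)) -` ball 0 1)" "open ((\<lambda>t. Complex (Re z) t) -` ball 0 1)"
    by (intro open_vimage open_ball continuous_intros)+
  have "((\<lambda>s. F (Complex s (Im z))) has_vector_derivative p + i * r) (at (Re z))"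
    by (rule has_vector_derivative_transform_within_open[OF has_vector_derivative_add[OF p(1) mi[OF p(3)]] opn(1)])
      (use z uv in \<open>auto simp: F_def\<close>)
  moreover have "((\<lambda>s. F (Complex s (Im z))) has_vector_derivative D 1) (at (Re z))"
    by (rule has_vector_derivative_Complex) (simp add: D)
  ultimately have D1: "D 1 = p + i * r" by (rule vector_derivative_unique_at[symmetric])
  have "((\<lambda>t. F (Complex (Re z) t)) has_vector_derivative - r + i * p) (at (Im z))"
    by (rule has_vector_derivative_transform_within_open[OF has_vector_derivative_add[OF p(4) mi[OF p(2)]] opn(2)])
      (use z uv in \<open>auto simp: F_def\<close>)
  moreover have "((\<lambda>t. F (Complex (Re z) t)) has_vector_derivative D \<i>) (at (Im z))"
    by (rule has_vector_derivative_Complex) (simp add: D)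
  ultimately have "D \<i> = - r + i * p" by (rule vector_derivative_unique_at[symmetric])
  also have "\<dots> = i * D 1" using imag_unit_square[OF i] by (simp add: D1 distrib_left flip: mult.assoc)
  finally have D2: "D \<i> = i * D 1" .
  interpret c: bounded_linear "slice_coord i" by (rule bounded_linear_slice_coord)
  have Dh: "D h = slice_embed i h * D 1" for h
  proof -
    have "h = Re h *\<^sub>R 1 + Im h *\<^sub>R \<i>" by (simp add: complex_eq_iff)
    then have "D h = Re h *\<^sub>R D 1 + Im h *\<^sub>R D \<i>" by (metis Dlin.add Dlin.scaleR)
    then show ?thesis unfolding D2 by (simp add: slice_embed_scaleR algebra_simps)
  qed
  have "((\<lambda>z. slice_coord i (F z * q)) has_derivative (\<lambda>h. slice_coord i (D h * q))) (at z)"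
    by (intro bounded_linear.has_derivative[OF bounded_linear_slice_coord]
        bounded_linear.has_derivative[OF bounded_linear_mult_left] D)
  also have "(\<lambda>h. slice_coord i (D h * q)) = (*) (slice_coord i (D 1 * q))"
  proof
    fix h
    show "slice_coord i (D h * q) = slice_coord i (D 1 * q) * h"
      unfolding Dh[of h] mult.assoc slice_coord_mult[OF i] by (rule mult.commute)
  qed
  finally have "((\<lambda>z. slice_coord i (F z * q)) has_field_derivative slice_coord i (D 1 * q)) (at z)"
    by (simp add: has_field_derivative_def)
  then show "(\<lambda>z. slice_coord i (f (slice_embed i z) * q)) field_differentiable at z within ball 0 1"
    unfolding F_def field_differentiable_def using has_field_derivative_at_within by blast
qed

section \<open>Power series in a quaternionic variable\<close>

text \<open>Differentiation is local, so a majorant on each smaller ball suffices: a radius strictly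
  between \<open>norm x\<close> and \<open>1\<close> is fixed. The domain is a general normed space
  because the lemma is applied to a quaternionic and to a complex variable.\<close>

lemma has_derivative_series_unit_ball:
  fixes f :: "nat \<Rightarrow> 'a::real_normed_vector \<Rightarrow> 'b::banach"
  assumes der: "\<And>n x. norm x < 1 \<Longrightarrow> (f n has_derivative D n x) (at x)"
    and bnd: "\<And>n x r h. norm x \<le> r \<Longrightarrow> norm (D n x h) \<le> M n r * norm h"
    and summ: "\<And>r. 0 < r \<Longrightarrow> r < 1 \<Longrightarrow> summable (\<lambda>n. M n r)"
    and s0: "summable (\<lambda>n. f n 0)" and x: "norm x < 1"
  shows "((\<lambda>x. \<Sum>n. f n x) has_derivative (\<lambda>h. \<Sum>n. D n x h)) (at x)"
proof -
  obtain r where r: "norm x < r" "r < 1" using x dense by blast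
  have r0: "0 < r" using r(1) norm_ge_zero[of x] by linarith
  note sM = summ[OF r0 r(2)]
  have xS: "x \<in> ball 0 r" using r by simp
  have ev: "\<forall>\<^sub>F n in sequentially. \<forall>x\<in>ball 0 r. \<forall>h.
      norm ((\<Sum>k<n. D k x h) - (\<Sum>k. D k x h)) \<le> e * norm h" if e: "e > 0" for e
  proof -
    obtain N where N: "\<And>n. n \<ge> N \<Longrightarrow> norm (\<Sum>k. M (k + n) r) < e"
      using suminf_exist_split[OF e sM] by blast
    have "norm ((\<Sum>k<n. D k x h) - (\<Sum>k. D k x h)) \<le> e * norm h" if n: "n \<ge> N" and x: "x \<in> ball 0 r" for n x h
    proof -
      have b: "norm (D k x h) \<le> M k r * norm h" for k using x by (intro bnd) simp
      have sh: "summable (\<lambda>k. M (k + n) r * norm h)"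
        using sM by (intro summable_mult2) (simp add: summable_iff_shift[of "\<lambda>n. M n r"])
      have "summable (\<lambda>k. norm (D k x h))"
        by (rule summable_comparison_test'[OF summable_mult2[OF sM], of 0]) (use b in simp)
      then have sD: "summable (\<lambda>k. D k x h)" "summable (\<lambda>k. norm (D (k + n) x h))"
        by (auto intro: summable_norm_cancel simp: summable_iff_shift[of "\<lambda>k. norm (D k x h)"])
      have "(\<Sum>k<n. D k x h) - (\<Sum>k. D k x h) = - (\<Sum>k. D (k + n) x h)"
        by (subst suminf_split_initial_segment[OF sD(1), of n]) simp
      then have "norm ((\<Sum>k<n. D k x h) - (\<Sum>k. D k x h)) = norm (\<Sum>k. D (k + n) x h)" by simp
      also have "\<dots> \<le> (\<Sum>k. norm (D (k + n) x h))" by (rule summable_norm[OF sD(2)])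
      also have "\<dots> \<le> (\<Sum>k. M (k + n) r * norm h)" by (intro suminf_le b sD(2) sh)
      also have "\<dots> = (\<Sum>k. M (k + n) r) * norm h"
        by (rule suminf_mult2[symmetric]) (use sM in \<open>simp add: summable_iff_shift[of "\<lambda>n. M n r"]\<close>)
      also have "\<dots> \<le> e * norm h" using N[OF n] by (intro mult_right_mono) auto
      finally show ?thesis .
    qed
    then show ?thesis unfolding eventually_sequentially by blast
  qed
  have der': "(f n has_derivative D n x) (at x within ball 0 r)" if "x \<in> ball 0 r" for n x
    using that r(2) by (intro has_derivative_at_withinI[OF der]) simp
  have z: "0 \<in> ball (0::'a) r" using r0 by simp
  obtain g where g: "\<forall>x\<in>ball 0 r. (\<lambda>n. f n x) sums g x \<and>
      (g has_derivative (\<lambda>h. \<Sum>n. D n x h)) (at x within ball 0 r)"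
    using has_derivative_series[OF convex_ball der' ev z summable_sums[OF s0]] by blast
  have "(g has_derivative (\<lambda>h. \<Sum>n. D n x h)) (at x)"
    using bspec[OF g xS] at_within_open[OF xS open_ball] by simp
  then show ?thesis
    by (rule has_derivative_transform_within_open[OF _ open_ball xS]) (use g in \<open>auto simp: sums_iff\<close>)
qed

text \<open>The noncommutative product rule: the value is the sum of
  \<open>x ^ k * h * x ^ (n - 1 - k)\<close> over \<open>k < n\<close>.\<close>

primrec power_derivative :: "nat \<Rightarrow> 'a::real_normed_algebra_1 \<Rightarrow> 'a \<Rightarrow> 'a" where
  "power_derivative 0 x h = 0"
| "power_derivative (Suc n) x h = x * power_derivative n x h + h * x ^ n"

lemma has_derivative_power_noncommutative:
  "((\<lambda>x. x ^ n) has_derivative power_derivative n x) (at x)"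
proof (induction n)
  case (Suc n)
  show ?case
    using has_derivative_mult[OF has_derivative_ident Suc] by simp
next
  case 0
  have "power_derivative 0 x = (\<lambda>h. 0)" by (simp add: fun_eq_iff)
  then show ?case by simp
qed

lemma norm_power_derivative_le:
  "norm x \<le> r \<Longrightarrow> norm (power_derivative n x h) \<le> (real n * r ^ (n - 1)) * norm h"
proof (induction n)
  case (Suc n)
  have r: "0 \<le> r" using Suc.prems norm_ge_zero[of x] by linarith
  have "norm (power_derivative (Suc n) x h) \<le> norm (x * power_derivative n x h) + norm (h * x ^ n)"
    by (simp add: norm_triangle_ineq)
  also have "\<dots> \<le> norm x * norm (power_derivative n x h) + norm h * norm (x ^ n)"
    by (intro add_mono norm_mult_ineq)
  also have "\<dots> \<le> r * ((real n * r ^ (n - 1)) * norm h) + norm h * r ^ n"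
    using Suc r by (intro add_mono mult_mono order_trans[OF norm_power_ineq] power_mono) auto
  also have "\<dots> = (real (Suc n) * r ^ (Suc n - 1)) * norm h"
    by (cases n) (simp_all add: algebra_simps)
  finally show ?case .
qed simp

lemma summable_derivative_bound:
  fixes A :: "nat \<Rightarrow> real"
  assumes "\<And>r. 0 \<le> r \<Longrightarrow> r < 1 \<Longrightarrow> summable (\<lambda>n. A n * r ^ n)" and A: "\<And>n. 0 \<le> A n" and r: "0 < r" "r < 1"
  shows "summable (\<lambda>n. real n * r ^ (n - 1) * A n)"
proof -
  have "summable (\<lambda>n. A n * x ^ n)" if "norm x < 1" for x
    by (rule summable_norm_cancel)
      (use assms(1)[of "\<bar>x\<bar>"] that A in \<open>simp add: abs_mult power_abs\<close>)
  then have "summable (\<lambda>n. diffs A n * r ^ n)"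
    using r by (intro termdiff_converges[of r 1]) auto
  then have "summable (\<lambda>n. real (Suc n) * r ^ (Suc n - 1) * A (Suc n))"
    by (simp add: diffs_def mult_ac)
  then show ?thesis using summable_Suc_iff[of "\<lambda>n. real n * r ^ (n - 1) * A n"] by simp
qed

text \<open>Right coefficients fit right scalars and left slice hyperholomorphy. Outside the ball
  the value is \<open>0\<close>, as for all elements of \<open>slice_bergman\<close>.\<close>

definition ball_power_series :: "(nat \<Rightarrow> quat) \<Rightarrow> quat \<Rightarrow> quat" where
  "ball_power_series a x = (if norm x < 1 then \<Sum>n. x ^ n * a n else 0)"

text \<open>On every slice \<open>x ^ n\<close> is \<open>Re (z ^ n) + j * Im (z ^ n)\<close> with
  real numbers that do not depend on \<open>j\<close>; this yields \<open>u\<close> and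
  \<open>v\<close>. The series is differentiated twice: in the quaternion \<open>x\<close> for
  differentiability on the ball, and in \<open>z\<close> for the Cauchy-Riemann equations.\<close>

lemma slice_hyperholomorphic_power_series:
  assumes summ: "\<And>r. 0 \<le> r \<Longrightarrow> r < 1 \<Longrightarrow> summable (\<lambda>n. norm (a n) * r ^ n)"
  shows "slice_hyperholomorphic (ball_power_series a)"
proof -
  define M where "M n r = (real n * r ^ (n - 1)) * norm (a n)" for n r
  have sM: "summable (\<lambda>n. M n r)" if "0 < r" "r < 1" for r
    unfolding M_def using summ that by (intro summable_derivative_bound) auto
  have sn: "summable (\<lambda>n. norm (c n *\<^sub>R a n))" if "\<And>n. \<bar>c n\<bar> \<le> r ^ n" "0 \<le> r" "r < 1" for c r
    by (rule summable_comparison_test'[OF summ[OF that(2,3)], of 0])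
      (use mult_right_mono[OF that(1), of "norm (a n)" for n] in \<open>simp add: mult.commute\<close>)
  have s0: "summable (\<lambda>n. c n *\<^sub>R a n)" if "\<And>n. n > 0 \<Longrightarrow> c n = 0" for c
    by (rule summable_finite[of "{0}"]) (use that in auto)
  have diff: "(ball_power_series a has_derivative (\<lambda>h. \<Sum>n. power_derivative n x h * a n)) (at x)" if x: "norm x < 1" for x
  proof -
    have "((\<lambda>x. \<Sum>n. x ^ n * a n) has_derivative (\<lambda>h. \<Sum>n. power_derivative n x h * a n)) (at x)"
    proof (rule has_derivative_series_unit_ball[where M = M, OF _ _ sM _ x])
      show "((\<lambda>x. x ^ n * a n) has_derivative (\<lambda>h. power_derivative n x h * a n)) (at x)" for n x
        by (intro bounded_linear.has_derivative[OF bounded_linear_mult_left] has_derivative_power_noncommutative)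
      show "norm (power_derivative n x h * a n) \<le> M n r * norm h" if "norm x \<le> r" for n r and x h :: quat
        using mult_right_mono[OF norm_power_derivative_le[OF that, of n h], of "norm (a n)"]
        by (simp add: M_def norm_mult mult_ac)
      show "summable (\<lambda>n. 0 ^ n * a n)"
        by (rule summable_finite[of "{0}"]) auto
    qed
    then show ?thesis
      by (rule has_derivative_transform_within_open[OF _ open_ball, of _ _ _ _ 0 1]) (use x in \<open>simp_all add: ball_power_series_def\<close>)
  qed
  define U where "U z = (\<Sum>n. Re (z ^ n) *\<^sub>R a n)" for z
  define V where "V z = (\<Sum>n. Im (z ^ n) *\<^sub>R a n)" for z
  define P where "P n z h = of_nat n * z ^ (n - 1) * h" for n and z h :: complex
  have P: "((\<lambda>z. z ^ n) has_derivative P n z) (at z)" for n z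
  proof -
    have "((\<lambda>z. z ^ n) has_field_derivative of_nat n * z ^ (n - 1)) (at z)"
      by (auto intro!: derivative_eq_intros)
    moreover have "P n z = (*) (of_nat n * z ^ (n - 1))" by (simp add: P_def fun_eq_iff)
    ultimately show ?thesis by (simp only: has_field_derivative_def)
  qed
  have Pn: "cmod (P n z h) * norm (a n) \<le> M n r * norm h" if "cmod z \<le> r" for n z h r
  proof -
    have "cmod (P n z h) = real n * cmod z ^ (n - 1) * cmod h"
      by (simp add: P_def norm_mult norm_power)
    also have "\<dots> \<le> real n * r ^ (n - 1) * cmod h"
      using that order_trans[OF norm_ge_zero that] by (intro mult_right_mono mult_left_mono power_mono) auto
    finally have "cmod (P n z h) * norm (a n) \<le> real n * r ^ (n - 1) * cmod h * norm (a n)"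
      by (rule mult_right_mono) simp
    then show ?thesis by (simp only: M_def mult_ac)
  qed
  have U: "(U has_derivative (\<lambda>h. \<Sum>n. Re (P n z h) *\<^sub>R a n)) (at z)" if "cmod z < 1" for z
    unfolding U_def
  proof (rule has_derivative_series_unit_ball[where M = M, OF _ _ sM _ that])
    show "((\<lambda>z. Re (z ^ n) *\<^sub>R a n) has_derivative (\<lambda>h. Re (P n z h) *\<^sub>R a n)) (at z)" for n z
      by (intro has_derivative_scaleR_left bounded_linear.has_derivative[OF bounded_linear_Re] P)
    show "norm (Re (P n z h) *\<^sub>R a n) \<le> M n r * norm h" if "cmod z \<le> r" for n z r h
      using Pn[OF that, of n h] mult_right_mono[OF abs_Re_le_cmod[of "P n z h"], of "norm (a n)"] by simp
    show "summable (\<lambda>n. Re (0 ^ n) *\<^sub>R a n)" by (rule s0) simp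
  qed
  have V: "(V has_derivative (\<lambda>h. \<Sum>n. Im (P n z h) *\<^sub>R a n)) (at z)" if "cmod z < 1" for z
    unfolding V_def
  proof (rule has_derivative_series_unit_ball[where M = M, OF _ _ sM _ that])
    show "((\<lambda>z. Im (z ^ n) *\<^sub>R a n) has_derivative (\<lambda>h. Im (P n z h) *\<^sub>R a n)) (at z)" for n z
      by (intro has_derivative_scaleR_left bounded_linear.has_derivative[OF bounded_linear_Im] P)
    show "norm (Im (P n z h) *\<^sub>R a n) \<le> M n r * norm h" if "cmod z \<le> r" for n z r h
      using Pn[OF that, of n h] mult_right_mono[OF abs_Im_le_cmod[of "P n z h"], of "norm (a n)"] by simp
    show "summable (\<lambda>n. Im (0 ^ n) *\<^sub>R a n)" by (rule s0) simp
  qed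
  have sums: "summable (\<lambda>n. Re (z ^ n) *\<^sub>R a n)" "summable (\<lambda>n. Im (z ^ n) *\<^sub>R a n)" if "cmod z < 1" for z
    using sn[of "\<lambda>n. Re (z ^ n)" "cmod z"] sn[of "\<lambda>n. Im (z ^ n)" "cmod z"] that
      abs_Re_le_cmod[of "z ^ n" for n] abs_Im_le_cmod[of "z ^ n" for n]
    by (auto intro: summable_norm_cancel simp: norm_power)
  have sP: "summable (\<lambda>n. Im (P n z 1) *\<^sub>R a n)" if z: "cmod z < 1" for z
  proof -
    obtain r where r: "cmod z < r" "r < 1" using z dense by blast
    have r0: "0 < r" using r(1) norm_ge_zero[of z] by linarith
    have "norm (Im (P n z 1) *\<^sub>R a n) \<le> M n r" for n
      using Pn[of z r n 1] mult_right_mono[OF abs_Im_le_cmod[of "P n z 1"], of "norm (a n)"] r(1) by simp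
    then show ?thesis by (rule summable_comparison_test'[OF sM[OF r0 r(2)], of 0])
  qed
  have cr: "slice_cauchy_riemann (\<lambda>s t. U (Complex s t)) (\<lambda>s t. V (Complex s t))"
    unfolding slice_cauchy_riemann_def
  proof (intro allI impI)
    fix s t :: real assume st: "s\<^sup>2 + t\<^sup>2 < 1"
    define z where "z = Complex s t"
    have z: "cmod z < 1" using st by (simp only: cmod_less_1_iff z_def complex.sel)
    have cn: "Complex s (- t) = cnj z" by (simp add: z_def complex_eq_iff)
    have 1: "U z = U (cnj z)" unfolding U_def by (simp flip: complex_cnj_power)
    have 2: "V z = - V (cnj z)"
      unfolding V_def using sums(2)[OF z] by (simp add: suminf_minus flip: complex_cnj_power)
    \<comment> \<open>\<open>P n z\<close> is complex linear, so the direction \<open>\<i>\<close>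
      multiplies by \<open>\<i>\<close> and exchanges real and imaginary parts up to sign. Summed
      against the coefficients, this is the Cauchy-Riemann system.\<close>
    have i: "P n z \<i> = \<i> * P n z 1" for n by (simp add: P_def)
    have m: "(\<Sum>n. Re (P n z \<i>) *\<^sub>R a n) = - (\<Sum>n. Im (P n z 1) *\<^sub>R a n)"
      using suminf_minus[OF sP[OF z]] by (simp add: i)
    have e: "(\<Sum>n. Im (P n z \<i>) *\<^sub>R a n) = (\<Sum>n. Re (P n z 1) *\<^sub>R a n)" by (simp add: i)
    note dU = has_vector_derivative_Complex[OF U[OF z, unfolded z_def], folded z_def]
    note dV = has_vector_derivative_Complex[OF V[OF z, unfolded z_def], folded z_def]
    show "U (Complex s t) = U (Complex s (- t)) \<and> V (Complex s t) = - V (Complex s (- t)) \<and>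
      (\<exists>p q. ((\<lambda>s. U (Complex s t)) has_vector_derivative p) (at s) \<and>
        ((\<lambda>t. V (Complex s t)) has_vector_derivative p) (at t) \<and>
        ((\<lambda>s. V (Complex s t)) has_vector_derivative q) (at s) \<and>
        ((\<lambda>t. U (Complex s t)) has_vector_derivative - q) (at t))"
      using 1 2 dU(1) dV(2)[unfolded e] dV(1) dU(2)[unfolded m] unfolding cn z_def[symmetric] by blast
  qed
  have rep: "ball_power_series a (slice_embed j z) = U (Complex (Re z) (Im z)) + j * V (Complex (Re z) (Im z))"
    if j: "j \<in> imag_units" and z: "cmod z < 1" for j z
  proof -
    have "j * V z = (\<Sum>n. j * (Im (z ^ n) *\<^sub>R a n))" unfolding V_def by (rule suminf_mult[symmetric, OF sums(2)[OF z]])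
    then have "U z + j * V z = (\<Sum>n. Re (z ^ n) *\<^sub>R a n + j * (Im (z ^ n) *\<^sub>R a n))"
      unfolding U_def using suminf_add[OF sums(1)[OF z] summable_mult[OF sums(2)[OF z], of j]] by simp
    also have "\<dots> = (\<Sum>n. slice_embed j z ^ n * a n)"
      unfolding slice_embed_power[OF j, symmetric] by (simp add: slice_embed_scaleR algebra_simps)
    finally show ?thesis using z j by (simp add: ball_power_series_def)
  qed
  have "ball_power_series a differentiable_on ball 0 1"
    unfolding differentiable_on_def differentiable_def using diff has_derivative_at_withinI by fastforce
  then show ?thesis
    unfolding slice_hyperholomorphic_iff
    by (intro conjI exI[of _ "\<lambda>s t. U (Complex s t)"] exI[of _ "\<lambda>s t. V (Complex s t)"] cr) (use rep in blast)+
qed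

section \<open>The slice Bergman space and its kernel\<close>

lemma bounded_linear_qcnj: "bounded_linear qcnj"
  unfolding linear_conv_bounded_linear[symmetric]
  by (intro linearI) (simp_all add: quat_eq_iff)

lemma qcnj_measurable [measurable]: "qcnj \<in> borel_measurable borel"
  by (intro borel_measurable_continuous_onI bounded_linear.continuous_on[OF bounded_linear_qcnj] continuous_intros)

text \<open>This transports every integral over the slice to the complex disc, where holomorphic
  functions and rotations are at hand.\<close>

lemma slice_area_distr:
  assumes i: "i \<in> imag_units"
  shows "slice_area \<alpha> i = distr (disc_area \<alpha>) borel (slice_embed i)"
proof -
  note [measurable] = slice_disc_borel[OF i]
  have "slice_area \<alpha> i = distr (density lborel (\<lambda>z.
      ennreal ((\<alpha> + 1) / pi * (1 - (norm (slice_embed i z))\<^sup>2) powr \<alpha>) * indicator (slice_disc i) (slice_embed i z)))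
      borel (slice_embed i)"
    unfolding slice_area_def slice_lebesgue_def by (rule density_distr) (simp_all add: measurable_lborel1)
  then show ?thesis
    using i by (simp add: disc_area_def indicator_def slice_embed_in_slice_disc)
qed

lemma borel_measurable_slice_hyperholomorphic:
  assumes f: "slice_hyperholomorphic f" and zero: "\<And>x. x \<notin> ball 0 1 \<Longrightarrow> f x = 0"
  shows "f \<in> borel_measurable borel"
proof -
  have "continuous_on (ball 0 1) f"
    using f by (auto simp: slice_hyperholomorphic_def intro: differentiable_imp_continuous_on)
  then have "(\<lambda>x. indicator (ball 0 1) x *\<^sub>R f x) \<in> borel_measurable borel"
    by (intro borel_measurable_continuous_on_indicator) auto
  moreover have "(\<lambda>x. indicator (ball 0 1) x *\<^sub>R f x) = f"
    using zero by (auto simp: indicator_def fun_eq_iff)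
  ultimately show ?thesis by simp
qed

lemma slice_bergman_measurable: "f \<in> slice_bergman \<alpha> i \<Longrightarrow> f \<in> borel_measurable borel"
  by (auto simp: slice_bergman_def intro: borel_measurable_slice_hyperholomorphic)

text \<open>The power series of \<open>(1 - z * cnj w) powr (- (\<alpha> + 2))\<close> in
  \<open>z\<close>, with the powers of \<open>cnj w\<close> as right coefficients. In this form
  \<open>z\<close> may be replaced by any quaternion in the ball.\<close>

definition slice_kernel :: "real \<Rightarrow> quat \<Rightarrow> complex \<Rightarrow> quat \<Rightarrow> quat" where
  "slice_kernel \<alpha> i w = ball_power_series (\<lambda>n. of_real (bergman_coeff \<alpha> n) * slice_embed i (cnj w) ^ n)"

section \<open>Scalar product and reproducing kernel for a fixed weight and slice\<close>

context
  fixes \<alpha> :: real and i :: quat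
  assumes \<alpha>: "\<alpha> > -1" and i: "i \<in> imag_units"
begin

lemma measurable_on_slice:
  assumes "f \<in> slice_bergman \<alpha> i"
  shows "(\<lambda>z. f (slice_embed i z)) \<in> borel_measurable borel"
  using slice_bergman_measurable[OF assms] by measurable

lemma slice_bergman_iff:
  "f \<in> slice_bergman \<alpha> i \<longleftrightarrow> slice_hyperholomorphic f \<and> (\<forall>x. x \<notin> ball 0 1 \<longrightarrow> f x = 0) \<and>
     integrable (disc_area \<alpha>) (\<lambda>z. (norm (f (slice_embed i z)))\<^sup>2)"
proof (cases "slice_hyperholomorphic f \<and> (\<forall>x. x \<notin> ball 0 1 \<longrightarrow> f x = 0)")
  case True
  then have [measurable]: "f \<in> borel_measurable borel"
    by (auto intro: borel_measurable_slice_hyperholomorphic)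
  show ?thesis
    using True by (auto simp: slice_bergman_def slice_area_distr[OF i] integrable_distr_eq)
qed (auto simp: slice_bergman_def)

lemma integrable_sqnorm:
  "f \<in> slice_bergman \<alpha> i \<Longrightarrow> integrable (disc_area \<alpha>) (\<lambda>z. (norm (f (slice_embed i z)))\<^sup>2)"
  by (simp add: slice_bergman_iff)

lemma integrable_inner:
  assumes f: "f \<in> slice_bergman \<alpha> i" and g: "g \<in> slice_bergman \<alpha> i"
  shows "integrable (disc_area \<alpha>) (\<lambda>z. qcnj (f (slice_embed i z)) * g (slice_embed i z))"
proof (rule Bochner_Integration.integrable_bound)
  note [measurable] = measurable_on_slice[OF f] measurable_on_slice[OF g]
  show "integrable (disc_area \<alpha>) (\<lambda>z. (norm (f (slice_embed i z)))\<^sup>2 + (norm (g (slice_embed i z)))\<^sup>2)"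
    using f g by (intro Bochner_Integration.integrable_add integrable_sqnorm)
  show "(\<lambda>z. qcnj (f (slice_embed i z)) * g (slice_embed i z)) \<in> borel_measurable (disc_area \<alpha>)" by measurable
  have "a * b \<le> a\<^sup>2 + b\<^sup>2" if "0 \<le> a" "0 \<le> b" for a b :: real
    using sum_squares_bound[of a b] mult_nonneg_nonneg[OF that] by linarith
  then show "AE z in disc_area \<alpha>. norm (qcnj (f (slice_embed i z)) * g (slice_embed i z))
      \<le> norm ((norm (f (slice_embed i z)))\<^sup>2 + (norm (g (slice_embed i z)))\<^sup>2)"
    by (simp add: norm_mult)
qed

lemma integrable_on_slice:
  assumes f: "f \<in> slice_bergman \<alpha> i"
  shows "integrable (disc_area \<alpha>) (\<lambda>z. f (slice_embed i z))"
proof (rule Bochner_Integration.integrable_bound)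
  interpret finite_measure "disc_area \<alpha>" by (rule finite_measure_disc_area[OF \<alpha>])
  note [measurable] = measurable_on_slice[OF f]
  show "integrable (disc_area \<alpha>) (\<lambda>z. 1 + (norm (f (slice_embed i z)))\<^sup>2)"
    using f by (intro Bochner_Integration.integrable_add integrable_sqnorm) simp
  show "(\<lambda>z. f (slice_embed i z)) \<in> borel_measurable (disc_area \<alpha>)" by measurable
  have "a \<le> 1 + a\<^sup>2" if "0 \<le> a" for a :: real
    using sum_squares_bound[of 1 a] that by simp
  then show "AE z in disc_area \<alpha>. norm (f (slice_embed i z)) \<le> norm (1 + (norm (f (slice_embed i z)))\<^sup>2)"
    by simp
qed

lemma slice_inner_disc:
  assumes f: "f \<in> slice_bergman \<alpha> i" and g: "g \<in> slice_bergman \<alpha> i"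
  shows "slice_inner \<alpha> i f g = (LINT z|disc_area \<alpha>. qcnj (f (slice_embed i z)) * g (slice_embed i z))"
proof -
  note [measurable] = slice_bergman_measurable[OF f] slice_bergman_measurable[OF g]
  show ?thesis
    unfolding slice_inner_def slice_area_distr[OF i] by (rule integral_distr) measurable
qed

lemma slice_inner_self:
  assumes f: "f \<in> slice_bergman \<alpha> i"
  shows "slice_inner \<alpha> i f f = of_real (LINT z|disc_area \<alpha>. (norm (f (slice_embed i z)))\<^sup>2)"
  unfolding slice_inner_disc[OF f f] mult_qcnj_norm
  by (rule integral_bounded_linear[OF bounded_linear_of_real integrable_sqnorm[OF f]])

lemma slice_bergman_add:
  assumes f: "f \<in> slice_bergman \<alpha> i" and g: "g \<in> slice_bergman \<alpha> i"
  shows "(\<lambda>x. f x + g x) \<in> slice_bergman \<alpha> i"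
  unfolding slice_bergman_iff
proof (intro conjI)
  note [measurable] = measurable_on_slice[OF f] measurable_on_slice[OF g]
  show "slice_hyperholomorphic (\<lambda>x. f x + g x)"
    using f g by (intro slice_hyperholomorphic_add) (auto simp: slice_bergman_iff)
  show "\<forall>x. x \<notin> ball 0 1 \<longrightarrow> f x + g x = 0" using f g by (auto simp: slice_bergman_iff)
  show "integrable (disc_area \<alpha>) (\<lambda>z. (norm (f (slice_embed i z) + g (slice_embed i z)))\<^sup>2)"
  proof (rule Bochner_Integration.integrable_bound)
    show "integrable (disc_area \<alpha>) (\<lambda>z. 2 * (norm (f (slice_embed i z)))\<^sup>2 + 2 * (norm (g (slice_embed i z)))\<^sup>2)"
      using f g by (intro Bochner_Integration.integrable_add integrable_mult_right integrable_sqnorm)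
    show "(\<lambda>z. (norm (f (slice_embed i z) + g (slice_embed i z)))\<^sup>2) \<in> borel_measurable (disc_area \<alpha>)"
      by measurable
    have "(norm (a + b))\<^sup>2 \<le> 2 * (norm a)\<^sup>2 + 2 * (norm b)\<^sup>2" for a b :: quat
    proof -
      have "(norm (a + b))\<^sup>2 \<le> (norm a + norm b)\<^sup>2" by (intro power_mono norm_triangle_ineq) simp
      also have "\<dots> \<le> 2 * (norm a)\<^sup>2 + 2 * (norm b)\<^sup>2"
        using sum_squares_bound[of "norm a" "norm b"] by (simp add: power2_sum)
      finally show ?thesis .
    qed
    then show "AE z in disc_area \<alpha>. norm ((norm (f (slice_embed i z) + g (slice_embed i z)))\<^sup>2)
        \<le> norm (2 * (norm (f (slice_embed i z)))\<^sup>2 + 2 * (norm (g (slice_embed i z)))\<^sup>2)"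
      by simp
  qed
qed

lemma slice_bergman_mult_right:
  assumes f: "f \<in> slice_bergman \<alpha> i"
  shows "(\<lambda>x. f x * q) \<in> slice_bergman \<alpha> i"
  unfolding slice_bergman_iff
proof (intro conjI)
  show "slice_hyperholomorphic (\<lambda>x. f x * q)"
    using f by (intro slice_hyperholomorphic_mult_right) (auto simp: slice_bergman_iff)
  show "\<forall>x. x \<notin> ball 0 1 \<longrightarrow> f x * q = 0" using f by (auto simp: slice_bergman_iff)
  show "integrable (disc_area \<alpha>) (\<lambda>z. (norm (f (slice_embed i z) * q))\<^sup>2)"
    using integrable_sqnorm[OF f] by (simp add: norm_mult power_mult_distrib)
qed

lemma zero_mem_slice_bergman: "(\<lambda>x. 0) \<in> slice_bergman \<alpha> i"
proof -
  have "slice_cauchy_riemann (\<lambda>a b. 0) (\<lambda>a b. 0)" 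
    unfolding slice_cauchy_riemann_def by (intro allI impI conjI exI[of _ 0]) simp_all
  then have "slice_hyperholomorphic (\<lambda>x. 0)"
    unfolding slice_hyperholomorphic_iff by (intro conjI exI[of _ "\<lambda>a b. 0"]) auto
  then show ?thesis by (auto simp: slice_bergman_iff)
qed

text \<open>Since \<open>cmod w < 1\<close>, the radius \<open>r = 1\<close> is admissible. This
  endpoint bounds the kernel on the whole ball and so makes it square integrable for the finite
  measure.\<close>

lemma kernel_summable:
  assumes "cmod w < 1" "0 \<le> r" "r \<le> 1"
  shows "summable (\<lambda>n. norm (of_real (bergman_coeff \<alpha> n) * slice_embed i (cnj w) ^ n) * r ^ n)"
proof -
  have "norm (of_real (bergman_coeff \<alpha> n) * slice_embed i (cnj w) ^ n) * r ^ n = bergman_coeff \<alpha> n * (cmod w * r) ^ n" for n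
    using bergman_coeff_pos[OF \<alpha>, of n] i by (simp add: norm_mult norm_power power_mult_distrib)
  moreover have "cmod w * r < 1" using assms mult_left_mono[of r 1 "cmod w"] by simp
  ultimately show ?thesis using assms bergman_coeff_summable[of "cmod w * r" \<alpha>] by simp
qed

lemma kernel_summable_on_slice:
  assumes w: "cmod w < 1" and z: "cmod z < 1"
  shows "summable (\<lambda>n. of_real (bergman_coeff \<alpha> n) * z ^ n * cnj w ^ n)"
proof (rule summable_comparison_test'[OF bergman_coeff_summable[of "cmod z * cmod w" \<alpha>], of 0])
  show "\<bar>cmod z * cmod w\<bar> < 1" using w z mult_strict_mono[of "cmod z" 1 "cmod w" 1] by simp
  show "norm (of_real (bergman_coeff \<alpha> n) * z ^ n * cnj w ^ n) \<le> bergman_coeff \<alpha> n * (cmod z * cmod w) ^ n" for n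
    using bergman_coeff_pos[OF \<alpha>, of n] by (simp add: norm_mult norm_power power_mult_distrib)
qed

lemma slice_kernel_on_slice:
  assumes w: "cmod w < 1" and z: "cmod z < 1"
  shows "slice_kernel \<alpha> i w (slice_embed i z) = slice_embed i (\<Sum>n. of_real (bergman_coeff \<alpha> n) * z ^ n * cnj w ^ n)"
proof -
  interpret bounded_linear "slice_embed i" by (rule bounded_linear_slice_embed)
  have "slice_embed i (\<Sum>n. of_real (bergman_coeff \<alpha> n) * z ^ n * cnj w ^ n) =
      (\<Sum>n. slice_embed i (of_real (bergman_coeff \<alpha> n) * z ^ n * cnj w ^ n))"
    by (rule suminf[OF kernel_summable_on_slice[OF w z]])
  also have "\<dots> = (\<Sum>n. slice_embed i z ^ n * (of_real (bergman_coeff \<alpha> n) * slice_embed i (cnj w) ^ n))"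
    by (simp only: slice_embed_mult[OF i] slice_embed_power[OF i] slice_embed_of_real of_real_mult_quat_left_commute mult.assoc)
  finally show ?thesis using z i by (simp add: slice_kernel_def ball_power_series_def)
qed

lemma slice_kernel_mem:
  assumes w: "cmod w < 1"
  shows "slice_kernel \<alpha> i w \<in> slice_bergman \<alpha> i"
proof -
  let ?a = "\<lambda>n. of_real (bergman_coeff \<alpha> n) * slice_embed i (cnj w) ^ n"
  have hyp: "slice_hyperholomorphic (slice_kernel \<alpha> i w)"
    unfolding slice_kernel_def using kernel_summable[OF w] by (intro slice_hyperholomorphic_power_series) simp
  have zero: "slice_kernel \<alpha> i w x = 0" if "x \<notin> ball 0 1" for x
    using that by (simp add: slice_kernel_def ball_power_series_def)
  have [measurable]: "slice_kernel \<alpha> i w \<in> borel_measurable borel"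
    by (rule borel_measurable_slice_hyperholomorphic[OF hyp zero])
  interpret finite_measure "disc_area \<alpha>" by (rule finite_measure_disc_area[OF \<alpha>])
  define B where "B = (\<Sum>n. norm (?a n))"
  have sB: "summable (\<lambda>n. norm (?a n))" using kernel_summable[OF w, of 1] by simp
  have "norm (slice_kernel \<alpha> i w x) \<le> B" for x
  proof (cases "norm x < 1")
    case True
    have le: "norm (x ^ n * ?a n) \<le> norm (?a n)" for n
      using mult_right_mono[of "norm x ^ n" 1 "norm (?a n)"] True by (simp add: norm_mult norm_power power_le_one)
    have "norm (\<Sum>n. x ^ n * ?a n) \<le> B" unfolding B_def by (rule norm_suminf_le[OF le sB])
    then show ?thesis using True by (simp add: slice_kernel_def ball_power_series_def)
  next
    case False
    then show ?thesis using suminf_nonneg[OF sB] by (simp add: slice_kernel_def ball_power_series_def B_def)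
  qed
  then have "norm ((norm (slice_kernel \<alpha> i w (slice_embed i z)))\<^sup>2) \<le> B\<^sup>2" for z
    by (simp add: power_mono)
  then have "integrable (disc_area \<alpha>) (\<lambda>z. (norm (slice_kernel \<alpha> i w (slice_embed i z)))\<^sup>2)"
    by (intro integrable_const_bound[where B = "B\<^sup>2"]) (simp_all only: always_eventually simp_thms, measurable)
  then show ?thesis using hyp zero by (auto simp: slice_bergman_iff)
qed

lemma slice_kernel_reproducing:
  assumes w: "cmod w < 1" and f: "f \<in> slice_bergman \<alpha> i"
  shows "f (slice_embed i w) = slice_inner \<alpha> i (slice_kernel \<alpha> i w) f"
proof (rule quat_eq_slice_coordI)
  fix q
  note K = slice_kernel_mem[OF w]
  define g where "g z = slice_coord i (f (slice_embed i z) * q)" for z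
  have hol: "g holomorphic_on ball 0 1"
    unfolding g_def by (rule slice_hyperholomorphic_holomorphic[OF _ i]) (use f in \<open>simp add: slice_bergman_iff\<close>)
  have bl: "bounded_linear (\<lambda>x. slice_coord i (x * q))"
    by (rule bounded_linear_compose[OF bounded_linear_slice_coord bounded_linear_mult_left])
  have gint: "integrable (disc_area \<alpha>) g"
    unfolding g_def by (rule integrable_bounded_linear[OF bl integrable_on_slice[OF f]])
  have "slice_coord i (slice_inner \<alpha> i (slice_kernel \<alpha> i w) f * q) =
      (LINT z|disc_area \<alpha>. slice_coord i (qcnj (slice_kernel \<alpha> i w (slice_embed i z)) * f (slice_embed i z) * q))"
    unfolding slice_inner_disc[OF K f]
    by (rule integral_bounded_linear[OF bl integrable_inner[OF K f], symmetric])
  also have "\<dots> = (LINT z|disc_area \<alpha>. (\<Sum>n. of_real (bergman_coeff \<alpha> n) * w ^ n * cnj z ^ n) * g z)"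
  proof (rule integral_cong_AE)
    note [measurable] = measurable_on_slice[OF f] measurable_on_slice[OF K] borel_measurable_integrable[OF gint]
    have [measurable]: "slice_coord i \<in> borel_measurable borel"
      by (intro borel_measurable_continuous_onI bounded_linear.continuous_on[OF bounded_linear_slice_coord] continuous_intros)
    show "(\<lambda>z. slice_coord i (qcnj (slice_kernel \<alpha> i w (slice_embed i z)) * f (slice_embed i z) * q)) \<in> borel_measurable (disc_area \<alpha>)"
      by measurable
    show "(\<lambda>z. (\<Sum>n. of_real (bergman_coeff \<alpha> n) * w ^ n * cnj z ^ n) * g z) \<in> borel_measurable (disc_area \<alpha>)"
      by measurable
    show "AE z in disc_area \<alpha>. slice_coord i (qcnj (slice_kernel \<alpha> i w (slice_embed i z)) * f (slice_embed i z) * q) =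
        (\<Sum>n. of_real (bergman_coeff \<alpha> n) * w ^ n * cnj z ^ n) * g z"
      using AE_disc_area[of \<alpha>]
    proof eventually_elim
      case (elim z)
      then have z: "cmod z < 1" by simp
      \<comment> \<open>Conjugation exchanges \<open>z\<close> and \<open>w\<close> in the kernel.
        The conjugated kernel is still an element of the slice and stands to the left of
        \<open>f\<close>, so it leaves \<open>slice_coord\<close> as a complex factor.\<close>
      have "cnj (\<Sum>n. of_real (bergman_coeff \<alpha> n) * z ^ n * cnj w ^ n) =
          (\<Sum>n. of_real (bergman_coeff \<alpha> n) * w ^ n * cnj z ^ n)"
        using bounded_linear.suminf[OF bounded_linear_cnj kernel_summable_on_slice[OF w z]]
        by (simp add: mult_ac)
      then have "qcnj (slice_kernel \<alpha> i w (slice_embed i z)) = slice_embed i (\<Sum>n. of_real (bergman_coeff \<alpha> n) * w ^ n * cnj z ^ n)"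
        by (simp only: slice_kernel_on_slice[OF w z] qcnj_slice_embed[OF i])
      then show ?case by (simp only: mult.assoc slice_coord_mult[OF i] g_def)
    qed
  qed
  also have "\<dots> = g w" by (rule disc_reproducing[OF \<alpha> hol gint w])
  finally show "slice_coord i (f (slice_embed i w) * q) = slice_coord i (slice_inner \<alpha> i (slice_kernel \<alpha> i w) f * q)"
    by (simp add: g_def)
qed

lemma slice_kernel_diagonal:
  assumes w: "cmod w < 1"
  shows "slice_kernel \<alpha> i w (slice_embed i w) = of_real ((1 - (cmod w)\<^sup>2) powr (- (\<alpha> + 2)))"
proof -
  have "(\<lambda>n. bergman_coeff \<alpha> n * ((cmod w)\<^sup>2) ^ n) sums (1 - (cmod w)\<^sup>2) powr (- (\<alpha> + 2))"
    using w by (intro bergman_coeff_sums) (simp add: abs_square_less_1)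
  then have "(\<lambda>n. complex_of_real (bergman_coeff \<alpha> n * ((cmod w)\<^sup>2) ^ n)) sums complex_of_real ((1 - (cmod w)\<^sup>2) powr (- (\<alpha> + 2)))"
    by (rule sums_of_real)
  moreover have eq: "complex_of_real (bergman_coeff \<alpha> n * ((cmod w)\<^sup>2) ^ n) = of_real (bergman_coeff \<alpha> n) * w ^ n * cnj w ^ n" for n
    by (simp only: of_real_mult of_real_power[of "(cmod w)\<^sup>2" n] complex_norm_square power_mult_distrib mult.assoc)
  ultimately have "(\<Sum>n. of_real (bergman_coeff \<alpha> n) * w ^ n * cnj w ^ n) = complex_of_real ((1 - (cmod w)\<^sup>2) powr (- (\<alpha> + 2)))"
    by (simp only: eq sums_iff)
  then show ?thesis by (simp only: slice_kernel_on_slice[OF w w] slice_embed_of_real)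
qed

text \<open>A vanishing integral gives \<open>f = 0\<close> only almost everywhere on the slice.
  Each value of \<open>f\<close> on the slice is an integral against the kernel and hence zero, and
  the slice determines \<open>f\<close> on the ball.\<close>

lemma slice_inner_zeroD:
  assumes f: "f \<in> slice_bergman \<alpha> i" and zero: "qRe (slice_inner \<alpha> i f f) = 0"
  shows "f = 0"
proof -
  note [measurable] = measurable_on_slice[OF f]
  have "(LINT z|disc_area \<alpha>. (norm (f (slice_embed i z)))\<^sup>2) = 0"
    using zero unfolding slice_inner_self[OF f] by (simp only: qRe_of_real)
  then have AE0: "AE z in disc_area \<alpha>. (norm (f (slice_embed i z)))\<^sup>2 = 0"
    by (subst (asm) integral_nonneg_eq_0_iff_AE[OF integrable_sqnorm[OF f]]) auto
  have "f (slice_embed i w) = 0" if w: "cmod w < 1" for w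
  proof -
    note K = slice_kernel_mem[OF w]
    note [measurable] = measurable_on_slice[OF K]
    have "slice_inner \<alpha> i (slice_kernel \<alpha> i w) f = (LINT z|disc_area \<alpha>. (0::quat))"
      unfolding slice_inner_disc[OF K f]
    proof (rule integral_cong_AE)
      show "AE z in disc_area \<alpha>. qcnj (slice_kernel \<alpha> i w (slice_embed i z)) * f (slice_embed i z) = 0"
        using AE0 by eventually_elim simp
    qed measurable
    then show ?thesis using slice_kernel_reproducing[OF w f] by simp
  qed
  then have "f x = 0" for x
    using slice_hyperholomorphic_zero_on_slice[of f i x] f i by (cases "norm x < 1") (auto simp: slice_bergman_iff)
  then show ?thesis by (simp add: fun_eq_iff)
qed

lemma quat_inner_space_slice_bergman:
  "quat_inner_space (slice_bergman \<alpha> i) (\<lambda>f q x. f x * q) (slice_inner \<alpha> i)"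
proof
  fix f g h :: "quat \<Rightarrow> quat" and p q :: quat
  show "(\<lambda>x. (f + g) x * q) = (\<lambda>x. f x * q) + (\<lambda>x. g x * q)"
    "(\<lambda>x. f x * (p + q)) = (\<lambda>x. f x * p) + (\<lambda>x. f x * q)"
    "(\<lambda>x. f x * (p * q)) = (\<lambda>x. f x * p * q)" "(\<lambda>x. f x * 1) = f"
    by (simp_all add: fun_eq_iff algebra_simps)
  show "0 \<in> slice_bergman \<alpha> i" using zero_mem_slice_bergman by (simp add: zero_fun_def)
  assume f: "f \<in> slice_bergman \<alpha> i"
  show fq: "(\<lambda>x. f x * q) \<in> slice_bergman \<alpha> i" by (rule slice_bergman_mult_right[OF f])
  show "0 \<le> qRe (slice_inner \<alpha> i f f)" unfolding slice_inner_self[OF f] qRe_of_real by simp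
  show "f = 0" if "qRe (slice_inner \<alpha> i f f) = 0" using slice_inner_zeroD[OF f that] .
  assume g: "g \<in> slice_bergman \<alpha> i"
  show "f + g \<in> slice_bergman \<alpha> i" using slice_bergman_add[OF f g] by (simp add: plus_fun_def)
  show "slice_inner \<alpha> i f (\<lambda>x. g x * q) = slice_inner \<alpha> i f g * q"
    unfolding slice_inner_disc[OF f g] slice_inner_disc[OF f slice_bergman_mult_right[OF g]] mult.assoc[symmetric]
    by (rule integral_bounded_linear[OF bounded_linear_mult_left integrable_inner[OF f g]])
  show "qcnj (slice_inner \<alpha> i f g) = slice_inner \<alpha> i g f"
    unfolding slice_inner_disc[OF f g] slice_inner_disc[OF g f]
    by (subst integral_bounded_linear[OF bounded_linear_qcnj integrable_inner[OF f g], symmetric]) (simp add: qcnj_mult)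
  assume h: "h \<in> slice_bergman \<alpha> i"
  have gh: "g + h \<in> slice_bergman \<alpha> i" using slice_bergman_add[OF g h] by (simp add: plus_fun_def)
  show "slice_inner \<alpha> i f (g + h) = slice_inner \<alpha> i f g + slice_inner \<alpha> i f h"
    unfolding slice_inner_disc[OF f g] slice_inner_disc[OF f h] slice_inner_disc[OF f gh]
    by (subst Bochner_Integration.integral_add[symmetric]) (simp_all add: integrable_inner f g h distrib_left)
qed

interpretation B: quat_inner_space "slice_bergman \<alpha> i" "\<lambda>f q x. f x * q" "slice_inner \<alpha> i"
  by (rule quat_inner_space_slice_bergman)

text \<open>The difference \<open>d\<close> of two reproducing elements satisfies
  \<open><d, d> = d(w) - d(w) = 0\<close>, so the definite description is justified by
  definiteness.\<close>

lemma bergman_kernel_eq: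
  assumes w: "cmod w < 1"
  shows "bergman_kernel \<alpha> i (slice_embed i w) = slice_kernel \<alpha> i w"
  unfolding bergman_kernel_def
proof (rule the_equality)
  note K = slice_kernel_mem[OF w]
  show "slice_kernel \<alpha> i w \<in> slice_bergman \<alpha> i \<and>
      (\<forall>f\<in>slice_bergman \<alpha> i. f (slice_embed i w) = slice_inner \<alpha> i (slice_kernel \<alpha> i w) f)"
    using K slice_kernel_reproducing[OF w] by blast
  fix k assume k: "k \<in> slice_bergman \<alpha> i \<and> (\<forall>f\<in>slice_bergman \<alpha> i. f (slice_embed i w) = slice_inner \<alpha> i k f)"
  let ?d = "k - slice_kernel \<alpha> i w"
  have d: "?d \<in> slice_bergman \<alpha> i" using k K by (intro B.diff_mem) auto
  have "slice_inner \<alpha> i ?d ?d = slice_inner \<alpha> i k ?d - slice_inner \<alpha> i (slice_kernel \<alpha> i w) ?d"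
    using k K d by (intro B.ip_diff_left) auto
  also have "\<dots> = ?d (slice_embed i w) - ?d (slice_embed i w)"
    using bspec[OF conjunct2[OF k] d] slice_kernel_reproducing[OF w d] by simp
  finally have "?d = 0" using B.ip_self_zeroD[OF d] by simp
  then show "k = slice_kernel \<alpha> i w" by simp
qed

lemma slice_norm_power2: "f \<in> slice_bergman \<alpha> i \<Longrightarrow> (slice_norm \<alpha> i f)\<^sup>2 = B.sqn f"
  using B.sqn_nonneg[of f] by (simp add: slice_norm_def B.sqn_def)

lemma berezin_transform_on_slice:
  assumes T: "B.linear_op T" and w: "cmod w < 1"
  shows "qRe (berezin_transform \<alpha> i T (slice_embed i w)) =
    (1 - (cmod w)\<^sup>2) powr (\<alpha> + 2) * qRe (slice_inner \<alpha> i (slice_kernel \<alpha> i w) (T (slice_kernel \<alpha> i w)))"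
proof -
  note K = slice_kernel_mem[OF w]
  define N where "N = (1 - (cmod w)\<^sup>2) powr (- (\<alpha> + 2))"
  have pos: "1 - (cmod w)\<^sup>2 > 0" using w by (simp add: abs_square_less_1)
  have N0: "N > 0" using pos by (simp add: N_def)
  have "slice_inner \<alpha> i (slice_kernel \<alpha> i w) (slice_kernel \<alpha> i w) = of_real N"
    unfolding N_def by (rule trans[OF slice_kernel_reproducing[OF w K, symmetric] slice_kernel_diagonal[OF w]])
  then have "B.sqn (slice_kernel \<alpha> i w) = N" by (simp add: B.sqn_def)
  then have norm: "slice_norm \<alpha> i (slice_kernel \<alpha> i w) = sqrt N"
    by (simp add: slice_norm_def B.sqn_def)
  \<comment> \<open>The real normalising factor is rewritten as a right scalar, so that right
    linearity of \<open>T\<close> and of the scalar product applies.\<close>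
  have k: "normalized_kernel \<alpha> i (slice_embed i w) = (\<lambda>x. slice_kernel \<alpha> i w x * of_real (1 / sqrt N))"
    unfolding normalized_kernel_def bergman_kernel_eq[OF w] norm
    by (simp add: fun_eq_iff of_real_def divide_inverse)
  have TK: "T (slice_kernel \<alpha> i w) \<in> slice_bergman \<alpha> i" using B.linear_op_mem[OF T K] .
  have "berezin_transform \<alpha> i T (slice_embed i w) =
      of_real (1 / sqrt N) * slice_inner \<alpha> i (slice_kernel \<alpha> i w) (T (slice_kernel \<alpha> i w)) * of_real (1 / sqrt N)"
    unfolding berezin_transform_def k B.linear_op_rs[OF T K]
      B.ip_rs_left[OF K B.rs_mem[OF TK]] B.ip_rs_right[OF K TK] by (simp add: mult.assoc del: of_real_divide)
  also have "\<dots> = of_real (1 / sqrt N * (1 / sqrt N)) * slice_inner \<alpha> i (slice_kernel \<alpha> i w) (T (slice_kernel \<alpha> i w))"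
    by (simp only: of_real_mult mult.assoc of_real_mult_quat_commute[symmetric, where q = "slice_inner _ _ _ _"])
  also have "1 / sqrt N * (1 / sqrt N) = (1 - (cmod w)\<^sup>2) powr (\<alpha> + 2)"
  proof -
    have "N = inverse ((1 - (cmod w)\<^sup>2) powr (\<alpha> + 2))" unfolding N_def by (rule powr_minus)
    then have "inverse N = (1 - (cmod w)\<^sup>2) powr (\<alpha> + 2)" by (simp only: inverse_inverse_eq)
    moreover have "1 / sqrt N * (1 / sqrt N) = inverse N" using N0 by (simp add: inverse_eq_divide)
    ultimately show ?thesis by (simp only:)
  qed
  finally show ?thesis by simp
qed

lemma nn_integral_sqn:
  assumes f: "f \<in> slice_bergman \<alpha> i"
  shows "(\<integral>\<^sup>+z. ennreal ((norm (f z))\<^sup>2) \<partial>slice_area \<alpha> i) = ennreal (B.sqn f)"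
proof -
  note [measurable] = slice_bergman_measurable[OF f]
  have "(\<integral>\<^sup>+z. ennreal ((norm (f z))\<^sup>2) \<partial>slice_area \<alpha> i) =
      (\<integral>\<^sup>+z. ennreal ((norm (f (slice_embed i z)))\<^sup>2) \<partial>disc_area \<alpha>)"
    unfolding slice_area_distr[OF i] by (rule nn_integral_distr) measurable
  also have "\<dots> = ennreal (LINT z|disc_area \<alpha>. (norm (f (slice_embed i z)))\<^sup>2)"
    by (rule nn_integral_eq_integral[OF integrable_sqnorm[OF f]]) simp
  finally show ?thesis unfolding B.sqn_def slice_inner_self[OF f] qRe_of_real .
qed

text \<open>The square in the invariant density lowers the exponent \<open>\<alpha> + 2\<close> of
  the squared kernel norm to the exponent \<open>\<alpha>\<close> of the weight.\<close>

lemma nn_integral_moebius_area: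
  assumes [measurable]: "G \<in> borel_measurable borel"
  shows "ennreal (\<alpha> + 1) * (\<integral>\<^sup>+z. ennreal ((1 - (norm z)\<^sup>2) powr (\<alpha> + 2)) * G z \<partial>slice_moebius_area i) =
    (\<integral>\<^sup>+z. G z \<partial>slice_area \<alpha> i)"
proof -
  note [measurable] = slice_disc_borel[OF i]
  have L: "sets (slice_lebesgue i) = sets borel" by (simp add: slice_lebesgue_def)
  note [measurable_cong] = L
  have eq: "ennreal (\<alpha> + 1) * (ennreal (1 / (pi * (1 - (norm z)\<^sup>2)\<^sup>2)) * indicator (slice_disc i) z *
        (ennreal ((1 - (norm z)\<^sup>2) powr (\<alpha> + 2)) * G z)) =
      ennreal ((\<alpha> + 1) / pi * (1 - (norm z)\<^sup>2) powr \<alpha>) * indicator (slice_disc i) z * G z" for z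
  proof (cases "z \<in> slice_disc i")
    case True
    then have "norm z < 1" by (simp add: slice_disc_def)
    then have pos: "1 - (norm z)\<^sup>2 > 0" by (simp add: abs_square_less_1)
    have "(\<alpha> + 1) * (1 / (pi * (1 - (norm z)\<^sup>2)\<^sup>2) * (1 - (norm z)\<^sup>2) powr (\<alpha> + 2)) =
        (\<alpha> + 1) / pi * (1 - (norm z)\<^sup>2) powr \<alpha>"
      using pos by (simp add: powr_add powr_realpow[of _ 2, simplified])
    then have "ennreal (\<alpha> + 1) * (ennreal (1 / (pi * (1 - (norm z)\<^sup>2)\<^sup>2)) * ennreal ((1 - (norm z)\<^sup>2) powr (\<alpha> + 2))) =
        ennreal ((\<alpha> + 1) / pi * (1 - (norm z)\<^sup>2) powr \<alpha>)"
      using \<alpha> by (simp add: ennreal_mult'[symmetric])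
    then show ?thesis using True by (simp add: mult.assoc[symmetric])
  qed simp
  show ?thesis
    unfolding slice_moebius_area_def slice_area_def
    by (subst (1 2) nn_integral_density) (simp_all add: nn_integral_cmult[symmetric] eq)
qed

end

section \<open>The trace formula\<close>

lemma sum_fun_apply: "(\<Sum>b\<in>B. F b) x = (\<Sum>b\<in>B. F b x)"
  by (induction B rule: infinite_finite_induct) simp_all

theorem theorem5p11:
  fixes \<alpha> :: real and i :: quat
    and T :: "(quat \<Rightarrow> quat) \<Rightarrow> (quat \<Rightarrow> quat)" and s :: "nat \<Rightarrow> real"
  assumes "\<alpha> > -1" and "i \<in> imag_units"
    and "bounded_operator \<alpha> i T" and "positive_operator \<alpha> i T"
    and "singular_value_sequence \<alpha> i T s"
  shows "(\<Sum>n. ennreal (s n)) =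
    ennreal (\<alpha> + 1) *
      (\<integral>\<^sup>+ z. ennreal (qRe (berezin_transform \<alpha> i T z)) \<partial>slice_moebius_area i)"
proof -
  note \<alpha> = assms(1) and i = assms(2)
  let ?H = "slice_bergman \<alpha> i"
  interpret B: quat_inner_space ?H "\<lambda>f q x. f x * q" "slice_inner \<alpha> i"
    by (rule quat_inner_space_slice_bergman[OF \<alpha> i])
  have linear: "B.linear_op P" if "bounded_operator \<alpha> i P" for P
    using that by (auto simp: bounded_operator_def B.linear_op_def plus_fun_def)
  have positive: "B.positive_op P" if "bounded_operator \<alpha> i P" "positive_operator \<alpha> i P" for P
    using that linear by (auto simp: positive_operator_def B.positive_op_def)
  note norm2 = slice_norm_power2[OF \<alpha> i]
  have norm_nonneg: "0 \<le> slice_norm \<alpha> i f" if "f \<in> ?H" for f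
    using B.ip_self_nonneg[OF that] by (simp add: slice_norm_def)
  have T: "B.positive_op T" using positive assms(3,4) .
  have linT: "B.linear_op T" using linear assms(3) .
  obtain C where C: "\<And>f. f \<in> ?H \<Longrightarrow> slice_norm \<alpha> i (T f) \<le> C * slice_norm \<alpha> i f"
    using assms(3) unfolding bounded_operator_def by blast
  have bdd: "B.sqn (T f) \<le> C\<^sup>2 * B.sqn f" if f: "f \<in> ?H" for f
  proof -
    have Tf: "T f \<in> ?H" by (rule B.linear_op_mem[OF linT f])
    have "(slice_norm \<alpha> i (T f))\<^sup>2 \<le> (C * slice_norm \<alpha> i f)\<^sup>2"
      by (rule power_mono[OF C[OF f] norm_nonneg[OF Tf]])
    then show ?thesis by (simp add: power_mult_distrib norm2 f Tf)
  qed
  obtain S where cpt0: "compact_operator \<alpha> i T" and mod: "modulus_operator \<alpha> i T S"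
    and dec: "decseq s" and s0: "\<And>n. s n \<ge> 0"
    and fin: "\<And>t. t > 0 \<Longrightarrow> finite {n. s n = t}"
    and dim: "\<And>t. t > 0 \<Longrightarrow> has_right_dim (eigenspace \<alpha> i S t) (card {n. s n = t})"
    using assms(5) unfolding singular_value_sequence_def by blast
  have cpt: "B.compact_op T"
    unfolding B.compact_op_def
  proof (intro allI impI)
    fix F :: "nat \<Rightarrow> quat \<Rightarrow> quat" and K
    assume F: "\<forall>n. F n \<in> ?H \<and> B.sqn (F n) \<le> K"
    then have "\<forall>n. F n \<in> ?H \<and> slice_norm \<alpha> i (F n) \<le> sqrt K"
      by (simp add: slice_norm_def B.sqn_def)
    then obtain r g where r: "strict_mono r" and g: "g \<in> ?H"
      and lim: "(\<lambda>n. slice_norm \<alpha> i (\<lambda>x. T (F (r n)) x - g x)) \<longlonglongrightarrow> 0"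
      using cpt0 unfolding compact_operator_def by blast
    have mem: "T (F (r n)) - g \<in> ?H" for n using F g B.linear_op_mem[OF linT] by blast
    have "(\<lambda>n. (slice_norm \<alpha> i (T (F (r n)) - g))\<^sup>2) \<longlonglongrightarrow> 0\<^sup>2"
      by (rule tendsto_power) (use lim in \<open>simp add: fun_diff_def\<close>)
    then have "(\<lambda>n. B.sqn (T (F (r n)) - g)) \<longlonglongrightarrow> 0" by (simp add: norm2[OF mem])
    then show "\<exists>r g. strict_mono r \<and> g \<in> ?H \<and> (\<lambda>n. B.sqn (T (F (r n)) - g)) \<longlonglongrightarrow> 0"
      using r g by blast
  qed
  obtain A where S: "B.positive_op S" and A: "adjoint_operator \<alpha> i T A"
    and SS: "\<And>f. f \<in> ?H \<Longrightarrow> S (S f) = A (T f)"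
    using mod positive unfolding modulus_operator_def by blast
  \<comment> \<open>\<open>T\<close> is self-adjoint, so its adjoint agrees with it on the space.
    Hence \<open>S\<close> and \<open>T\<close> are positive operators with the same square, which
    gives equal eigenspaces for positive eigenvalues.\<close>
  have AT: "A f = T f" if f: "f \<in> ?H" for f
  proof -
    have mem: "A f \<in> ?H" "T f \<in> ?H"
      using A f B.linear_op_mem[OF linT f] by (auto simp: adjoint_operator_def bounded_operator_def)
    then have d: "A f - T f \<in> ?H" by blast
    have "slice_inner \<alpha> i (A f) (A f - T f) = slice_inner \<alpha> i (T f) (A f - T f)"
      using A f d B.positive_op_selfadjoint[OF T f d] by (simp add: adjoint_operator_def)
    then have "slice_inner \<alpha> i (A f - T f) (A f - T f) = 0"
      using B.ip_diff_left[OF mem d] by simp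
    then have "A f - T f = 0" using B.ip_self_zeroD[OF d] by simp
    then show ?thesis by simp
  qed
  have SSTT: "S (S f) = T (T f)" if "f \<in> ?H" for f
    using SS[OF that] AT[OF B.linear_op_mem[OF linT that]] by simp
  have eigen: "{f \<in> ?H. T f = (\<lambda>x. f x * of_real t)} = eigenspace \<alpha> i S t" if t: "t > 0" for t
    unfolding eigenspace_def
    using B.eigenvector_of_square_root[OF T S SSTT[symmetric] _ t] B.eigenvector_of_square_root[OF S T SSTT _ t]
    by blast
  have "\<exists>B. finite B \<and> card B = card {n. s n = t} \<and>
      {f \<in> ?H. T f = (\<lambda>x. f x * of_real t)} = B.rspan B \<and>
      (\<forall>c. (\<Sum>b\<in>B. (\<lambda>x. b x * c b)) = 0 \<longrightarrow> (\<forall>b\<in>B. c b = 0))" if t: "t > 0" for t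
  proof -
    have eq: "(\<Sum>b\<in>B. (\<lambda>x. b x * c b)) = (\<lambda>x. \<Sum>b\<in>B. b x * c b)" for B and c :: "(quat \<Rightarrow> quat) \<Rightarrow> quat"
      by (simp add: fun_eq_iff sum_fun_apply)
    show ?thesis
      using dim[OF t] unfolding has_right_dim_def eigen[OF t] B.rspan_def eq by (simp add: fun_eq_iff)
  qed
  from B.compact_positive_diagonal[OF T cpt bdd dec s0 fin this]
  obtain e where eH: "\<And>n. e n \<in> ?H" and sqn_e: "\<And>n. B.sqn (e n) = (if s n > 0 then 1 else 0)"
    and diag: "\<And>f. f \<in> ?H \<Longrightarrow> (\<lambda>n. s n * (norm (slice_inner \<alpha> i (e n) f))\<^sup>2) sums qRe (slice_inner \<alpha> i f (T f))"
    by blast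
  \<comment> \<open>On the slice disc \<open>G z\<close> is \<open><K_z, T K_z>\<close>. Written as
    a series it is visibly Borel measurable on all quaternions.\<close>
  define G where "G z = (\<Sum>n. ennreal (s n) * ennreal ((norm (e n z))\<^sup>2))" for z
  have em [measurable]: "e n \<in> borel_measurable borel" for n
    by (rule slice_bergman_measurable[OF eH])
  have Gm: "G \<in> borel_measurable borel" unfolding G_def by measurable
  have berezin: "ennreal (qRe (berezin_transform \<alpha> i T z)) = ennreal ((1 - (norm z)\<^sup>2) powr (\<alpha> + 2)) * G z"
    if z: "z \<in> slice_disc i" for z
  proof -
    obtain w where w: "cmod w < 1" "z = slice_embed i w"
      using z unfolding slice_disc_eq[OF i] by auto
    note K = slice_kernel_mem[OF \<alpha> i w(1)]
    let ?K = "slice_kernel \<alpha> i w"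
    \<comment> \<open>The reproducing property gives \<open>e n z\<close> as the scalar product in
      the opposite order; conjugation keeps the norm.\<close>
    have "norm (slice_inner \<alpha> i (e n) ?K) = norm (e n z)" for n
      using slice_kernel_reproducing[OF \<alpha> i w(1) eH] B.ip_cnj[OF K eH] norm_qcnj by (metis w(2))
    then have "(\<lambda>n. s n * (norm (e n z))\<^sup>2) sums qRe (slice_inner \<alpha> i ?K (T ?K))"
      using diag[OF K] by simp
    then have "(\<Sum>n. ennreal (s n * (norm (e n z))\<^sup>2)) = ennreal (qRe (slice_inner \<alpha> i ?K (T ?K)))"
      using s0 by (intro suminf_ennreal_eq) simp_all
    then have "G z = ennreal (qRe (slice_inner \<alpha> i ?K (T ?K)))"
      unfolding G_def using s0 by (simp add: ennreal_mult)
    then show ?thesis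
      unfolding w(2) berezin_transform_on_slice[OF \<alpha> i linT w(1)] using i by (simp add: ennreal_mult')
  qed
  \<comment> \<open>The identity \<open>berezin\<close> holds on the slice disc only, and the
    invariant measure is concentrated there.\<close>
  have "AE z in slice_moebius_area i. z \<in> slice_disc i"
  proof -
    have "sets (slice_lebesgue i) = sets borel" by (simp add: slice_lebesgue_def)
    note [measurable_cong] = this and [measurable] = slice_disc_borel[OF i]
    show ?thesis unfolding slice_moebius_area_def by (subst AE_density) (auto simp: indicator_def)
  qed
  then have "(\<integral>\<^sup>+ z. ennreal (qRe (berezin_transform \<alpha> i T z)) \<partial>slice_moebius_area i) =
      (\<integral>\<^sup>+ z. ennreal ((1 - (norm z)\<^sup>2) powr (\<alpha> + 2)) * G z \<partial>slice_moebius_area i)"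
    by (intro nn_integral_cong_AE) (auto elim!: eventually_mono simp: berezin)
  then have "ennreal (\<alpha> + 1) * (\<integral>\<^sup>+ z. ennreal (qRe (berezin_transform \<alpha> i T z)) \<partial>slice_moebius_area i) =
      (\<integral>\<^sup>+ z. G z \<partial>slice_area \<alpha> i)"
    using nn_integral_moebius_area[OF \<alpha> i Gm] by simp
  also have "\<dots> = (\<Sum>n. \<integral>\<^sup>+ z. ennreal (s n) * ennreal ((norm (e n z))\<^sup>2) \<partial>slice_area \<alpha> i)"
    unfolding G_def slice_area_distr[OF i] by (rule nn_integral_suminf) measurable
  also have "\<dots> = (\<Sum>n. ennreal (s n) * ennreal (B.sqn (e n)))"
  proof (rule suminf_cong)
    fix n
    show "(\<integral>\<^sup>+ z. ennreal (s n) * ennreal ((norm (e n z))\<^sup>2) \<partial>slice_area \<alpha> i) = ennreal (s n) * ennreal (B.sqn (e n))"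
      unfolding nn_integral_sqn[OF \<alpha> i eH, symmetric] slice_area_distr[OF i]
      by (rule nn_integral_cmult) measurable
  qed
  \<comment> \<open>The vectors \<open>e n\<close> are unit vectors where \<open>s n > 0\<close>;
    for \<open>s n = 0\<close> both summands vanish.\<close>
  also have "\<dots> = (\<Sum>n. ennreal (s n))"
    using s0 by (intro suminf_cong) (auto simp: sqn_e not_less intro: antisym)
  finally show ?thesis by simp
qed

end
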